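(* Let $H=\left[\frac{1}{m+n+1}\right]_{m,n=0}^\infty$ be the Hilbert matrix, viewed as a bounded operator on $\ell^2$, and let $h(\tau)=\frac{\pi}{\cosh(\pi\tau)}$ for $\tau\in(0,\infty)$. For $T\in\mathcal{B}(\ell^2)$, regarded as an infinite matrix, the following are equivalent. (i) $T^2=H$. (ii) There is a (complex-valued) measurable function $g$ on $(0,\infty)$ with $g^2=h$ such that $$T=\left[\int_0^\infty g(x)w_m(x)\overline{w_n(x)}\,dx\right]_{m,n=0}^\infty.$$
   Context: $\mathcal{B}(\ell^2)$ denotes the bounded linear operators on $\ell^2=\ell^2(\{0,1,2,\dots\})$, identified with their matrices in the standard basis. The functions $w_n$ are defined as follows. Let $L_n$, $n\ge0$, be the Laguerre polynomials, an orthonormal basis of $L^2((0,\infty),e^{-x}dx)$, and let $(Qf)(x)=e^{-x/2}f(x)$, a unitary operator from $L^2((0,\infty),e^{-x}dx)$ onto $L^2((0,\infty),dx)$. Let $K_\nu(z)=\int_0^\infty e^{-z\cosh t}\cosh(\nu t)\,dt$ be the modified Bessel function of the third kind, and let $$(Uf)(\tau)=\int_0^\infty\frac{\sqrt{2\tau\sinh(\pi\tau)}}{\pi\sqrt{x}}\,K_{i\tau}\!\left(\frac{x}{2}\right)f(x)\,dx,$$ which is a unitary operator from $L^2((0,\infty),dx)$ onto itself (Lebedev). Then $w_n=UQL_n$ for $n\ge0$; these form an orthonormal basis of $L^2((0,\infty),dx)$. *)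

theory Defs
  imports "HOL-Analysis.Analysis"
begin

definition ell2 :: "(nat \<Rightarrow> complex) set" where
  "ell2 = {x. summable (\<lambda>n. (cmod (x n))\<^sup>2)}"

definition ell2_norm :: "(nat \<Rightarrow> complex) \<Rightarrow> real" where
  "ell2_norm x = sqrt (\<Sum>n. (cmod (x n))\<^sup>2)"

definition ell2_basis :: "nat \<Rightarrow> nat \<Rightarrow> complex" where
  "ell2_basis n = (\<lambda>k. if k = n then 1 else 0)"

text \<open>Operators on \<open>ell2\<close> are functions on all sequences; only their values on \<open>ell2\<close> are
  meaningful, so equality of operators always means equality on \<open>ell2\<close>.\<close>

definition bounded_op_ell2 :: "((nat \<Rightarrow> complex) \<Rightarrow> (nat \<Rightarrow> complex)) \<Rightarrow> bool" where
  "bounded_op_ell2 T \<longleftrightarrow>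
     (\<forall>x\<in>ell2. T x \<in> ell2) \<and>
     (\<forall>x\<in>ell2. \<forall>y\<in>ell2. T (\<lambda>k. x k + y k) = (\<lambda>k. T x k + T y k)) \<and>
     (\<forall>c. \<forall>x\<in>ell2. T (\<lambda>k. c * x k) = (\<lambda>k. c * T x k)) \<and>
     (\<exists>C. \<forall>x\<in>ell2. ell2_norm (T x) \<le> C * ell2_norm x)"

text \<open>The entry in row \<open>m\<close> and column \<open>n\<close> is the \<open>m\<close>-th coordinate of the image of the
  \<open>n\<close>-th basis vector.\<close>

definition matrix_of_op ::
    "((nat \<Rightarrow> complex) \<Rightarrow> (nat \<Rightarrow> complex)) \<Rightarrow> nat \<Rightarrow> nat \<Rightarrow> complex" where
  "matrix_of_op T m n = T (ell2_basis n) m"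

definition op_of_matrix ::
    "(nat \<Rightarrow> nat \<Rightarrow> complex) \<Rightarrow> (nat \<Rightarrow> complex) \<Rightarrow> (nat \<Rightarrow> complex)" where
  "op_of_matrix A x = (\<lambda>m. \<Sum>n. A m n * x n)"

definition hilbert_matrix :: "nat \<Rightarrow> nat \<Rightarrow> complex" where
  "hilbert_matrix m n = 1 / (of_nat m + of_nat n + 1)"

text \<open>The rows of the Hilbert matrix are square-summable, so the series in \<open>op_of_matrix\<close>
  converges absolutely at every point of \<open>ell2\<close>; boundedness is Hilbert's inequality.\<close>

definition hilbert_op :: "(nat \<Rightarrow> complex) \<Rightarrow> (nat \<Rightarrow> complex)" where
  "hilbert_op = op_of_matrix hilbert_matrix"

definition laguerre :: "nat \<Rightarrow> real \<Rightarrow> real" where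
  "laguerre n x = (\<Sum>k\<le>n. real (n choose k) * (-1) ^ k / fact k * x ^ k)"

definition bessel_K :: "complex \<Rightarrow> complex \<Rightarrow> complex" where
  "bessel_K \<nu> z =
     (LINT t|lebesgue_on {0<..}. exp (- z * cosh (complex_of_real t)) * cosh (\<nu> * complex_of_real t))"

definition Q_op :: "(real \<Rightarrow> complex) \<Rightarrow> real \<Rightarrow> complex" where
  "Q_op f x = complex_of_real (exp (- x / 2)) * f x"

text \<open>For a general square-integrable \<open>f\<close> the unitary operator needs an improper
  integral or an extension by continuity.  For \<open>f = Q_op p\<close> with \<open>p\<close> a polynomial, the only
  case used here, the integral converges absolutely for every \<open>\<tau> > 0\<close>.\<close>

definition U_op :: "(real \<Rightarrow> complex) \<Rightarrow> real \<Rightarrow> complex" where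
  "U_op f \<tau> =
     (LINT x|lebesgue_on {0<..}.
        complex_of_real (sqrt (2 * \<tau> * sinh (pi * \<tau>)) / (pi * sqrt x)) *
        bessel_K (\<i> * complex_of_real \<tau>) (complex_of_real (x / 2)) * f x)"

definition w :: "nat \<Rightarrow> real \<Rightarrow> complex" where
  "w n = U_op (Q_op (\<lambda>x. complex_of_real (laguerre n x)))"

definition h :: "real \<Rightarrow> real" where
  "h \<tau> = pi / cosh (pi * \<tau>)"

end

theory Submission
  imports Defs "HOL-Real_Asymp.Real_Asymp"
begin

text \<open>
  Substituting the integral for \<open>bessel_K\<close> and integrating in \<open>x\<close> first turns \<open>w n \<tau>\<close> into
  \<open>sqrt (weight \<tau>)\<close> times an explicit polynomial in \<open>\<tau>\<^sup>2\<close> (a continuous dual Hahn polynomial), a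
  combination of the products \<open>quadprod k \<tau> = (\<Prod>j<k. (j + 1/2)\<^sup>2 + \<tau>\<^sup>2)\<close>.  The moments of
  \<open>quadprod j * quadprod k\<close> against \<open>weight\<close> and \<open>weight * h\<close> have closed forms, because \<open>sech\<close> is
  its own cosine transform up to scaling; hence the \<open>w n\<close> are orthonormal and multiplication by
  \<open>h\<close> has the Hilbert matrix as its matrix.

  For completeness, the functions orthogonal to all \<open>w n\<close> are those with vanishing even moments
  against \<open>sqrt weight\<close>.  As \<open>weight\<close> decays exponentially, this class is stable under
  multiplication by \<open>cos (s \<tau>)\<close>, hence by the cosine transform \<open>h\<close>, hence by its powers, and \<open>h\<close>
  is strictly monotone, so such a function is zero almost everywhere by Weierstrass approximation.

  If \<open>T\<^sup>2 = H\<close>, let \<open>F\<close> and \<open>v m\<close> be the functions with coefficient sequences \<open>T e\<^sub>0\<close> and the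
  \<open>m\<close>-th row of \<open>T\<close>.  As \<open>T\<close> commutes with \<open>H\<close>, evaluating \<open>T H\<^sup>j e\<^sub>0\<close> and \<open>T T H\<^sup>j e\<^sub>0\<close> in two ways
  for all \<open>j\<close> gives \<open>v m * w 0 = F * w m\<close> and \<open>F\<^sup>2 = h * (w 0)\<^sup>2\<close> almost everywhere, so
  \<open>g = F / w 0\<close> works up to a null set.  The converse is Parseval's identity.
\<close>

section \<open>Square-integrable functions and orthonormal bases\<close>

text \<open>\<open>T\<close> is not assumed normal, so no functional calculus applies. What replaces
  it is that e_0 is a cyclic vector for H: on the function side it is \<open>w 0\<close>, which has
  no zero for \<tau> > 0, and an integrable function is determined almost everywhere by its
  integrals against the powers of the injective function \<open>h\<close>. An operator commuting
  with H must then be a multiplication, and this is tested by comparing integrals of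
  \<open>h ^ j\<close> against products of two L2 functions. The same uniqueness statement closes
  the completeness proof.

  Orthonormality and completeness of the \<open>w n\<close> are derived from their closed form,
  without appeal to the unitarity of the Lebedev transform. The closed form rests on x/2 + x/2 cosh
  t = x cosh(t/2)^2: the x-integral becomes a Gamma integral that leaves sech(t/2)^(2k+1), whose
  cosine transform is, up to a constant, \<open>h\<close> times \<open>quadprod k\<close>.

  The \<open>w n\<close> are real, so pairings are taken without conjugation; the matrices in
  question are symmetric, but in general not Hermitian.\<close>

definition L2 :: "'a measure \<Rightarrow> ('a \<Rightarrow> complex) \<Rightarrow> bool" where
  "L2 M f \<longleftrightarrow> f \<in> borel_measurable M \<and> integrable M (\<lambda>x. (cmod (f x))\<^sup>2)"

lemma L2_measurable: "L2 M f \<Longrightarrow> f \<in> borel_measurable M"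
  and L2_integrable: "L2 M f \<Longrightarrow> integrable M (\<lambda>x. (cmod (f x))\<^sup>2)"
  by (auto simp: L2_def)

text \<open>This weighted inequality does duty for Cauchy-Schwarz. The parameter is 1 for
  integrability of products and for Bessel, large in limits of pairings, and \<open>2^k\<close> in
  the Riesz-Fischer argument.\<close>

lemma norm_mult_le_half_squares:
  fixes a b :: "'a::real_normed_div_algebra"
  assumes "c > 0"
  shows "2 * norm (a * b) \<le> c * (norm a)\<^sup>2 + (norm b)\<^sup>2 / c"
proof -
  have "0 \<le> (c * norm a - norm b)\<^sup>2 / c" using assms by simp
  also have "\<dots> = c * (norm a)\<^sup>2 + (norm b)\<^sup>2 / c - 2 * norm (a * b)"
    using assms by (simp add: power2_eq_square norm_mult field_simps)
  finally show ?thesis by simp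
qed

lemma L2_mult_integrable:
  assumes "L2 M f" "L2 M g"
  shows "integrable M (\<lambda>x. f x * g x)"
proof (rule Bochner_Integration.integrable_bound)
  show "integrable M (\<lambda>x. (cmod (f x))\<^sup>2 + (cmod (g x))\<^sup>2)"
    using assms by (simp add: L2_def)
  show "(\<lambda>x. f x * g x) \<in> borel_measurable M"
    using assms by (intro borel_measurable_times) (auto simp: L2_def)
  show "AE x in M. norm (f x * g x) \<le> norm ((cmod (f x))\<^sup>2 + (cmod (g x))\<^sup>2)"
  proof (rule AE_I2)
    fix x
    have "norm (f x * g x) \<ge> 0" by simp
    then show "norm (f x * g x) \<le> norm ((cmod (f x))\<^sup>2 + (cmod (g x))\<^sup>2)"
      using norm_mult_le_half_squares[of 1 "f x" "g x"] unfolding real_norm_def by linarith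
  qed
qed

lemma L2_bound:
  assumes "L2 M f" "g \<in> borel_measurable M" "AE x in M. cmod (g x) \<le> C * cmod (f x)" "C \<ge> 0"
  shows "L2 M g"
  unfolding L2_def
proof (intro conjI)
  show "integrable M (\<lambda>x. (cmod (g x))\<^sup>2)"
  proof (rule Bochner_Integration.integrable_bound)
    show "integrable M (\<lambda>x. C\<^sup>2 * (cmod (f x))\<^sup>2)"
      using assms(1) by (simp add: L2_def)
    show "(\<lambda>x. (cmod (g x))\<^sup>2) \<in> borel_measurable M" using assms(2) by measurable
    show "AE x in M. norm ((cmod (g x))\<^sup>2) \<le> norm (C\<^sup>2 * (cmod (f x))\<^sup>2)"
      using assms(3)
    proof eventually_elim
      case (elim x)
      then have "(cmod (g x))\<^sup>2 \<le> (C * cmod (f x))\<^sup>2" by (intro power_mono) auto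
      then show ?case by (simp add: power_mult_distrib)
    qed
  qed
qed (fact assms)

lemma L2_add:
  assumes "L2 M f" "L2 M g"
  shows "L2 M (\<lambda>x. f x + g x)"
  unfolding L2_def
proof (intro conjI)
  show "(\<lambda>x. f x + g x) \<in> borel_measurable M"
    using assms by (intro borel_measurable_add) (auto simp: L2_def)
  show "integrable M (\<lambda>x. (cmod (f x + g x))\<^sup>2)"
  proof (rule Bochner_Integration.integrable_bound)
    show "integrable M (\<lambda>x. 2 * (cmod (f x))\<^sup>2 + 2 * (cmod (g x))\<^sup>2)"
      using assms by (simp add: L2_def)
    show "(\<lambda>x. (cmod (f x + g x))\<^sup>2) \<in> borel_measurable M"
      using assms by (intro borel_measurable_power borel_measurable_norm borel_measurable_add)
        (auto simp: L2_def)
    show "AE x in M. norm ((cmod (f x + g x))\<^sup>2) \<le> norm (2 * (cmod (f x))\<^sup>2 + 2 * (cmod (g x))\<^sup>2)"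
    proof (rule AE_I2)
      fix x
      have "(cmod (f x + g x))\<^sup>2 \<le> (cmod (f x) + cmod (g x))\<^sup>2"
        by (intro power_mono norm_triangle_ineq) auto
      also have "\<dots> \<le> 2 * (cmod (f x))\<^sup>2 + 2 * (cmod (g x))\<^sup>2"
        using sum_squares_bound[of "cmod (f x)" "cmod (g x)"] by (simp add: power2_sum)
      finally show "norm ((cmod (f x + g x))\<^sup>2) \<le> norm (2 * (cmod (f x))\<^sup>2 + 2 * (cmod (g x))\<^sup>2)"
        by simp
    qed
  qed
qed

lemma L2_cmult: "L2 M f \<Longrightarrow> L2 M (\<lambda>x. c * f x)"
  by (rule L2_bound[of M f _ "cmod c"]) (auto simp: norm_mult L2_def)

lemma L2_zero: "L2 M (\<lambda>x. 0)"
  by (simp add: L2_def)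

lemma L2_diff: "L2 M f \<Longrightarrow> L2 M g \<Longrightarrow> L2 M (\<lambda>x. f x - g x)"
  using L2_add[of M f "\<lambda>x. (-1) * g x"] L2_cmult[of M g "-1"] by simp

lemma L2_sum: "(\<And>i. i \<in> A \<Longrightarrow> L2 M (f i)) \<Longrightarrow> L2 M (\<lambda>x. \<Sum>i\<in>A. f i x)"
  by (induction A rule: infinite_finite_induct) (auto intro: L2_add simp: L2_zero)

lemma L2_tendsto_integral_mult:
  assumes f: "\<And>n. L2 M (f n)" and F: "L2 M F" and g: "L2 M g"
    and lim: "(\<lambda>n. \<integral>x. (cmod (f n x - F x))\<^sup>2 \<partial>M) \<longlonglongrightarrow> 0"
  shows "(\<lambda>n. \<integral>x. f n x * g x \<partial>M) \<longlonglongrightarrow> (\<integral>x. F x * g x \<partial>M)"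
proof (rule LIMSEQ_I)
  fix \<epsilon> :: real assume \<epsilon>: "\<epsilon> > 0"
  define B where "B = (\<integral>x. (cmod (g x))\<^sup>2 \<partial>M)"
  have B: "B \<ge> 0" by (simp add: B_def)
  \<comment> \<open>The weight pushes the fixed part \<open>B / a\<close> below \<epsilon>; the
    other part tends to 0 with \<open>n\<close>. The summand 1 keeps \<open>a\<close> positive when
    \<open>B = 0\<close>.\<close>
  define a where "a = (B + 1) / \<epsilon>"
  have a: "a > 0" using B \<epsilon> by (simp add: a_def)
  have Ba: "B / a < \<epsilon>" using B \<epsilon> by (simp add: a_def field_simps)
  have bound: "2 * cmod ((\<integral>x. f n x * g x \<partial>M) - (\<integral>x. F x * g x \<partial>M)) \<le>
      a * (\<integral>x. (cmod (f n x - F x))\<^sup>2 \<partial>M) + B / a" for n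
  proof -
    have d: "L2 M (\<lambda>x. f n x - F x)" by (intro L2_diff f F)
    have "cmod ((\<integral>x. f n x * g x \<partial>M) - (\<integral>x. F x * g x \<partial>M)) =
        cmod (\<integral>x. (f n x - F x) * g x \<partial>M)"
      by (subst Bochner_Integration.integral_diff[symmetric])
        (auto intro: L2_mult_integrable f F g simp: algebra_simps)
    also have "\<dots> \<le> (\<integral>x. cmod ((f n x - F x) * g x) \<partial>M)" by simp
    finally have "2 * cmod ((\<integral>x. f n x * g x \<partial>M) - (\<integral>x. F x * g x \<partial>M)) \<le>
        (\<integral>x. 2 * cmod ((f n x - F x) * g x) \<partial>M)" by simp
    also have "\<dots> \<le> (\<integral>x. a * (cmod (f n x - F x))\<^sup>2 + (cmod (g x))\<^sup>2 / a \<partial>M)"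
    proof (rule integral_mono)
      show "integrable M (\<lambda>x. 2 * cmod ((f n x - F x) * g x))"
        using integrable_norm[OF L2_mult_integrable[OF d g]] by simp
      show "integrable M (\<lambda>x. a * (cmod (f n x - F x))\<^sup>2 + (cmod (g x))\<^sup>2 / a)"
        using d g by (simp add: L2_def)
    qed (rule norm_mult_le_half_squares[OF a])
    also have "\<dots> = a * (\<integral>x. (cmod (f n x - F x))\<^sup>2 \<partial>M) + B / a"
      using d g by (subst Bochner_Integration.integral_add) (auto simp: L2_def B_def)
    finally show ?thesis .
  qed
  obtain N where N: "\<And>n. n \<ge> N \<Longrightarrow> norm ((\<integral>x. (cmod (f n x - F x))\<^sup>2 \<partial>M) - 0) < \<epsilon> / a"
    using LIMSEQ_D[OF lim, of "\<epsilon> / a"] a \<epsilon> by auto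
  have "cmod ((\<integral>x. f n x * g x \<partial>M) - (\<integral>x. F x * g x \<partial>M)) < \<epsilon>" if "n \<ge> N" for n
  proof -
    have "(\<integral>x. (cmod (f n x - F x))\<^sup>2 \<partial>M) < \<epsilon> / a" using N[OF that] by simp
    then have "a * (\<integral>x. (cmod (f n x - F x))\<^sup>2 \<partial>M) < \<epsilon>" using a by (simp add: field_simps)
    then show ?thesis using bound[of n] Ba by linarith
  qed
  then show "\<exists>no. \<forall>n\<ge>no. cmod ((\<integral>x. f n x * g x \<partial>M) - (\<integral>x. F x * g x \<partial>M)) < \<epsilon>"
    by blast
qed

text \<open>Real basis functions make the pairing bilinear, which suits products such as
  \<open>g * w m * w n\<close>. Completeness is left to a second locale, since Riesz-Fischer and
  Bessel hold for every such system.\<close>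

locale real_orthonormal_system =
  fixes M :: "'a measure" and e :: "nat \<Rightarrow> 'a \<Rightarrow> complex"
  assumes e_L2: "L2 M (e n)"
    and e_real: "cnj (e n x) = e n x"
    and e_orth: "(\<integral>x. e m x * e n x \<partial>M) = (if m = n then 1 else 0)"
begin

lemma integral_norm_square_sum:
  assumes "finite A"
  shows "(\<integral>x. (cmod (\<Sum>n\<in>A. c n * e n x))\<^sup>2 \<partial>M) = (\<Sum>n\<in>A. (cmod (c n))\<^sup>2)"
proof -
  let ?s = "\<lambda>x. \<Sum>n\<in>A. c n * e n x"
  have s: "L2 M ?s" by (intro L2_sum L2_cmult e_L2)
  have i: "integrable M (\<lambda>x. c m * cnj (c n) * (e m x * e n x))" for m n
    using L2_mult_integrable[OF e_L2[of m] e_L2[of n]] by (rule integrable_mult_right)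
  have "complex_of_real (\<integral>x. (cmod (?s x))\<^sup>2 \<partial>M) = (\<integral>x. complex_of_real ((cmod (?s x))\<^sup>2) \<partial>M)"
    by (rule Bochner_Integration.integral_of_real[OF L2_integrable[OF s], symmetric])
  also have "\<dots> = (\<integral>x. (\<Sum>m\<in>A. \<Sum>n\<in>A. c m * cnj (c n) * (e m x * e n x)) \<partial>M)"
    unfolding complex_norm_square
    by (intro Bochner_Integration.integral_cong refl)
      (simp add: e_real sum_product mult_ac)
  also have "\<dots> = (\<Sum>m\<in>A. \<Sum>n\<in>A. c m * cnj (c n) * (if m = n then 1 else 0))"
    using i by (simp add: e_orth)
  also have "\<dots> = complex_of_real (\<Sum>n\<in>A. (cmod (c n))\<^sup>2)"
    using assms by (simp add: sum.delta if_distrib cong: if_cong)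
      (intro sum.cong refl, simp flip: of_real_power complex_norm_square)
  finally show ?thesis by (simp only: of_real_eq_iff)
qed

text \<open>The mean square distance of two partial sums is bounded by a tail of a convergent
  series. A fast subsequence converges almost everywhere, which supplies \<open>F\<close>; Fatou
  along that subsequence bounds the distance of every partial sum from \<open>F\<close> by the
  tail.\<close>

lemma riesz_fischer_limit:
  assumes x: "summable (\<lambda>n. (cmod (x n))\<^sup>2)"
  obtains F where "L2 M F"
    "(\<lambda>N. \<integral>t. (cmod ((\<Sum>n<N. x n * e n t) - F t))\<^sup>2 \<partial>M) \<longlonglongrightarrow> 0"
proof -
  define s where "s = (\<lambda>N t. \<Sum>n<N. x n * e n t)"
  define tail where "tail = (\<lambda>K. \<Sum>n. (cmod (x (n + K)))\<^sup>2)"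
  have s_L2: "L2 M (s N)" for N unfolding s_def by (intro L2_sum L2_cmult e_L2)
  have s_meas[measurable]: "s N \<in> borel_measurable M" for N using s_L2 by (simp add: L2_def)
  have diff_L2: "L2 M (\<lambda>t. s N t - s K t)" for N K by (intro L2_diff s_L2)
  have tail_le: "(\<Sum>n\<in>{K..<N}. (cmod (x n))\<^sup>2) \<le> tail K" if "K \<le> N" for K N
  proof -
    have "(\<Sum>n\<in>{K..<N}. (cmod (x n))\<^sup>2) = (\<Sum>n<N-K. (cmod (x (n + K)))\<^sup>2)"
      using that sum.shift_bounds_nat_ivl[of "\<lambda>n. (cmod (x n))\<^sup>2" 0 K "N - K"]
      by (simp add: atLeast0LessThan)
    also have "\<dots> \<le> tail K"
      unfolding tail_def by (intro sum_le_suminf summable_ignore_initial_segment x) auto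
    finally show ?thesis .
  qed
  have diff_int: "(\<integral>t. (cmod (s N t - s K t))\<^sup>2 \<partial>M) \<le> tail K" if "K \<le> N" for K N
  proof -
    have "s N t - s K t = (\<Sum>n\<in>{K..<N}. x n * e n t)" for t
      unfolding s_def using that
      by (metis (no_types, lifting) sum_diff_nat_ivl atLeast0LessThan zero_le)
    then have "(\<integral>t. (cmod (s N t - s K t))\<^sup>2 \<partial>M) = (\<Sum>n\<in>{K..<N}. (cmod (x n))\<^sup>2)"
      by (simp add: integral_norm_square_sum)
    then show ?thesis using tail_le[OF that] by simp
  qed
  have tail0: "tail \<longlonglongrightarrow> 0"
    unfolding tail_def using suminf_exist_split2[OF x] .
  have tail_nonneg: "tail K \<ge> 0" for K
    unfolding tail_def by (intro suminf_nonneg summable_ignore_initial_segment x) auto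
  have "\<exists>K. \<forall>n\<ge>K. tail n \<le> (1/4)^k" for k :: nat
  proof -
    obtain K where "\<forall>n\<ge>K. norm (tail n - 0) < (1/4)^k"
      using LIMSEQ_D[OF tail0, of "(1/4)^k"] by auto
    then have "\<forall>n\<ge>K. tail n \<le> (1/4)^k" by (auto simp: less_imp_le abs_less_iff)
    then show ?thesis ..
  qed
  then obtain r0 where r0: "\<And>k n. n \<ge> r0 k \<Longrightarrow> tail n \<le> (1/4)^k" by metis
  \<comment> \<open>Summing the \<open>r0 j\<close> makes \<open>r\<close> nondecreasing and the
    summand \<open>k\<close> makes it unbounded, while \<open>r k\<close> stays beyond
    \<open>r0 k\<close>.\<close>
  define r where "r = (\<lambda>k. k + (\<Sum>j\<le>k. r0 j))"
  have r_ge: "k \<le> r k" "r0 k \<le> r k" for k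
    unfolding r_def by (simp, rule trans_le_add2, rule member_le_sum) auto
  have r_Suc: "r k \<le> r (Suc k)" for k by (simp add: r_def)
  define d where "d = (\<lambda>k t. s (r (Suc k)) t - s (r k) t)"
  have d_meas[measurable]: "d k \<in> borel_measurable M" for k unfolding d_def by measurable
  have d_int: "(\<integral>t. (cmod (d k t))\<^sup>2 \<partial>M) \<le> (1/4)^k" for k
    using diff_int[OF r_Suc[of k]] r0[OF r_ge(2)[of k]] unfolding d_def by linarith
  \<comment> \<open>The mean square of \<open>d k\<close> is at most 4^(-k), so the factor 2^k still
    leaves the summable bound 2^(-k). Pointwise, \<open>u k t + (1/2)^k\<close> majorizes
    \<open>2 * norm (d k t)\<close>, which turns summable squares into absolute convergence of the
    telescoping series.\<close>
  define u where "u = (\<lambda>k t. 2^k * (cmod (d k t))\<^sup>2)"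
  have u_meas[measurable]: "u k \<in> borel_measurable M" for k unfolding u_def by measurable
  have u_nonneg: "u k t \<ge> 0" for k t by (simp add: u_def)
  have u_integrable: "integrable M (u k)" for k
    unfolding u_def d_def using diff_L2 by (simp add: L2_def)
  have u_int: "(\<integral>t. u k t \<partial>M) \<le> (1/2)^k" for k
  proof -
    have "(\<integral>t. u k t \<partial>M) \<le> 2^k * (1/4)^k" using d_int[of k] by (simp add: u_def)
    also have "\<dots> = (1/2)^k" by (simp flip: power_mult_distrib)
    finally show ?thesis .
  qed
  have "(\<integral>\<^sup>+t. (\<Sum>k. ennreal (u k t)) \<partial>M) = (\<Sum>k. \<integral>\<^sup>+t. ennreal (u k t) \<partial>M)"
    by (intro nn_integral_suminf) auto
  also have "\<dots> \<le> (\<Sum>k. ennreal ((1/2)^k))"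
    by (intro suminf_le) (auto simp: nn_integral_eq_integral u_integrable u_nonneg u_int intro: ennreal_leI)
  also have "\<dots> < \<infinity>"
    by (subst suminf_ennreal2) (auto intro: summable_geometric)
  finally have "AE t in M. (\<Sum>k. ennreal (u k t)) \<noteq> \<infinity>"
    by (intro nn_integral_noteq_infinite) (auto simp: less_top)
  then have ae_sum: "AE t in M. convergent (\<lambda>k. s (r k) t)"
  proof eventually_elim
    case (elim t)
    then have su: "summable (\<lambda>k. u k t)"
      using u_nonneg by (intro summable_suminf_not_top) auto
    have "summable (\<lambda>k. d k t)"
    proof (rule summable_comparison_test)
      show "summable (\<lambda>k. u k t + (1/2)^k)" using su by (intro summable_add summable_geometric) auto
      have "norm (d k t) \<le> u k t + (1/2)^k" for k
      proof -
        have "2 * norm (d k t) \<le> u k t + (1/2)^k"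
          using norm_mult_le_half_squares[of "2^k" "d k t" 1]
          by (simp add: u_def power_one_over)
        then show ?thesis using norm_ge_zero[of "d k t"] by linarith
      qed
      then show "\<exists>N. \<forall>k\<ge>N. norm (d k t) \<le> u k t + (1/2)^k" by blast
    qed
    then have "convergent (\<lambda>k. (\<Sum>j<k. d j t) + s (r 0) t)"
      by (intro convergent_add convergent_const) (simp add: summable_iff_convergent)
    moreover have "(\<Sum>j<k. d j t) + s (r 0) t = s (r k) t" for k
      unfolding d_def by (subst sum_lessThan_telescope) simp
    ultimately show ?case by simp
  qed
  define F where "F = (\<lambda>t. lim (\<lambda>k. s (r k) t))"
  have F_meas[measurable]: "F \<in> borel_measurable M"
    unfolding F_def by (rule borel_measurable_lim_metric) auto
  have ae_lim: "AE t in M. (\<lambda>k. s (r k) t) \<longlonglongrightarrow> F t"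
    using ae_sum by eventually_elim (simp add: F_def convergent_LIMSEQ_iff)
  have nn: "(\<integral>\<^sup>+t. ennreal ((cmod (s K t - F t))\<^sup>2) \<partial>M) \<le> ennreal (tail K)" for K
  proof -
    have "(\<integral>\<^sup>+t. ennreal ((cmod (s K t - F t))\<^sup>2) \<partial>M) =
        (\<integral>\<^sup>+t. liminf (\<lambda>k. ennreal ((cmod (s (r k) t - s K t))\<^sup>2)) \<partial>M)"
    proof (rule nn_integral_cong_AE, use ae_lim in eventually_elim)
      case (elim t)
      have "(\<lambda>k. ennreal ((cmod (s (r k) t - s K t))\<^sup>2)) \<longlonglongrightarrow> ennreal ((cmod (F t - s K t))\<^sup>2)"
        by (intro tendsto_ennrealI tendsto_intros elim)
      then show ?case
        by (subst norm_minus_commute) (rule lim_imp_Liminf[symmetric], auto)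
    qed
    also have "\<dots> \<le> liminf (\<lambda>k. \<integral>\<^sup>+t. ennreal ((cmod (s (r k) t - s K t))\<^sup>2) \<partial>M)"
      by (intro nn_integral_liminf) measurable
    also have "\<dots> \<le> ennreal (tail K)"
    proof (rule Liminf_le)
      have "(\<integral>\<^sup>+t. ennreal ((cmod (s (r k) t - s K t))\<^sup>2) \<partial>M) \<le> ennreal (tail K)" if "k \<ge> K" for k
      proof (subst nn_integral_eq_integral)
        show "integrable M (\<lambda>t. (cmod (s (r k) t - s K t))\<^sup>2)" using diff_L2 by (simp add: L2_def)
        show "ennreal (\<integral>t. (cmod (s (r k) t - s K t))\<^sup>2 \<partial>M) \<le> ennreal (tail K)"
          using r_ge(1)[of k] that by (intro ennreal_leI diff_int) simp
      qed auto
      then show "\<forall>\<^sub>F k in sequentially. (\<integral>\<^sup>+t. ennreal ((cmod (s (r k) t - s K t))\<^sup>2) \<partial>M) \<le> ennreal (tail K)"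
        by (auto simp: eventually_sequentially)
    qed simp
    finally show ?thesis .
  qed
  have sF_L2: "L2 M (\<lambda>t. s K t - F t)" for K
    unfolding L2_def
  proof (intro conjI)
    show "integrable M (\<lambda>t. (cmod (s K t - F t))\<^sup>2)"
      by (rule integrableI_bounded) (use nn[of K] in \<open>auto intro: le_less_trans\<close>)
  qed simp
  have F_L2: "L2 M F"
    using L2_diff[OF s_L2[of 0] sF_L2[of 0]] by simp
  have "(\<integral>t. (cmod (s K t - F t))\<^sup>2 \<partial>M) \<le> tail K" for K
    using nn[of K] sF_L2[of K] tail_nonneg[of K]
    by (subst (asm) nn_integral_eq_integral) (auto simp: L2_def)
  then have "(\<lambda>K. \<integral>t. (cmod (s K t - F t))\<^sup>2 \<partial>M) \<longlonglongrightarrow> 0"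
    by (intro tendsto_sandwich[OF _ _ tendsto_const tail0]) auto
  then show ?thesis using that[OF F_L2] by (simp add: s_def)
qed

lemma integral_partial_sum:
  "(\<integral>t. (\<Sum>n<N. x n * e n t) * e m t \<partial>M) = (if m < N then x m else 0)"
proof -
  have "(\<integral>t. (\<Sum>n<N. x n * e n t) * e m t \<partial>M) = (\<integral>t. (\<Sum>n<N. x n * (e n t * e m t)) \<partial>M)"
    by (simp only: sum_distrib_right mult.assoc)
  also have "\<dots> = (\<Sum>n<N. x n * (if n = m then 1 else 0))"
    by (simp add: L2_mult_integrable[OF e_L2 e_L2] e_orth)
  also have "\<dots> = (if m < N then x m else 0)"
    by (simp add: if_distrib sum.delta' cong: if_cong)
  finally show ?thesis .
qed

lemma riesz_fischer:
  assumes x: "summable (\<lambda>n. (cmod (x n))\<^sup>2)"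
  shows "\<exists>F. L2 M F \<and> (\<forall>n. (\<integral>t. F t * e n t \<partial>M) = x n) \<and>
    (\<lambda>N. \<integral>t. (cmod ((\<Sum>n<N. x n * e n t) - F t))\<^sup>2 \<partial>M) \<longlonglongrightarrow> 0"
proof -
  obtain F where F: "L2 M F"
    "(\<lambda>N. \<integral>t. (cmod ((\<Sum>n<N. x n * e n t) - F t))\<^sup>2 \<partial>M) \<longlonglongrightarrow> 0"
    using riesz_fischer_limit[OF x] by blast
  have "(\<integral>t. F t * e m t \<partial>M) = x m" for m
  proof (rule LIMSEQ_unique)
    show "(\<lambda>N. \<integral>t. (\<Sum>n<N. x n * e n t) * e m t \<partial>M) \<longlonglongrightarrow> (\<integral>t. F t * e m t \<partial>M)"
      by (intro L2_tendsto_integral_mult F e_L2 L2_sum L2_cmult)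
    show "(\<lambda>N. \<integral>t. (\<Sum>n<N. x n * e n t) * e m t \<partial>M) \<longlonglongrightarrow> x m"
      unfolding integral_partial_sum
      by (rule tendsto_eventually) (auto simp: eventually_sequentially intro!: exI[of _ "Suc m"])
  qed
  then show ?thesis using F by auto
qed

text \<open>Pairing \<open>F\<close> with the sum of \<open>cnj (x n) * e n\<close> gives the
  partial sum \<open>S\<close> of squares, and the squared norm of that sum is \<open>S\<close>
  again. Hence \<open>2 * S\<close> is at most \<open>S\<close> plus the squared norm of
  \<open>F\<close>, a bound independent of \<open>N\<close>.\<close>

lemma bessel:
  assumes F: "L2 M F"
  shows "summable (\<lambda>n. (cmod (\<integral>t. F t * e n t \<partial>M))\<^sup>2)"
proof (rule bounded_imp_summable)
  fix N :: nat
  define x where "x = (\<lambda>n. \<integral>t. F t * e n t \<partial>M)"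
  define A where "A = {..N}"
  have A: "finite A" by (simp add: A_def)
  define S where "S = (\<Sum>n\<in>A. (cmod (x n))\<^sup>2)"
  let ?s = "\<lambda>t. \<Sum>n\<in>A. cnj (x n) * e n t"
  have s: "L2 M ?s" by (intro L2_sum L2_cmult e_L2)
  have S1: "complex_of_real S = (\<Sum>n\<in>A. cnj (x n) * (\<integral>t. F t * e n t \<partial>M))"
  proof -
    have "complex_of_real ((cmod (x n))\<^sup>2) = cnj (x n) * (\<integral>t. F t * e n t \<partial>M)" for n
      unfolding complex_norm_square x_def by (rule mult.commute)
    then show ?thesis unfolding S_def of_real_sum by (intro sum.cong refl)
  qed
  have "F t * ?s t = (\<Sum>n\<in>A. cnj (x n) * (F t * e n t))" for t
    unfolding sum_distrib_left by (intro sum.cong refl) simp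
  then have "(\<integral>t. F t * ?s t \<partial>M) = (\<integral>t. (\<Sum>n\<in>A. cnj (x n) * (F t * e n t)) \<partial>M)"
    by (simp only:)
  also have "\<dots> = (\<Sum>n\<in>A. \<integral>t. cnj (x n) * (F t * e n t) \<partial>M)"
    by (rule Bochner_Integration.integral_sum)
      (rule integrable_mult_right, rule L2_mult_integrable[OF F e_L2])
  also have "\<dots> = complex_of_real S"
    unfolding S1 by (simp only: integral_mult_right_zero)
  finally have S2: "(\<integral>t. F t * ?s t \<partial>M) = complex_of_real S" .
  have "0 \<le> S" unfolding S_def by (intro sum_nonneg) simp
  then have "S = cmod (\<integral>t. F t * ?s t \<partial>M)"
    unfolding S2 by simp
  also have "\<dots> \<le> (\<integral>t. cmod (F t * ?s t) \<partial>M)" by simp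
  finally have "2 * S \<le> (\<integral>t. 2 * cmod (F t * ?s t) \<partial>M)" by simp
  also have "\<dots> \<le> (\<integral>t. 1 * (cmod (F t))\<^sup>2 + (cmod (?s t))\<^sup>2 / 1 \<partial>M)"
  proof (rule integral_mono)
    show "integrable M (\<lambda>t. 2 * cmod (F t * ?s t))"
      using integrable_norm[OF L2_mult_integrable[OF F s]] by simp
    show "integrable M (\<lambda>t. 1 * (cmod (F t))\<^sup>2 + (cmod (?s t))\<^sup>2 / 1)"
      using F s by (simp add: L2_def)
  qed (rule norm_mult_le_half_squares[OF zero_less_one])
  also have "\<dots> = (\<integral>t. (cmod (F t))\<^sup>2 \<partial>M) + (\<integral>t. (cmod (?s t))\<^sup>2 \<partial>M)"
    using F s by (simp add: L2_def)
  also have "(\<integral>t. (cmod (?s t))\<^sup>2 \<partial>M) = S"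
    by (subst integral_norm_square_sum[OF A]) (simp add: S_def)
  finally show "(\<Sum>n\<le>N. (cmod (\<integral>t. F t * e n t \<partial>M))\<^sup>2) \<le> (\<integral>t. (cmod (F t))\<^sup>2 \<partial>M)"
    by (simp add: S_def x_def A_def)
qed simp

end

locale real_orthonormal_basis = real_orthonormal_system +
  assumes complete: "L2 M f \<Longrightarrow> (\<And>n. (\<integral>x. f x * e n x \<partial>M) = 0) \<Longrightarrow> AE x in M. f x = 0"
begin

text \<open>Riesz-Fischer produces an L2 limit of the expansion with the same coefficients as
  \<open>F\<close>; completeness identifies it with \<open>F\<close> almost everywhere, and pairing
  with \<open>G\<close> is continuous under that limit.\<close>

lemma parseval:
  assumes F: "L2 M F" and G: "L2 M G"
  shows "(\<lambda>n. (\<integral>t. F t * e n t \<partial>M) * (\<integral>t. G t * e n t \<partial>M)) sums (\<integral>t. F t * G t \<partial>M)"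
proof -
  define x where "x = (\<lambda>n. \<integral>t. F t * e n t \<partial>M)"
  have x: "summable (\<lambda>n. (cmod (x n))\<^sup>2)" unfolding x_def by (rule bessel[OF F])
  obtain F' where F': "L2 M F'" "\<And>n. (\<integral>t. F' t * e n t \<partial>M) = x n"
    "(\<lambda>N. \<integral>t. (cmod ((\<Sum>n<N. x n * e n t) - F' t))\<^sup>2 \<partial>M) \<longlonglongrightarrow> 0"
    using riesz_fischer[OF x] by auto
  have "AE t in M. F t - F' t = 0"
  proof (rule complete)
    show "L2 M (\<lambda>t. F t - F' t)" by (intro L2_diff F F')
    show "(\<integral>t. (F t - F' t) * e n t \<partial>M) = 0" for n
      using F'(2)[of n] L2_mult_integrable[OF F e_L2] L2_mult_integrable[OF F'(1) e_L2]
      by (simp add: left_diff_distrib x_def)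
  qed
  then have eq: "(\<integral>t. F t * G t \<partial>M) = (\<integral>t. F' t * G t \<partial>M)"
    using L2_measurable[OF F] L2_measurable[OF F'(1)] L2_measurable[OF G]
    by (intro integral_cong_AE) auto
  have "(\<lambda>N. \<integral>t. (\<Sum>n<N. x n * e n t) * G t \<partial>M) \<longlonglongrightarrow> (\<integral>t. F' t * G t \<partial>M)"
    by (intro L2_tendsto_integral_mult F' G L2_sum L2_cmult e_L2)
  moreover have "(\<integral>t. (\<Sum>n<N. x n * e n t) * G t \<partial>M) = (\<Sum>n<N. x n * (\<integral>t. G t * e n t \<partial>M))" for N
  proof -
    have "(\<integral>t. (\<Sum>n<N. x n * e n t) * G t \<partial>M) = (\<integral>t. (\<Sum>n<N. x n * (G t * e n t)) \<partial>M)"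
      by (simp only: sum_distrib_right mult.assoc) (simp only: mult.commute)
    then show ?thesis by (simp add: L2_mult_integrable[OF G e_L2])
  qed
  ultimately show ?thesis unfolding sums_def eq by (simp add: x_def)
qed

end

section \<open>Bounded operators on the sequence space\<close>

lemma ell2_add: "x \<in> ell2 \<Longrightarrow> y \<in> ell2 \<Longrightarrow> (\<lambda>k. x k + y k) \<in> ell2"
  unfolding ell2_def mem_Collect_eq
proof (rule summable_comparison_test)
  assume "summable (\<lambda>n. (cmod (x n))\<^sup>2)" "summable (\<lambda>n. (cmod (y n))\<^sup>2)"
  then show "summable (\<lambda>n. 2 * (cmod (x n))\<^sup>2 + 2 * (cmod (y n))\<^sup>2)"
    by (intro summable_add summable_mult)
  have "(cmod (x n + y n))\<^sup>2 \<le> 2 * (cmod (x n))\<^sup>2 + 2 * (cmod (y n))\<^sup>2" for n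
  proof -
    have "(cmod (x n + y n))\<^sup>2 \<le> (cmod (x n) + cmod (y n))\<^sup>2"
      by (intro power_mono norm_triangle_ineq) auto
    also have "\<dots> \<le> 2 * (cmod (x n))\<^sup>2 + 2 * (cmod (y n))\<^sup>2"
      using sum_squares_bound[of "cmod (x n)" "cmod (y n)"] by (simp add: power2_sum)
    finally show ?thesis .
  qed
  then show "\<exists>N. \<forall>n\<ge>N. norm ((cmod (x n + y n))\<^sup>2) \<le> 2 * (cmod (x n))\<^sup>2 + 2 * (cmod (y n))\<^sup>2"
    by auto
qed

lemma ell2_cmult: "x \<in> ell2 \<Longrightarrow> (\<lambda>k. c * x k) \<in> ell2"
  unfolding ell2_def mem_Collect_eq norm_mult power_mult_distrib by (rule summable_mult)

lemma ell2_finite_support: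
  assumes "\<And>n. n \<ge> N \<Longrightarrow> x n = 0"
  shows "x \<in> ell2" "ell2_norm x = sqrt (\<Sum>n<N. (cmod (x n))\<^sup>2)"
proof -
  have "(\<lambda>n. (cmod (x n))\<^sup>2) sums (\<Sum>n<N. (cmod (x n))\<^sup>2)"
    by (rule sums_finite) (auto simp: assms not_less)
  then show "x \<in> ell2" "ell2_norm x = sqrt (\<Sum>n<N. (cmod (x n))\<^sup>2)"
    by (auto simp: ell2_def ell2_norm_def sums_iff)
qed

lemma ell2_basis_in_ell2: "ell2_basis n \<in> ell2"
  by (rule ell2_finite_support(1)[of "Suc n"]) (auto simp: ell2_basis_def)

lemma norm_le_ell2_norm: "x \<in> ell2 \<Longrightarrow> cmod (x n) \<le> ell2_norm x"
proof -
  assume x: "x \<in> ell2"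
  then have "(\<Sum>k\<in>{n}. (cmod (x k))\<^sup>2) \<le> (\<Sum>k. (cmod (x k))\<^sup>2)"
    by (intro sum_le_suminf) (auto simp: ell2_def)
  then have "sqrt ((cmod (x n))\<^sup>2) \<le> ell2_norm x"
    unfolding ell2_norm_def by (intro real_sqrt_le_mono) simp
  then show ?thesis by simp
qed

lemma
  assumes "bounded_op_ell2 T"
  shows bounded_op_ell2_mem: "x \<in> ell2 \<Longrightarrow> T x \<in> ell2"
    and bounded_op_ell2_add: "x \<in> ell2 \<Longrightarrow> y \<in> ell2 \<Longrightarrow> T (\<lambda>k. x k + y k) = (\<lambda>k. T x k + T y k)"
    and bounded_op_ell2_cmult: "x \<in> ell2 \<Longrightarrow> T (\<lambda>k. c * x k) = (\<lambda>k. c * T x k)"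
    and bounded_op_ell2_bound: "\<exists>C. \<forall>x\<in>ell2. ell2_norm (T x) \<le> C * ell2_norm x"
  using assms unfolding bounded_op_ell2_def by blast+

lemma bounded_op_ell2_compose:
  assumes "bounded_op_ell2 S" "bounded_op_ell2 T"
  shows "bounded_op_ell2 (\<lambda>x. S (T x))"
proof -
  obtain C where C: "\<forall>x\<in>ell2. ell2_norm (S x) \<le> C * ell2_norm x"
    using assms(1) by (auto simp: bounded_op_ell2_def)
  obtain D where D: "\<forall>x\<in>ell2. ell2_norm (T x) \<le> D * ell2_norm x"
    using assms(2) by (auto simp: bounded_op_ell2_def)
  have nn: "x \<in> ell2 \<Longrightarrow> 0 \<le> ell2_norm x" for x
    unfolding ell2_norm_def ell2_def by (intro real_sqrt_ge_zero suminf_nonneg) auto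
  have "ell2_norm (S (T x)) \<le> (\<bar>C\<bar> * D) * ell2_norm x" if x: "x \<in> ell2" for x
  proof -
    have T: "T x \<in> ell2" using assms(2) x by (auto simp: bounded_op_ell2_def)
    have "ell2_norm (S (T x)) \<le> C * ell2_norm (T x)" using C T by auto
    also have "\<dots> \<le> \<bar>C\<bar> * ell2_norm (T x)" by (intro mult_right_mono nn T) simp
    also have "\<dots> \<le> \<bar>C\<bar> * (D * ell2_norm x)" using D x by (intro mult_left_mono) auto
    finally show ?thesis by simp
  qed
  then show ?thesis using assms by (auto simp: bounded_op_ell2_def)
qed

lemma bounded_op_ell2_sums_finite:
  assumes T: "bounded_op_ell2 T"
  shows "T (\<lambda>k. if k < N then x k else 0) m = (\<Sum>n<N. matrix_of_op T m n * x n)"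
proof (induction N)
  case 0
  have "T (\<lambda>k. 0 * ell2_basis 0 k) = (\<lambda>k. 0 * T (ell2_basis 0) k)"
    by (rule bounded_op_ell2_cmult[OF T ell2_basis_in_ell2])
  then show ?case by simp
next
  case (Suc N)
  have mem: "(\<lambda>k. if k < N then x k else 0) \<in> ell2"
    by (rule ell2_finite_support(1)[of N]) auto
  have "(\<lambda>k. if k < Suc N then x k else 0) =
      (\<lambda>k. (if k < N then x k else 0) + x N * ell2_basis N k)"
    by (auto simp: ell2_basis_def less_Suc_eq)
  then have "T (\<lambda>k. if k < Suc N then x k else 0) =
      T (\<lambda>k. (if k < N then x k else 0) + x N * ell2_basis N k)" by (rule arg_cong)
  also have "\<dots> = (\<lambda>k. T (\<lambda>k. if k < N then x k else 0) k + T (\<lambda>k. x N * ell2_basis N k) k)"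
    by (rule bounded_op_ell2_add[OF T mem ell2_cmult[OF ell2_basis_in_ell2]])
  also have "T (\<lambda>k. x N * ell2_basis N k) = (\<lambda>k. x N * T (ell2_basis N) k)"
    by (rule bounded_op_ell2_cmult[OF T ell2_basis_in_ell2])
  finally show ?case using Suc.IH by (simp add: matrix_of_op_def mult.commute)
qed

text \<open>The finite version is linearity. The remainder is a coordinate of \<open>T\<close>
  applied to the tail of \<open>x\<close>, and the norm of the tail tends to 0. The matrix thus
  determines \<open>T\<close> on \<open>ell2\<close>.\<close>

lemma bounded_op_ell2_sums:
  assumes T: "bounded_op_ell2 T" and x: "x \<in> ell2"
  shows "(\<lambda>n. matrix_of_op T m n * x n) sums T x m"
proof -
  obtain C where C: "\<And>x. x \<in> ell2 \<Longrightarrow> ell2_norm (T x) \<le> C * ell2_norm x"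
    using bounded_op_ell2_bound[OF T] by blast
  let ?h = "\<lambda>N k. if k < N then x k else 0" and ?t = "\<lambda>N k. if k < N then 0 else x k"
  have h: "?h N \<in> ell2" for N by (rule ell2_finite_support(1)[of N]) auto
  have t: "?t N \<in> ell2" for N
    using ell2_add[OF x ell2_cmult[OF h[of N], of "-1"]]
    by (rule back_subst[of "\<lambda>y. y \<in> ell2"]) auto
  have norm_t: "ell2_norm (?t N) = sqrt (\<Sum>n. (cmod (x (n + N)))\<^sup>2)" for N
    unfolding ell2_norm_def
    by (subst suminf_split_initial_segment[of _ N])
      (use t[of N] in \<open>auto simp: ell2_def intro!: arg_cong[where f=suminf]\<close>)
  have lim: "(\<lambda>N. ell2_norm (?t N)) \<longlonglongrightarrow> 0"
    unfolding norm_t using x tendsto_real_sqrt[OF suminf_exist_split2] by (fastforce simp: ell2_def)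
  have "T x m - (\<Sum>n<N. matrix_of_op T m n * x n) = T (?t N) m" for N
  proof -
    have "T (\<lambda>k. ?h N k + ?t N k) = (\<lambda>k. T (?h N) k + T (?t N) k)"
      by (rule bounded_op_ell2_add[OF T h t])
    moreover have "(\<lambda>k. ?h N k + ?t N k) = x" by auto
    ultimately have "T x m = T (?h N) m + T (?t N) m" by simp
    then show ?thesis using bounded_op_ell2_sums_finite[OF T] by simp
  qed
  moreover have "cmod (T (?t N) m) \<le> C * ell2_norm (?t N)" for N
    using C[OF t[of N]] norm_le_ell2_norm[of "T (?t N)" m] bounded_op_ell2_mem[OF T t]
    by (meson order_trans)
  ultimately have "cmod (T x m - (\<Sum>n<N. matrix_of_op T m n * x n)) \<le> C * ell2_norm (?t N)" for N
    by simp
  then have "(\<lambda>N. T x m - (\<Sum>n<N. matrix_of_op T m n * x n)) \<longlonglongrightarrow> 0"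
    by (intro Lim_null_comparison[OF _ tendsto_mult_right_zero[OF lim, of C]]) auto
  from tendsto_diff[OF tendsto_const[of "T x m"] this] show ?thesis
    unfolding sums_def by simp
qed

text \<open>On the conjugate of a truncated row, \<open>T\<close> has the value \<open>s\<close> in
  coordinate \<open>m\<close>, while the test vector has norm \<open>sqrt s\<close>; so
  \<open>s \<le> C * sqrt s\<close>. This lets every row be read as the coefficient sequence of an
  L2 function.\<close>

lemma bounded_op_ell2_row_summable:
  assumes T: "bounded_op_ell2 T"
  shows "summable (\<lambda>n. (cmod (matrix_of_op T m n))\<^sup>2)"
proof -
  obtain C where C: "\<And>x. x \<in> ell2 \<Longrightarrow> ell2_norm (T x) \<le> C * ell2_norm x"
    using bounded_op_ell2_bound[OF T] by blast
  have "(\<Sum>n<N. (cmod (matrix_of_op T m n))\<^sup>2) \<le> C\<^sup>2" for N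
  proof -
    let ?x = "\<lambda>n. if n < N then cnj (matrix_of_op T m n) else 0"
    define s where "s = (\<Sum>n<N. (cmod (matrix_of_op T m n))\<^sup>2)"
    have s: "s \<ge> 0" unfolding s_def by (intro sum_nonneg) simp
    have x: "?x \<in> ell2" "ell2_norm ?x = sqrt s"
      using ell2_finite_support[of N ?x] by (auto simp: s_def)
    have "T ?x m = complex_of_real s"
      unfolding bounded_op_ell2_sums_finite[OF T] s_def of_real_sum complex_norm_square ..
    then have "s = cmod (T ?x m)" using s by simp
    also have "\<dots> \<le> C * sqrt s"
      using C[OF x(1)] norm_le_ell2_norm[of "T ?x" m] bounded_op_ell2_mem[OF T x(1)] x(2) by fastforce
    finally have le: "sqrt s * sqrt s \<le> C * sqrt s" using s by simp
    show ?thesis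
    proof (cases "s = 0")
      case False
      then have "sqrt s \<le> C" using le s by (subst (asm) mult_le_cancel_right) auto
      then have "(sqrt s)\<^sup>2 \<le> C\<^sup>2" using s by (intro power_mono) auto
      then show ?thesis using s by (simp add: s_def)
    qed (simp add: s_def)
  qed
  then show ?thesis
    by (intro bounded_imp_summable[of _ "C\<^sup>2"]) (auto simp flip: lessThan_Suc_atMost simp del: sum.lessThan_Suc)
qed

lemma bounded_op_ell2_eqI:
  assumes S: "bounded_op_ell2 S" "\<And>m n. matrix_of_op S m n = A m n" and x: "x \<in> ell2"
  shows "S x = op_of_matrix A x"
  using bounded_op_ell2_sums[OF S(1) x] by (auto simp: fun_eq_iff op_of_matrix_def sums_iff S(2))

section \<open>The half line\<close>

abbreviation (input) Rpos :: "real measure" where "Rpos \<equiv> lebesgue_on {0<..}"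

lemma sigma_finite_Rpos: "sigma_finite_measure Rpos"
proof -
  have "sigma_finite_measure (lebesgue :: real measure)"
  proof
    obtain A :: "real set set" where A: "countable A" "A \<subseteq> sets lborel" "\<Union>A = space lborel" "\<forall>a\<in>A. emeasure lborel a \<noteq> \<infinity>"
      using lborel.sigma_finite_countable by blast
    then show "\<exists>A::real set set. countable A \<and> A \<subseteq> sets lebesgue \<and> \<Union>A = space lebesgue \<and> (\<forall>a\<in>A. emeasure lebesgue a \<noteq> \<infinity>)"
      by (intro exI[of _ A]) auto
  qed
  then show ?thesis by (rule sigma_finite_measure_restrict_space) simp
qed

interpretation Rpos: sigma_finite_measure Rpos by (rule sigma_finite_Rpos)
interpretation Rpos_pair: pair_sigma_finite Rpos Rpos ..

lemma borel_measurable_Rpos: "f \<in> borel_measurable borel \<Longrightarrow> f \<in> borel_measurable Rpos"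
  by (simp add: measurable_completion measurable_restrict_space1)

text \<open>The half lines are closed under intersection and generate the Borel sets, so the
  vanishing of the complex measure with density \<open>F\<close> spreads from them to all Borel
  sets.\<close>

lemma AE_zero_of_integral_halfline_zero:
  fixes F :: "real \<Rightarrow> complex"
  assumes F: "integrable Rpos F"
    and zero: "\<And>a. a \<ge> 0 \<Longrightarrow> (\<integral>x. indicator {a<..} x *\<^sub>R F x \<partial>Rpos) = 0"
  shows "AE x in Rpos. F x = 0"
proof (rule Rpos.density_zero[OF F])
  have ind: "integrable Rpos (\<lambda>x. indicator B x *\<^sub>R F x)" if "B \<in> sets borel" for B
  proof -
    have "B \<inter> {0<..} \<in> sets Rpos" using that by (auto simp: sets_restrict_space)
    then have "integrable Rpos (\<lambda>x. indicator (B \<inter> {0<..}) x *\<^sub>R F x)"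
      by (rule integrable_mult_indicator) (rule F)
    then show ?thesis
      by (rule Bochner_Integration.integrable_cong[THEN iffD1, rotated 2]) (auto simp: indicator_def)
  qed
  have F0: "(\<integral>x. F x \<partial>Rpos) = 0"
    using zero[of 0] by (subst Bochner_Integration.integral_cong[of Rpos Rpos F "\<lambda>x. indicator {0<..} x *\<^sub>R F x"]) auto
  have borel: "(\<integral>x. indicator B x *\<^sub>R F x \<partial>Rpos) = 0" if "B \<in> sets borel" for B :: "real set"
  proof -
    have B: "B \<in> sigma_sets UNIV (range greaterThan)"
      using that by (subst (asm) borel_Ioi) simp
    have "Int_stable (range greaterThan :: real set set)"
    proof (rule Int_stableI)
      fix A B :: "real set" assume "A \<in> range greaterThan" "B \<in> range greaterThan"
      then obtain a b where "A = {a<..}" "B = {b<..}" by auto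
      then have "A \<inter> B = {max a b<..}" by auto
      then show "A \<inter> B \<in> range greaterThan" by blast
    qed
    moreover have "range greaterThan \<subseteq> Pow (UNIV :: real set)" by simp
    ultimately show ?thesis using B
    proof (induction rule: sigma_sets_induct_disjoint)
      case (basic A)
      then obtain a where A: "A = {a<..}" by auto
      show ?case
      \<comment> \<open>The assumption speaks of \<open>a \<ge> 0\<close> only. For negative
        \<open>a\<close> the half line contains the whole space, as it does for
        \<open>a = 0\<close>.\<close>
      proof (cases "a \<ge> 0")
        case True
        then show ?thesis using zero A by simp
      next
        case False
        then have "(\<integral>x. indicator A x *\<^sub>R F x \<partial>Rpos) = (\<integral>x. F x \<partial>Rpos)"
          by (intro Bochner_Integration.integral_cong) (auto simp: A)
        then show ?thesis using F0 by simp
      qed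
    next
      case (compl A)
      then have "A \<in> sets borel" by (simp add: borel_Ioi)
      then have "(\<integral>x. F x - indicator A x *\<^sub>R F x \<partial>Rpos) = 0"
        using F ind F0 compl by simp
      moreover have "F x - indicator A x *\<^sub>R F x = indicator (UNIV - A) x *\<^sub>R F x" for x
        by (auto simp: indicator_def)
      ultimately show ?case by simp
    next
      case (union A)
      have A: "A i \<in> sets borel" for i using union by (auto simp: borel_Ioi)
      have "set_lebesgue_integral Rpos (\<Union>i. A i \<inter> {0<..}) F = (\<Sum>i. set_lebesgue_integral Rpos (A i \<inter> {0<..}) F)"
      proof (rule lebesgue_integral_countable_add)
        show "A i \<inter> {0<..} \<in> sets Rpos" for i using A by (auto simp: sets_restrict_space)
        show "i \<noteq> j \<Longrightarrow> (A i \<inter> {0<..}) \<inter> (A j \<inter> {0<..}) = {}" for i j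
          using union(1) by (auto simp: disjoint_family_on_def)
        have "set_integrable Rpos (\<Union>(range A)) F"
          unfolding set_integrable_def by (rule ind) (use A in auto)
        then show "set_integrable Rpos (\<Union>i. A i \<inter> {0<..}) F"
          unfolding set_integrable_def
          by (rule Bochner_Integration.integrable_cong[THEN iffD1, rotated 2]) (auto simp: indicator_def)
      qed
      moreover have "set_lebesgue_integral Rpos (B \<inter> {0<..}) F = (\<integral>x. indicator B x *\<^sub>R F x \<partial>Rpos)" for B
        unfolding set_lebesgue_integral_def
        by (intro Bochner_Integration.integral_cong) (auto simp: indicator_def)
      moreover have "(\<Union>i. A i \<inter> {0<..}) = \<Union>(range A) \<inter> {0<..}" by auto
      ultimately have "(\<integral>x. indicator (\<Union>(range A)) x *\<^sub>R F x \<partial>Rpos) = (\<Sum>i. \<integral>x. indicator (A i) x *\<^sub>R F x \<partial>Rpos)"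
        by (simp only:)
      then show ?case using union(3) by simp
    qed simp
  qed
  \<comment> \<open>A Lebesgue set is a Borel set up to a subset of a Borel null set, so its
    integral is one already known to vanish.\<close>
  fix A assume "A \<in> sets Rpos"
  then have "A \<in> sets lebesgue" "A \<subseteq> {0<..}" by (auto simp: sets_restrict_space)
  then obtain S N N' where A: "A = S \<union> N" "N \<subseteq> N'" "N' \<in> null_sets lborel" "S \<in> sets lborel"
    by (auto elim: sets_completionE)
  have "N' \<in> null_sets lebesgue" using A(3) by (rule null_sets_completionI)
  then have "AE x in lebesgue. x \<notin> N'" by (rule AE_not_in)
  then have ae: "AE x in Rpos. x \<notin> N'" by (auto simp: AE_restrict_space_iff)
  have "set_lebesgue_integral Rpos A F = (\<integral>x. indicator S x *\<^sub>R F x \<partial>Rpos)"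
    unfolding set_lebesgue_integral_def
  proof (rule integral_cong_AE)
    show "(\<lambda>x. indicat_real A x *\<^sub>R F x) \<in> borel_measurable Rpos"
      using F \<open>A \<in> sets Rpos\<close> by measurable
    show "(\<lambda>x. indicat_real S x *\<^sub>R F x) \<in> borel_measurable Rpos"
      using ind[of S] A(4) by auto
    show "AE x in Rpos. indicat_real A x *\<^sub>R F x = indicat_real S x *\<^sub>R F x"
      using ae by eventually_elim (use A(1,2) in \<open>auto simp: indicator_def\<close>)
  qed
  then show "set_lebesgue_integral Rpos A F = 0" using borel[of S] A(4) by simp
qed

text \<open>Weierstrass approximation extends the vanishing from powers to continuous functions of
  \<open>h\<close>. As \<open>h\<close> is strictly decreasing, \<open>h x < h a\<close> means
  \<open>x > a\<close>, so pointwise limits of such functions reach the indicators of half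
  lines.\<close>

lemma AE_zero_of_integral_mult_powers_zero:
  fixes F :: "real \<Rightarrow> complex" and h :: "real \<Rightarrow> real"
  assumes F: "integrable Rpos F"
    and h: "h \<in> borel_measurable borel" "\<And>x. x > 0 \<Longrightarrow> h x \<in> {0..b}"
      "\<And>x y. 0 \<le> x \<Longrightarrow> x < y \<Longrightarrow> h y < h x"
    and zero: "\<And>n. (\<integral>x. of_real (h x ^ n) * F x \<partial>Rpos) = 0"
  shows "AE x in Rpos. F x = 0"
proof (rule AE_zero_of_integral_halfline_zero[OF F])
  have hM[measurable]: "h \<in> borel_measurable Rpos" by (rule borel_measurable_Rpos[OF h(1)])
  have F_meas[measurable]: "F \<in> borel_measurable Rpos" using F by auto
  have int_bounded: "integrable Rpos (\<lambda>x. of_real (u (h x)) * F x)"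
    if u: "u \<in> borel_measurable borel" "\<And>y. y \<in> {0..b} \<Longrightarrow> \<bar>u y\<bar> \<le> C" for u :: "real \<Rightarrow> real" and C
  proof (rule Bochner_Integration.integrable_bound)
    show "integrable Rpos (\<lambda>x. C * norm (F x))" using F by simp
    show "(\<lambda>x. of_real (u (h x)) * F x) \<in> borel_measurable Rpos"
      using u(1) by measurable
    show "AE x in Rpos. norm (of_real (u (h x)) * F x) \<le> norm (C * norm (F x))"
    proof (rule AE_I2)
      fix x assume "x \<in> space Rpos"
      then have "\<bar>u (h x)\<bar> \<le> C" using u(2) h(2)[of x] by auto
      then show "norm (of_real (u (h x)) * F x) \<le> norm (C * norm (F x))"
        by (simp add: norm_mult mult_right_mono abs_mult)
    qed
  qed
  have int_cont: "integrable Rpos (\<lambda>x. of_real (u (h x)) * F x)"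
    if "continuous_on UNIV u" for u :: "real \<Rightarrow> real"
  proof -
    have "bounded (u ` {0..b})"
      using that by (intro compact_imp_bounded compact_continuous_image) (auto intro: continuous_on_subset)
    then obtain C where "\<forall>y\<in>{0..b}. \<bar>u y\<bar> \<le> C" by (auto simp: bounded_iff)
    then show ?thesis using that by (intro int_bounded) (auto intro: borel_measurable_continuous_onI)
  qed
  have zero_cont: "(\<integral>x. of_real (u (h x)) * F x \<partial>Rpos) = 0" if u: "continuous_on UNIV u" for u :: "real \<Rightarrow> real"
  proof -
    have "cmod (\<integral>x. of_real (u (h x)) * F x \<partial>Rpos) \<le> 0 + e" if e: "e > 0" for e
    proof -
      define N where "N = (\<integral>x. norm (F x) \<partial>Rpos)"
      have N: "N \<ge> 0" by (simp add: N_def)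
      \<comment> \<open>The divisor \<open>N + 1\<close> keeps the tolerance meaningful when
        \<open>F\<close> has norm 0.\<close>
      obtain p where p: "real_polynomial_function p" "\<And>y. y \<in> {0..b} \<Longrightarrow> \<bar>u y - p y\<bar> < e / (N + 1)"
        using Stone_Weierstrass_real_polynomial_function[of "{0..b}" u "e / (N + 1)"] u e N
        by (auto intro: continuous_on_subset)
      obtain a n where p_eq: "p = (\<lambda>y. \<Sum>i\<le>n. a i * y ^ i)"
        using p(1) real_polynomial_function_iff_sum by blast
      have p_cont: "continuous_on UNIV p" unfolding p_eq by (intro continuous_intros)
      have "(\<integral>x. of_real (p (h x)) * F x \<partial>Rpos) = (\<integral>x. (\<Sum>i\<le>n. of_real (a i) * (of_real (h x ^ i) * F x)) \<partial>Rpos)"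
        unfolding p_eq by (simp add: sum_distrib_right mult.assoc)
      also have "\<dots> = (\<Sum>i\<le>n. \<integral>x. of_real (a i) * (of_real (h x ^ i) * F x) \<partial>Rpos)"
        by (rule Bochner_Integration.integral_sum)
          (rule integrable_mult_right, rule int_cont, intro continuous_intros)
      also have "\<dots> = 0" by (simp only: integral_mult_right_zero zero mult_zero_right sum.neutral_const)
      finally have p0: "(\<integral>x. of_real (p (h x)) * F x \<partial>Rpos) = 0" .
      have "(\<integral>x. of_real (u (h x)) * F x \<partial>Rpos) =
          (\<integral>x. of_real (u (h x)) * F x - of_real (p (h x)) * F x \<partial>Rpos)"
        using int_cont[OF u] int_cont[OF p_cont] p0 by simp
      also have "cmod \<dots> \<le> (\<integral>x. cmod (of_real (u (h x)) * F x - of_real (p (h x)) * F x) \<partial>Rpos)"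
        by simp
      also have "\<dots> \<le> (\<integral>x. e / (N + 1) * cmod (F x) \<partial>Rpos)"
      proof (rule integral_mono)
        show "integrable Rpos (\<lambda>x. cmod (of_real (u (h x)) * F x - of_real (p (h x)) * F x))"
          using int_cont[OF u] int_cont[OF p_cont] by auto
        show "integrable Rpos (\<lambda>x. e / (N + 1) * cmod (F x))" using F by simp
        fix x assume "x \<in> space Rpos"
        then have "\<bar>u (h x) - p (h x)\<bar> \<le> e / (N + 1)" using p(2)[of "h x"] h(2)[of x] by auto
        moreover have "of_real (u (h x)) * F x - of_real (p (h x)) * F x = of_real (u (h x) - p (h x)) * F x"
          by (simp add: algebra_simps)
        ultimately show "cmod (of_real (u (h x)) * F x - of_real (p (h x)) * F x) \<le> e / (N + 1) * cmod (F x)"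
          by (simp only: norm_mult norm_of_real) (intro mult_right_mono norm_ge_zero)
      qed
      also have "\<dots> = e * (N / (N + 1))" by (simp add: N_def)
      also have "\<dots> \<le> e * 1" using N e by (intro mult_left_mono) auto
      finally show ?thesis by simp
    qed
    then have "cmod (\<integral>x. of_real (u (h x)) * F x \<partial>Rpos) \<le> 0" by (rule field_le_epsilon)
    then show ?thesis by simp
  qed
  fix a :: real assume a: "a \<ge> 0"
  \<comment> \<open>Ramps of slope \<open>n\<close> below the level \<open>h a\<close>: they vanish
    where \<open>h x \<ge> h a\<close>, become 1 for large \<open>n\<close> where
    \<open>h x < h a\<close>, and stay in [0, 1], so \<open>cmod (F x)\<close> dominates.\<close>
  let ?u = "\<lambda>n y. min 1 (max 0 (real n * (h a - y)))"
  have "(\<lambda>n. \<integral>x. of_real (?u n (h x)) * F x \<partial>Rpos) \<longlonglongrightarrow> (\<integral>x. indicator {a<..} x *\<^sub>R F x \<partial>Rpos)"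
  proof (rule integral_dominated_convergence)
    show "integrable Rpos (\<lambda>x. cmod (F x))" using F by simp
    show "(\<lambda>x. of_real (?u n (h x)) * F x) \<in> borel_measurable Rpos" for n by measurable
    have "(\<lambda>x. indicat_real {a<..} x) \<in> borel_measurable Rpos"
      by (rule borel_measurable_Rpos) simp
    then show "(\<lambda>x. indicat_real {a<..} x *\<^sub>R F x) \<in> borel_measurable Rpos" by measurable
    show "AE x in Rpos. norm (of_real (?u n (h x)) * F x) \<le> cmod (F x)" for n
      by (rule AE_I2) (simp add: norm_mult mult_left_le_one_le)
    show "AE x in Rpos. (\<lambda>n. of_real (?u n (h x)) * F x) \<longlonglongrightarrow> indicat_real {a<..} x *\<^sub>R F x"
    proof (rule AE_I2)
      fix x assume "x \<in> space Rpos"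
      then have x: "x > 0" by simp
      show "(\<lambda>n. of_real (?u n (h x)) * F x) \<longlonglongrightarrow> indicat_real {a<..} x *\<^sub>R F x"
      proof (cases "a < x")
        case True
        then have pos: "h a - h x > 0" using h(3)[of a x] a by simp
        obtain n0 where n0: "real n0 * (h a - h x) > 1" using reals_Archimedean3[OF pos] by blast
        have "?u n (h x) = 1" if "n \<ge> n0" for n
        proof -
          have "real n0 * (h a - h x) \<le> real n * (h a - h x)"
            using that pos by (intro mult_right_mono) auto
          then show ?thesis using n0 by simp
        qed
        then have "\<forall>\<^sub>F n in sequentially. of_real (?u n (h x)) * F x = F x"
          by (auto simp: eventually_sequentially intro!: exI[of _ n0])
        then show ?thesis using True by (simp add: tendsto_eventually)
      next
        case False
        then have "h a - h x \<le> 0" using h(3)[of x a] x by (cases "x = a") auto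
        then have "real n * (h a - h x) \<le> 0" for n by (simp add: mult_nonneg_nonpos)
        then have "?u n (h x) = 0" for n by (simp add: max_absorb1)
        then show ?thesis using False by simp
      qed
    qed
  qed
  moreover have "(\<integral>x. of_real (?u n (h x)) * F x \<partial>Rpos) = 0" for n
    by (rule zero_cont) (intro continuous_intros)
  ultimately have "(\<lambda>n::nat. 0) \<longlonglongrightarrow> (\<integral>x. indicator {a<..} x *\<^sub>R F x \<partial>Rpos)"
    by (simp only:)
  then show "(\<integral>x. indicator {a<..} x *\<^sub>R F x \<partial>Rpos) = 0"
    by (rule LIMSEQ_unique[OF _ tendsto_const])
qed

section \<open>Elementary integrals\<close>

lemma borel_measurable_cosh [measurable]: "(cosh :: real \<Rightarrow> real) \<in> borel_measurable borel"
  and borel_measurable_sinh [measurable]: "(sinh :: real \<Rightarrow> real) \<in> borel_measurable borel"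
  and borel_measurable_tanh [measurable]: "(tanh :: real \<Rightarrow> real) \<in> borel_measurable borel"
  by (intro borel_measurable_continuous_onI continuous_intros; simp)+

lemma integral_Rpos_lborel:
  fixes f :: "real \<Rightarrow> 'a::{banach, second_countable_topology}"
  assumes [measurable]: "f \<in> borel_measurable borel"
  shows "integral\<^sup>L Rpos f = (\<integral>x. indicator {0<..} x *\<^sub>R f x \<partial>lborel)"
  by (subst integral_restrict_space) (simp_all add: integral_completion)

lemma integrable_Rpos_lborel:
  fixes f :: "real \<Rightarrow> 'a::{banach, second_countable_topology}"
  assumes [measurable]: "f \<in> borel_measurable borel"
  shows "integrable Rpos f \<longleftrightarrow> integrable lborel (\<lambda>x. indicator {0<..} x *\<^sub>R f x)"
  by (subst integrable_restrict_space) (simp_all add: integrable_completion)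

lemma
  fixes f :: "real \<Rightarrow> real"
  assumes f[measurable]: "f \<in> borel_measurable borel" and c: "c > 0"
  shows integral_Rpos_scale: "(\<integral>x. f (c * x) \<partial>Rpos) = (\<integral>x. f x \<partial>Rpos) / c"
    and integrable_Rpos_scale: "integrable Rpos (\<lambda>x. f (c * x)) \<longleftrightarrow> integrable Rpos f"
proof -
  have ind: "indicator {0<..} (c * x) = (indicator {0<..} x :: real)" for x
    using c by (auto simp: indicator_def zero_less_mult_iff)
  have "(\<integral>x. indicator {0<..} x *\<^sub>R f x \<partial>lborel) = c * (\<integral>x. indicator {0<..} x *\<^sub>R f (c * x) \<partial>lborel)"
    using c by (subst lborel_integral_real_affine[of c _ 0]) (simp_all add: ind)
  then show "(\<integral>x. f (c * x) \<partial>Rpos) = (\<integral>x. f x \<partial>Rpos) / c"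
    using c by (simp add: integral_Rpos_lborel)
  show "integrable Rpos (\<lambda>x. f (c * x)) \<longleftrightarrow> integrable Rpos f"
    using lborel_integrable_real_affine_iff[of c "\<lambda>x. indicator {0<..} x *\<^sub>R f x" 0] c
    by (simp add: integrable_Rpos_lborel ind)
qed

lemma integral_Rpos_FTC:
  fixes f F :: "real \<Rightarrow> real"
  assumes f: "continuous_on UNIV f" "integrable Rpos f"
    and F: "\<And>x. x > 0 \<Longrightarrow> (F has_real_derivative f x) (at x)" "isCont F 0"
    and B: "(F \<longlongrightarrow> B) at_top"
  shows "integral\<^sup>L Rpos f = B - F 0"
proof -
  have meas: "f \<in> borel_measurable borel" using f(1) by (rule borel_measurable_continuous_onI)
  have "integral\<^sup>L Rpos f = (LBINT x=0..\<infinity>. f x)"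
    by (simp add: integral_Rpos_lborel[OF meas] interval_lebesgue_integral_0_infty set_lebesgue_integral_def)
  also have "\<dots> = B - F 0"
  proof (rule interval_integral_FTC_integrable)
    show "(F has_vector_derivative f x) (at x)" if "0 < ereal x" for x
      using F(1)[of x] that by (simp add: has_real_derivative_iff_has_vector_derivative zero_ereal_def)
    show "isCont f x" for x using f(1) by (simp add: continuous_on_eq_continuous_at)
    have "einterval 0 \<infinity> = {0<..}" by (auto simp: einterval_def zero_ereal_def)
    then show "set_integrable lborel (einterval 0 \<infinity>) f"
      using f(2) by (simp add: integrable_Rpos_lborel[OF meas] set_integrable_def)
    have "(F \<longlongrightarrow> F 0) (at_right 0)" using F(2) by (simp add: isCont_def filterlim_at_split)
    then show "((F \<circ> real_of_ereal) \<longlongrightarrow> F 0) (at_right 0)"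
      unfolding zero_ereal_def by (simp add: ereal_tendsto_simps)
    show "((F \<circ> real_of_ereal) \<longlongrightarrow> B) (at_left \<infinity>)"
      using B by (simp add: ereal_tendsto_simps)
  qed simp
  finally show ?thesis .
qed

lemma
  assumes p: "p > (0::real)"
  shows integrable_Gamma_Rpos: "integrable Rpos (\<lambda>t. t powr (p - 1) * exp (- t))"
    and integral_Gamma_Rpos: "(\<integral>t. t powr (p - 1) * exp (- t) \<partial>Rpos) = Gamma p"
proof -
  have eq: "indicator {0<..} t *\<^sub>R (t powr (p - 1) * exp (- t)) = indicator {0..} t * t powr (p - 1) / exp t" for t
    by (auto simp: indicator_def exp_minus field_simps)
  have nn: "(\<integral>\<^sup>+t. ennreal (indicator {0<..} t *\<^sub>R (t powr (p - 1) * exp (- t))) \<partial>lborel) = ennreal (Gamma p)"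
    unfolding eq by (rule Gamma_conv_nn_integral_real[OF p, symmetric])
  have int: "integrable lborel (\<lambda>t. indicator {0<..} t *\<^sub>R (t powr (p - 1) * exp (- t)))"
    by (rule integrableI_nn_integral_finite[OF _ _ nn]) (auto simp: indicator_def)
  then show "integrable Rpos (\<lambda>t. t powr (p - 1) * exp (- t))" by (simp add: integrable_Rpos_lborel)
  show "(\<integral>t. t powr (p - 1) * exp (- t) \<partial>Rpos) = Gamma p"
    using nn Gamma_real_pos[OF p]
    by (simp add: integral_Rpos_lborel) (subst integral_eq_nn_integral, auto simp: indicator_def)
qed

lemma
  assumes p: "p > (0::real)" and a: "a > 0"
  shows integrable_Gamma_Rpos_scaled: "integrable Rpos (\<lambda>t. t powr (p - 1) * exp (- (a * t)))"
    and integral_Gamma_Rpos_scaled: "(\<integral>t. t powr (p - 1) * exp (- (a * t)) \<partial>Rpos) = Gamma p / a powr p"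
proof -
  have eq: "t powr (p - 1) * exp (- (a * t)) = a powr (1 - p) * ((a * t) powr (p - 1) * exp (- (a * t)))"
    if "t \<in> space Rpos" for t
    using a that by (simp add: powr_mult powr_diff field_simps)
  have int: "integrable Rpos (\<lambda>t. (a * t) powr (p - 1) * exp (- (a * t)))"
    using integrable_Rpos_scale[of "\<lambda>t. t powr (p - 1) * exp (- t)" a] integrable_Gamma_Rpos[OF p] a by simp
  then show "integrable Rpos (\<lambda>t. t powr (p - 1) * exp (- (a * t)))"
    by (subst Bochner_Integration.integrable_cong[OF refl eq]) auto
  have "(\<integral>t. t powr (p - 1) * exp (- (a * t)) \<partial>Rpos) =
      (\<integral>t. a powr (1 - p) * ((a * t) powr (p - 1) * exp (- (a * t))) \<partial>Rpos)"
    by (rule Bochner_Integration.integral_cong[OF refl eq])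
  also have "\<dots> = a powr (1 - p) * (Gamma p / a)"
    using integral_Rpos_scale[of "\<lambda>t. t powr (p - 1) * exp (- t)" a] integral_Gamma_Rpos[OF p] a by simp
  also have "\<dots> = Gamma p / a powr p"
    using a by (simp add: powr_diff field_simps)
  finally show "(\<integral>t. t powr (p - 1) * exp (- (a * t)) \<partial>Rpos) = Gamma p / a powr p" .
qed

lemma integrable_power_exp_Rpos:
  assumes "a > 0"
  shows "integrable Rpos (\<lambda>t. t ^ n * exp (- (a * t)))"
proof -
  have "t powr (real (Suc n) - 1) * exp (- (a * t)) = t ^ n * exp (- (a * t))" if "t \<in> space Rpos" for t
    using that by (simp add: powr_realpow)
  then show ?thesis
    using integrable_Gamma_Rpos_scaled[of "real (Suc n)" a] assms
    by (subst (asm) Bochner_Integration.integrable_cong[OF refl]) auto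
qed

lemma integrable_polynomial_exp_Rpos:
  assumes p: "real_polynomial_function p" and a: "a > 0"
  shows "integrable Rpos (\<lambda>t. p t * exp (- (a * t)))"
proof -
  obtain c n where "p = (\<lambda>x. \<Sum>i\<le>n. c i * x ^ i)" using p real_polynomial_function_iff_sum by blast
  then show ?thesis
    using integrable_power_exp_Rpos[OF a] by (simp add: sum_distrib_right mult.assoc)
qed

lemma borel_measurable_polynomial: "real_polynomial_function (p :: real \<Rightarrow> real) \<Longrightarrow> p \<in> borel_measurable borel"
  by (intro borel_measurable_continuous_onI) (simp add: continuous_on_polymonial_function real_polynomial_function_eq)

lemma integrable_polynomial_mult_Rpos:
  fixes u :: "real \<Rightarrow> real"
  assumes p: "real_polynomial_function p" and a: "a > 0"
    and u: "u \<in> borel_measurable borel" "\<And>x. x > 0 \<Longrightarrow> \<bar>u x\<bar> \<le> C * exp (- (a * x))"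
  shows "integrable Rpos (\<lambda>x. p x * u x)"
proof (rule Bochner_Integration.integrable_bound)
  show "integrable Rpos (\<lambda>x. C * (p x * exp (- (a * x))))"
    using integrable_polynomial_exp_Rpos[OF p a] by simp
  have [measurable]: "p \<in> borel_measurable borel" "u \<in> borel_measurable borel"
    using p u by (auto intro: borel_measurable_polynomial)
  show "(\<lambda>x. p x * u x) \<in> borel_measurable Rpos" by (rule borel_measurable_Rpos) measurable
  show "AE x in Rpos. norm (p x * u x) \<le> norm (C * (p x * exp (- (a * x))))"
  proof (rule AE_I2)
    fix x :: real assume "x \<in> space Rpos"
    then have "\<bar>u x\<bar> \<le> C * exp (- (a * x))" using u by simp
    then have "\<bar>u x\<bar> \<le> \<bar>C\<bar> * exp (- (a * x))"
      by (rule order_trans) (intro mult_right_mono, auto)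
    then have "\<bar>p x\<bar> * \<bar>u x\<bar> \<le> \<bar>p x\<bar> * (\<bar>C\<bar> * exp (- (a * x)))" by (intro mult_left_mono) auto
    then show "norm (p x * u x) \<le> norm (C * (p x * exp (- (a * x))))"
      by (simp add: abs_mult mult_ac)
  qed
qed

lemma integrable_exp_bound_Rpos:
  fixes u :: "real \<Rightarrow> real"
  assumes "a > 0" "u \<in> borel_measurable borel" "\<And>x. x > 0 \<Longrightarrow> \<bar>u x\<bar> \<le> C * exp (- (a * x))"
  shows "integrable Rpos u"
proof -
  have "real_polynomial_function (\<lambda>x::real. 1)" by (rule real_polynomial_function.intros)
  from integrable_polynomial_mult_Rpos[OF this assms] show ?thesis by simp
qed

lemma inverse_cosh_le: "1 / cosh x \<le> 2 * exp (- x)" for x :: real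
proof -
  have "exp x \<le> 2 * cosh x" by (simp add: cosh_def)
  then show ?thesis by (simp add: exp_minus field_simps)
qed

lemma exp_tendsto_0_at_top: "a > 0 \<Longrightarrow> ((\<lambda>t. exp (- (a * t))) \<longlongrightarrow> 0) at_top" for a :: real
  by (auto intro!: filterlim_compose[OF exp_at_bot] filterlim_tendsto_pos_mult_at_top filterlim_ident
      simp: filterlim_uminus_at_bot)

lemma
  assumes a: "a > (0::real)"
  shows integral_exp_cos_Rpos: "(\<integral>t. exp (- (a * t)) * cos (b * t) \<partial>Rpos) = a / (a\<^sup>2 + b\<^sup>2)"
    and integral_exp_sin_Rpos: "(\<integral>t. exp (- (a * t)) * sin (b * t) \<partial>Rpos) = b / (a\<^sup>2 + b\<^sup>2)"
    and integrable_exp_cos_Rpos: "integrable Rpos (\<lambda>t. exp (- (a * t)) * cos (b * t))"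
    and integrable_exp_sin_Rpos: "integrable Rpos (\<lambda>t. exp (- (a * t)) * sin (b * t))"
proof -
  have pos: "a\<^sup>2 + b\<^sup>2 > 0" using a by (simp add: sum_power2_gt_zero_iff)
  show ic: "integrable Rpos (\<lambda>t. exp (- (a * t)) * cos (b * t))"
    by (rule integrable_exp_bound_Rpos[OF a, of _ 1]) (auto simp: abs_mult mult_left_le)
  show isin: "integrable Rpos (\<lambda>t. exp (- (a * t)) * sin (b * t))"
    by (rule integrable_exp_bound_Rpos[OF a, of _ 1]) (auto simp: abs_mult mult_left_le)
  have lim: "((\<lambda>t. exp (- (a * t)) * u t / (a\<^sup>2 + b\<^sup>2)) \<longlongrightarrow> 0) at_top"
    if u: "\<And>t. \<bar>u t\<bar> \<le> C" for u and C :: real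
  proof -
    have bound: "norm (exp (- (a * t)) * u t / (a\<^sup>2 + b\<^sup>2)) \<le> C / (a\<^sup>2 + b\<^sup>2) * exp (- (a * t))" for t
    proof -
      have "\<bar>exp (- (a * t)) * u t / (a\<^sup>2 + b\<^sup>2)\<bar> = exp (- (a * t)) / (a\<^sup>2 + b\<^sup>2) * \<bar>u t\<bar>"
        using pos by (simp add: abs_mult)
      also have "\<dots> \<le> exp (- (a * t)) / (a\<^sup>2 + b\<^sup>2) * C"
        using pos u by (intro mult_left_mono) auto
      finally show ?thesis by (simp add: mult.commute)
    qed
    show ?thesis
      by (rule Lim_null_comparison[OF always_eventually[OF allI[OF bound]]])
        (rule tendsto_mult_right_zero[OF exp_tendsto_0_at_top[OF a]])
  qed
  have bd: "\<bar>b * sin t - a * cos t\<bar> \<le> \<bar>b\<bar> + \<bar>a\<bar>" "\<bar>- (a * sin t + b * cos t)\<bar> \<le> \<bar>b\<bar> + \<bar>a\<bar>" for t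
  proof -
    have *: "\<bar>x * sin t\<bar> \<le> \<bar>x\<bar>" "\<bar>x * cos t\<bar> \<le> \<bar>x\<bar>" for x :: real
      by (auto simp: abs_mult mult_left_le)
    show "\<bar>b * sin t - a * cos t\<bar> \<le> \<bar>b\<bar> + \<bar>a\<bar>" "\<bar>- (a * sin t + b * cos t)\<bar> \<le> \<bar>b\<bar> + \<bar>a\<bar>"
      using *(1)[of b] *(2)[of a] *(1)[of a] *(2)[of b] by linarith+
  qed
  have "(\<integral>t. exp (- (a * t)) * cos (b * t) \<partial>Rpos) = 0 - exp (- (a * 0)) * (b * sin (b * 0) - a * cos (b * 0)) / (a\<^sup>2 + b\<^sup>2)"
  proof (rule integral_Rpos_FTC)
    show "continuous_on UNIV (\<lambda>t. exp (- (a * t)) * cos (b * t))" by (intro continuous_intros)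
    show "isCont (\<lambda>t. exp (- (a * t)) * (b * sin (b * t) - a * cos (b * t)) / (a\<^sup>2 + b\<^sup>2)) 0"
      using pos by (intro continuous_intros) auto
    show "((\<lambda>t. exp (- (a * t)) * (b * sin (b * t) - a * cos (b * t)) / (a\<^sup>2 + b\<^sup>2)) has_real_derivative
        exp (- (a * x)) * cos (b * x)) (at x)" for x
    proof -
      have "((\<lambda>t. exp (- (a * t)) * (b * sin (b * t) - a * cos (b * t))) has_real_derivative
          exp (- (a * x)) * cos (b * x) * (a\<^sup>2 + b\<^sup>2)) (at x)"
        by (auto intro!: derivative_eq_intros simp: power2_eq_square algebra_simps)
      from DERIV_cdivide[OF this, of "a\<^sup>2 + b\<^sup>2"] show ?thesis using a by simp
    qed
  qed (rule ic, rule lim, rule bd)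
  then show "(\<integral>t. exp (- (a * t)) * cos (b * t) \<partial>Rpos) = a / (a\<^sup>2 + b\<^sup>2)" by simp
  have "(\<integral>t. exp (- (a * t)) * sin (b * t) \<partial>Rpos) = 0 - exp (- (a * 0)) * (- (a * sin (b * 0) + b * cos (b * 0))) / (a\<^sup>2 + b\<^sup>2)"
  proof (rule integral_Rpos_FTC)
    show "continuous_on UNIV (\<lambda>t. exp (- (a * t)) * sin (b * t))" by (intro continuous_intros)
    show "isCont (\<lambda>t. exp (- (a * t)) * (- (a * sin (b * t) + b * cos (b * t))) / (a\<^sup>2 + b\<^sup>2)) 0"
      using pos by (intro continuous_intros) auto
    show "((\<lambda>t. exp (- (a * t)) * (- (a * sin (b * t) + b * cos (b * t))) / (a\<^sup>2 + b\<^sup>2)) has_real_derivative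
        exp (- (a * x)) * sin (b * x)) (at x)" for x
    proof -
      have "((\<lambda>t. exp (- (a * t)) * (- (a * sin (b * t) + b * cos (b * t)))) has_real_derivative
          exp (- (a * x)) * sin (b * x) * (a\<^sup>2 + b\<^sup>2)) (at x)"
        by (auto intro!: derivative_eq_intros simp: power2_eq_square algebra_simps)
      from DERIV_cdivide[OF this, of "a\<^sup>2 + b\<^sup>2"] show ?thesis using a by simp
    qed
  qed (rule isin, rule lim, rule bd)
  then show "(\<integral>t. exp (- (a * t)) * sin (b * t) \<partial>Rpos) = b / (a\<^sup>2 + b\<^sup>2)" by simp
qed

text \<open>Logarithmic differentiation of the reflection formula for
  \<open>Gamma z * Gamma (1 - z)\<close> writes the cotangent as
  \<open>Digamma (1 - z) - Digamma z\<close>. Subtracting the two Digamma series removes the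
  harmonic terms and the Euler constant.\<close>

lemma cot_partial_fractions:
  fixes z :: complex
  assumes z: "z \<notin> \<int>"
  shows "(\<lambda>n. inverse (z + of_nat n) - inverse (1 - z + of_nat n)) sums
    (of_real pi * cos (of_real pi * z) / sin (of_real pi * z))"
proof -
  have z1: "1 - z \<notin> \<int>" using z by (metis Ints_1 Ints_diff add_diff_cancel_left' diff_add_cancel minus_diff_eq diff_diff_eq2)
  have np: "z \<notin> \<int>\<^sub>\<le>\<^sub>0" "1 - z \<notin> \<int>\<^sub>\<le>\<^sub>0" using z z1 nonpos_Ints_Int by blast+
  have nz: "z \<noteq> 0" "1 - z \<noteq> 0" using np by (metis zero_in_nonpos_Ints)+
  have s: "sin (of_real pi * z) \<noteq> 0"
    using z sin_eq_0[of "of_real pi * z"] by (auto simp: Ints_def)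
  have d1: "((\<lambda>z. Gamma z * Gamma (1 - z)) has_field_derivative
      Gamma z * Gamma (1 - z) * (Digamma z - Digamma (1 - z))) (at z)"
    using np by (auto intro!: derivative_eq_intros simp: algebra_simps)
  have d2: "((\<lambda>z. of_real pi / sin (of_real pi * z)) has_field_derivative
      - (of_real pi * of_real pi * cos (of_real pi * z) / (sin (of_real pi * z))\<^sup>2)) (at z)"
    using s by (auto intro!: derivative_eq_intros simp: power2_eq_square)
  have "Gamma z * Gamma (1 - z) * (Digamma z - Digamma (1 - z)) =
      - (of_real pi * of_real pi * cos (of_real pi * z) / (sin (of_real pi * z))\<^sup>2)"
    using d1 d2 unfolding Gamma_reflection_complex by (rule DERIV_unique)
  then have eq: "of_real pi / sin (of_real pi * z) * (Digamma z - Digamma (1 - z)) =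
      - (of_real pi * of_real pi * cos (of_real pi * z) / (sin (of_real pi * z))\<^sup>2)"
    by (simp only: Gamma_reflection_complex)
  have "Digamma z - Digamma (1 - z) =
      sin (of_real pi * z) / of_real pi * (of_real pi / sin (of_real pi * z) * (Digamma z - Digamma (1 - z)))"
    using s by simp
  also have "\<dots> = - (of_real pi * cos (of_real pi * z) / sin (of_real pi * z))"
    unfolding eq using s by (simp add: power2_eq_square)
  finally have refl: "Digamma (1 - z) - Digamma z = of_real pi * cos (of_real pi * z) / sin (of_real pi * z)"
    by (simp add: algebra_simps)
  have "(\<lambda>n. (inverse (of_nat (Suc n)) - inverse (1 - z + of_nat n)) - (inverse (of_nat (Suc n)) - inverse (z + of_nat n)))
     sums ((Digamma (1 - z) + euler_mascheroni) - (Digamma z + euler_mascheroni))"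
    unfolding Digamma_def diff_add_cancel by (intro sums_diff summable_sums summable_Digamma nz)
  then show ?thesis unfolding refl[symmetric] by simp
qed

section \<open>Transforms of the hyperbolic secant and cosecant\<close>

lemma cos_div_sin_eq:
  fixes z w :: complex
  assumes "sin z \<noteq> 0" "cos z = w * sin z"
  shows "of_real pi * cos z / sin z = of_real pi * w"
  using assms by simp

text \<open>The real part of the cotangent expansion at z = 1/4 + i \<tau>/2. At this point pi z has
  real part pi/4, where sine and cosine agree, and the offsets 1/4 + n and 3/4 + n, doubled, are the
  decay rates in \<open>sech_half_sums\<close>.\<close>

lemma sech_partial_fractions:
  "(\<lambda>n. 2 * ((2 * real n + 1/2) / ((2 * real n + 1/2)\<^sup>2 + \<tau>\<^sup>2)
        - (2 * real n + 3/2) / ((2 * real n + 3/2)\<^sup>2 + \<tau>\<^sup>2))) sums (pi / cosh (pi * \<tau>))"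
proof -
  define z where "z = Complex (1/4) (\<tau> / 2)"
  define y where "y = pi * \<tau> / 2"
  have z: "z \<notin> \<int>"
  proof
    assume "z \<in> \<int>"
    then obtain k :: int where "z = of_int k" by (auto simp: Ints_def)
    then have "Re z = of_int k" by simp
    then have "1 = 4 * k" by (simp add: z_def)
    then show False by presburger
  qed
  have pz: "of_real pi * z = Complex (pi / 4) y" by (simp add: z_def y_def complex_eq_iff)
  have exps: "exp y + exp (- y) = 2 * cosh y" "exp y - exp (- y) = 2 * sinh y"
    "exp (- y) - exp y = - (2 * sinh y)"
    by (simp_all add: cosh_def sinh_def field_simps)
  have sin: "sin (of_real pi * z) = of_real (sqrt 2 / 2) * Complex (cosh y) (sinh y)"
    unfolding pz by (simp add: complex_eq_iff Re_sin Im_sin exps sin_45 cos_45)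
  have cos: "cos (of_real pi * z) = of_real (sqrt 2 / 2) * Complex (cosh y) (- sinh y)"
    unfolding pz by (simp add: complex_eq_iff Re_cos Im_cos exps sin_45 cos_45)
  \<comment> \<open>The value of the cotangent, (1 - i sinh 2y) / cosh 2y; it is verified through
    the double-argument formulas.\<close>
  define w where "w = Complex (1 / cosh (2 * y)) (- sinh (2 * y) / cosh (2 * y))"
  have "Complex (cosh y) (- sinh y) = w * Complex (cosh y) (sinh y)"
  proof -
    define c where "c = cosh (2 * y)"
    define d where "d = sinh (2 * y)"
    have c0: "c \<noteq> 0" by (simp add: c_def)
    have c: "c = 2 * (sinh y)\<^sup>2 + 1" "c = 2 * (cosh y)\<^sup>2 - 1"
      by (simp_all add: c_def cosh_double cosh_square_eq)
    have d: "d = 2 * sinh y * cosh y" by (simp add: d_def sinh_double)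
    have "cosh y * c = cosh y + d * sinh y"
      unfolding c(1) d by (simp add: power2_eq_square algebra_simps)
    moreover have "- sinh y * c = sinh y - d * cosh y"
      unfolding c(2) d by (simp add: power2_eq_square algebra_simps)
    ultimately show ?thesis using c0 unfolding w_def c_def[symmetric] d_def[symmetric]
      by (simp add: complex_eq_iff field_simps)
  qed
  then have "cos (of_real pi * z) = w * sin (of_real pi * z)" unfolding sin cos by simp
  moreover have "sin (of_real pi * z) \<noteq> 0" unfolding sin by (simp add: complex_eq_iff)
  ultimately have "of_real pi * cos (of_real pi * z) / sin (of_real pi * z) = of_real pi * w"
    by (intro cos_div_sin_eq)
  then have "(\<lambda>n. Re (inverse (z + of_nat n) - inverse (1 - z + of_nat n))) sums Re (of_real pi * w)"
    using cot_partial_fractions[OF z] by (intro sums_Re) simp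
  moreover have "Re (of_real pi * w) = pi / cosh (pi * \<tau>)" by (simp add: w_def y_def)
  moreover have "Re (inverse (z + of_nat n) - inverse (1 - z + of_nat n)) =
      2 * ((2 * real n + 1/2) / ((2 * real n + 1/2)\<^sup>2 + \<tau>\<^sup>2)
        - (2 * real n + 3/2) / ((2 * real n + 3/2)\<^sup>2 + \<tau>\<^sup>2))" for n
  proof -
    have half: "b / (b\<^sup>2 + (\<tau> / 2)\<^sup>2) = 2 * (2 * b / ((2 * b)\<^sup>2 + \<tau>\<^sup>2))" for b
    proof -
      have "(2 * b)\<^sup>2 + \<tau>\<^sup>2 = 4 * (b\<^sup>2 + (\<tau> / 2)\<^sup>2)" by (simp add: power2_eq_square)
      moreover have "2 * (2 * b / (4 * x)) = b / x" for x :: real by simp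
      ultimately show ?thesis by (simp only:)
    qed
    have "Re (inverse (z + of_nat n) - inverse (1 - z + of_nat n)) =
        (1/4 + real n) / ((1/4 + real n)\<^sup>2 + (\<tau> / 2)\<^sup>2) - (3/4 + real n) / ((3/4 + real n)\<^sup>2 + (\<tau> / 2)\<^sup>2)"
      by (simp add: z_def)
    also have "\<dots> = 2 * (2 * (1/4 + real n) / ((2 * (1/4 + real n))\<^sup>2 + \<tau>\<^sup>2)) -
        2 * (2 * (3/4 + real n) / ((2 * (3/4 + real n))\<^sup>2 + \<tau>\<^sup>2))"
      by (simp only: half)
    also have "2 * (1/4 + real n) = 2 * real n + 1/2" by simp
    also have "2 * (3/4 + real n) = 2 * real n + 3/2" by simp
    finally show ?thesis by simp
  qed
  ultimately show ?thesis by (simp only:)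
qed

text \<open>At z = 1/2 + i \<tau> the numbers z and 1 - z are conjugate, so every term of the
  cotangent expansion is purely imaginary, and the cotangent itself is -i tanh(pi \<tau>).\<close>

lemma tanh_partial_fractions:
  "(\<lambda>n. 2 * \<tau> / ((real n + 1/2)\<^sup>2 + \<tau>\<^sup>2)) sums (pi * tanh (pi * \<tau>))"
proof -
  define z where "z = Complex (1/2) \<tau>"
  define y where "y = pi * \<tau>"
  have z: "z \<notin> \<int>"
  proof
    assume "z \<in> \<int>"
    then obtain k :: int where "z = of_int k" by (auto simp: Ints_def)
    then have "Re z = of_int k" by simp
    then have "1 = 2 * k" by (simp add: z_def)
    then show False by presburger
  qed
  have pz: "of_real pi * z = Complex (pi / 2) y" by (simp add: z_def y_def complex_eq_iff)
  have exps: "exp y + exp (- y) = 2 * cosh y" "exp y - exp (- y) = 2 * sinh y"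
    "exp (- y) - exp y = - (2 * sinh y)"
    by (simp_all add: cosh_def sinh_def field_simps)
  have sin: "sin (of_real pi * z) = Complex (cosh y) 0"
    unfolding pz by (simp add: complex_eq_iff Re_sin Im_sin exps)
  have cos: "cos (of_real pi * z) = Complex 0 (- sinh y)"
    unfolding pz by (simp add: complex_eq_iff Re_cos Im_cos exps)
  have "cos (of_real pi * z) = Complex 0 (- tanh y) * sin (of_real pi * z)"
    unfolding sin cos by (simp add: complex_eq_iff tanh_def)
  moreover have "sin (of_real pi * z) \<noteq> 0" unfolding sin by (simp add: complex_eq_iff)
  ultimately have "of_real pi * cos (of_real pi * z) / sin (of_real pi * z) = of_real pi * Complex 0 (- tanh y)"
    by (intro cos_div_sin_eq)
  then have "(\<lambda>n. - Im (inverse (z + of_nat n) - inverse (1 - z + of_nat n))) sums (- Im (of_real pi * Complex 0 (- tanh y)))"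
    using cot_partial_fractions[OF z] by (intro sums_minus sums_Im) simp
  moreover have "- Im (inverse (z + of_nat n) - inverse (1 - z + of_nat n)) = 2 * \<tau> / ((real n + 1/2)\<^sup>2 + \<tau>\<^sup>2)" for n
    by (simp add: z_def add.commute)
  ultimately show ?thesis by (simp add: y_def)
qed

definition sech :: "real \<Rightarrow> real" where "sech x = 1 / cosh x"

lemma sech_pos [simp]: "sech x > 0" by (simp add: sech_def)
lemma sech_le_1 [simp]: "sech x \<le> 1" by (simp add: sech_def cosh_real_ge_1)
lemma sech_le_exp: "sech x \<le> 2 * exp (- x)" unfolding sech_def by (rule inverse_cosh_le)
lemma borel_measurable_sech [measurable]: "sech \<in> borel_measurable borel" unfolding sech_def by measurable

lemma continuous_on_sech [continuous_intros]: "continuous_on A f \<Longrightarrow> continuous_on A (\<lambda>x. sech (f x))"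
  unfolding sech_def by (intro continuous_intros) auto

lemma sech_square: "(sech x)\<^sup>2 = 1 - (tanh x)\<^sup>2"
proof -
  have "(sinh x)\<^sup>2 + 1 \<noteq> 0" using cosh_square_eq[of x] by (metis cosh_real_nonzero power_not_zero)
  then show ?thesis
    by (simp add: sech_def tanh_def power_divide cosh_square_eq diff_divide_eq_iff)
qed

lemma DERIV_sech [THEN DERIV_chain2, derivative_intros]:
  "(sech has_real_derivative - (sech x * tanh x)) (at x)"
  unfolding sech_def tanh_def
  by (auto intro!: derivative_eq_intros simp: power2_eq_square)

text \<open>With x = exp(-t/2), sech is 2x/(1 + x^2), whose geometric expansion alternates. Writing
  it as 2(x - x^3)/(1 - x^4) groups neighbouring terms into positive ones, so that the series can
  serve as its own majorant under the cosine.\<close>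

lemma sech_half_sums:
  assumes t: "t > 0"
  shows "(\<lambda>n. 2 * (exp (- ((2 * real n + 1/2) * t)) - exp (- ((2 * real n + 3/2) * t)))) sums sech (t / 2)"
proof -
  define x where "x = exp (- (t / 2))"
  have x: "0 < x" "x < 1" using t by (simp_all add: x_def)
  have e: "exp (- ((2 * real n + 1/2) * t)) = x * (x ^ 4) ^ n" "exp (- ((2 * real n + 3/2) * t)) = x ^ 3 * (x ^ 4) ^ n" for n
    unfolding x_def by (simp_all flip: exp_of_nat_mult exp_add add: algebra_simps)
  have x4: "x ^ 4 < 1" using x by (simp add: power_less_one_iff)
  have "(\<lambda>n. 2 * (x - x ^ 3) * (x ^ 4) ^ n) sums (2 * (x - x ^ 3) * (1 / (1 - x ^ 4)))"
    using x x4 by (intro sums_mult geometric_sums) auto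
  moreover have "2 * (x - x ^ 3) * (1 / (1 - x ^ 4)) = sech (t / 2)"
  proof -
    have c: "cosh (t / 2) = (1 / x + x) / 2" by (simp add: x_def cosh_def exp_minus field_simps)
    have "1 - x ^ 4 = (1 - x\<^sup>2) * (1 + x\<^sup>2)" by (simp add: algebra_simps power2_eq_square power4_eq_xxxx)
    moreover have "x - x ^ 3 = x * (1 - x\<^sup>2)" by (simp add: algebra_simps power2_eq_square power3_eq_cube)
    moreover have "1 - x\<^sup>2 \<noteq> 0" using x by (simp add: power2_eq_1_iff)
    ultimately have "2 * (x - x ^ 3) * (1 / (1 - x ^ 4)) = 2 * x / (1 + x\<^sup>2)" by simp
    also have "\<dots> = sech (t / 2)" unfolding sech_def c using x by (simp add: field_simps power2_eq_square)
    finally show ?thesis .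
  qed
  moreover have "2 * (exp (- ((2 * real n + 1/2) * t)) - exp (- ((2 * real n + 3/2) * t))) =
      2 * (x - x ^ 3) * (x ^ 4) ^ n" for n
    unfolding e by (simp add: left_diff_distrib right_diff_distrib)
  ultimately show ?thesis by (simp only:)
qed

text \<open>Each exponential has a rational cosine transform, and the series integrated term by term
  is the partial fraction expansion of the right-hand side.\<close>

lemma integral_cos_sech_half: "(\<integral>t. cos (\<tau> * t) * sech (t / 2) \<partial>Rpos) = pi / cosh (pi * \<tau>)"
proof -
  define a where "a = (\<lambda>n. 2 * real n + 1/2)"
  define b where "b = (\<lambda>n. 2 * real n + 3/2)"
  have ab: "0 < a n" "a n \<le> b n" "0 < b n" for n by (simp_all add: a_def b_def add_pos_pos)
  define g where "g = (\<lambda>n t. 2 * (exp (- (a n * t)) - exp (- (b n * t))))"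
  define f where "f = (\<lambda>n t. cos (\<tau> * t) * g n t)"
  have e: "integrable Rpos (\<lambda>t. exp (- (c * t)))" "(\<integral>t. exp (- (c * t)) \<partial>Rpos) = 1 / c" if "c > 0" for c
    using integrable_exp_cos_Rpos[OF that, of 0] integral_exp_cos_Rpos[OF that, of 0] that
    by (simp_all add: power2_eq_square)
  have f_eq: "f n = (\<lambda>t. 2 * (exp (- (a n * t)) * cos (\<tau> * t)) - 2 * (exp (- (b n * t)) * cos (\<tau> * t)))" for n
    by (auto simp: f_def g_def algebra_simps)
  have f_int: "integrable Rpos (f n)" for n
    unfolding f_eq using ab[of n] integrable_exp_cos_Rpos[of "a n" \<tau>] integrable_exp_cos_Rpos[of "b n" \<tau>] by simp
  have f_val: "(\<integral>t. f n t \<partial>Rpos) = 2 * (a n / ((a n)\<^sup>2 + \<tau>\<^sup>2) - b n / ((b n)\<^sup>2 + \<tau>\<^sup>2))" for n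
    unfolding f_eq using ab[of n] integrable_exp_cos_Rpos[of "a n" \<tau>] integrable_exp_cos_Rpos[of "b n" \<tau>]
      integral_exp_cos_Rpos[of "a n" \<tau>] integral_exp_cos_Rpos[of "b n" \<tau>] by simp
  have g_int: "integrable Rpos (g n)" and g_val: "(\<integral>t. g n t \<partial>Rpos) = 2 * (1 / a n - 1 / b n)" for n
    unfolding g_def using ab[of n] e[of "a n"] e[of "b n"] by simp_all
  have g_nonneg: "g n t \<ge> 0" if "t > 0" for n t
    using ab[of n] that by (simp add: g_def mult_right_mono)
  have gs: "(\<lambda>n. g n t) sums sech (t / 2)" if "t > 0" for t
    using sech_half_sums[OF that] unfolding g_def a_def b_def .
  have fs: "(\<lambda>n. f n t) sums (cos (\<tau> * t) * sech (t / 2))" if "t > 0" for t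
    unfolding f_def by (intro sums_mult gs that)
  have "(\<lambda>n. \<integral>t. f n t \<partial>Rpos) sums (\<integral>t. (\<Sum>n. f n t) \<partial>Rpos)"
  proof (rule sums_integral[OF f_int])
    show "AE t in Rpos. summable (\<lambda>n. norm (f n t))"
    proof (rule AE_I2)
      fix t assume "t \<in> space Rpos"
      then have t: "t > 0" by simp
      show "summable (\<lambda>n. norm (f n t))"
        by (rule summable_comparison_test[OF _ sums_summable[OF gs[OF t]]])
          (auto simp: f_def abs_mult g_nonneg[OF t] mult_left_le_one_le)
    qed
    \<comment> \<open>The integrals of the positive terms form the same partial fraction expansion
      at \<tau> = 0.\<close>
    have "summable (\<lambda>n. 2 * (1 / a n - 1 / b n))"
      using sums_summable[OF sech_partial_fractions[of 0]]
      by (simp add: a_def b_def power2_eq_square)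
    then show "summable (\<lambda>n. \<integral>t. norm (f n t) \<partial>Rpos)"
    proof (rule summable_comparison_test[rotated], intro exI allI impI)
      fix n
      have "(\<integral>t. norm (f n t) \<partial>Rpos) \<le> (\<integral>t. g n t \<partial>Rpos)"
      proof (rule integral_mono)
        show "integrable Rpos (\<lambda>t. norm (f n t))" using f_int by (rule integrable_norm)
        show "norm (f n t) \<le> g n t" if "t \<in> space Rpos" for t
          using that g_nonneg[of t n] by (simp add: f_def abs_mult mult_left_le_one_le)
      qed (rule g_int)
      then show "norm (\<integral>t. norm (f n t) \<partial>Rpos) \<le> 2 * (1 / a n - 1 / b n)" by (simp add: g_val)
    qed
  qed
  moreover have "(\<integral>t. (\<Sum>n. f n t) \<partial>Rpos) = (\<integral>t. cos (\<tau> * t) * sech (t / 2) \<partial>Rpos)"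
    by (intro Bochner_Integration.integral_cong refl sums_unique[symmetric] fs) simp
  ultimately have "(\<lambda>n. 2 * (a n / ((a n)\<^sup>2 + \<tau>\<^sup>2) - b n / ((b n)\<^sup>2 + \<tau>\<^sup>2))) sums
      (\<integral>t. cos (\<tau> * t) * sech (t / 2) \<partial>Rpos)" by (simp only: f_val)
  then show ?thesis
    using sech_partial_fractions[of \<tau>] unfolding a_def b_def by (rule sums_unique2)
qed

lemma csch_half_sums:
  assumes t: "t > 0"
  shows "(\<lambda>n. 2 * exp (- ((real n + 1/2) * t))) sums (1 / sinh (t / 2))"
proof -
  define x where "x = exp (- (t / 2))"
  have x: "0 < x" "x < 1" using t by (simp_all add: x_def)
  have e: "exp (- ((real n + 1/2) * t)) = x * (x\<^sup>2) ^ n" for n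
    unfolding x_def by (simp flip: exp_of_nat_mult exp_add add: algebra_simps)
  have x2: "x\<^sup>2 < 1" using x by (simp add: power_less_one_iff)
  have "(\<lambda>n. 2 * x * (x\<^sup>2) ^ n) sums (2 * x * (1 / (1 - x\<^sup>2)))"
    using x x2 by (intro sums_mult geometric_sums) auto
  moreover have "2 * x * (1 / (1 - x\<^sup>2)) = 1 / sinh (t / 2)"
  proof -
    have s: "sinh (t / 2) = (1 / x - x) / 2" by (simp add: x_def sinh_def exp_minus field_simps)
    have "sinh (t / 2) = (1 - x\<^sup>2) / (2 * x)"
      unfolding s using x by (simp add: field_simps power2_eq_square)
    then show ?thesis by simp
  qed
  ultimately show ?thesis by (simp add: e mult.assoc)
qed

text \<open>As for the secant, except that csch(t/2) has a pole at 0. The estimate |sin(\<tau> t)|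
  \<le> |\<tau>| t compensates for it and bounds the integrals of the terms by multiples of 1/(a
  n)^2.\<close>

lemma integral_sin_csch_half: "(\<integral>t. sin (\<tau> * t) / sinh (t / 2) \<partial>Rpos) = pi * tanh (pi * \<tau>)"
proof -
  define a where "a = (\<lambda>n. real n + 1/2)"
  have a: "0 < a n" for n by (simp add: a_def add_nonneg_pos)
  define f where "f = (\<lambda>n t. 2 * (exp (- (a n * t)) * sin (\<tau> * t)))"
  have f_int: "integrable Rpos (f n)" for n
    unfolding f_def using integrable_exp_sin_Rpos[OF a] by simp
  have f_val: "(\<integral>t. f n t \<partial>Rpos) = 2 * \<tau> / ((a n)\<^sup>2 + \<tau>\<^sup>2)" for n
    unfolding f_def using integral_exp_sin_Rpos[OF a] by simp
  have fs: "(\<lambda>n. f n t) sums (sin (\<tau> * t) / sinh (t / 2))" if "t > 0" for t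
    using sums_mult[OF csch_half_sums[OF that], of "sin (\<tau> * t)"] by (simp add: f_def a_def mult_ac)
  have te: "integrable Rpos (\<lambda>t. t * exp (- (a n * t)))" "(\<integral>t. t * exp (- (a n * t)) \<partial>Rpos) = 1 / (a n)\<^sup>2" for n
  proof -
    have eq: "t powr (2 - 1) * exp (- (a n * t)) = t * exp (- (a n * t))" if "t \<in> space Rpos" for t
      using that by simp
    show "integrable Rpos (\<lambda>t. t * exp (- (a n * t)))"
      using integrable_power_exp_Rpos[OF a, of 1] by simp
    have "(\<integral>t. t * exp (- (a n * t)) \<partial>Rpos) = (\<integral>t. t powr (2 - 1) * exp (- (a n * t)) \<partial>Rpos)"
      by (rule Bochner_Integration.integral_cong[OF refl eq[symmetric]])
    also have "\<dots> = Gamma 2 / a n powr 2" by (rule integral_Gamma_Rpos_scaled) (simp_all add: a)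
    also have "\<dots> = 1 / (a n)\<^sup>2" using a[of n] Gamma_fact[of 1, where 'a = real] by (simp add: powr_numeral)
    finally show "(\<integral>t. t * exp (- (a n * t)) \<partial>Rpos) = 1 / (a n)\<^sup>2" .
  qed
  have f_bd: "norm (f n t) \<le> 2 * \<bar>\<tau>\<bar> * (t * exp (- (a n * t)))" if "t > 0" for n t
  proof -
    have "\<bar>sin (\<tau> * t)\<bar> \<le> \<bar>\<tau>\<bar> * t" using abs_sin_x_le_abs_x[of "\<tau> * t"] that by (simp add: abs_mult)
    then have "exp (- (a n * t)) * \<bar>sin (\<tau> * t)\<bar> \<le> exp (- (a n * t)) * (\<bar>\<tau>\<bar> * t)"
      by (intro mult_left_mono) auto
    then show ?thesis by (simp add: f_def abs_mult mult_ac)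
  qed
  have "(\<lambda>n. \<integral>t. f n t \<partial>Rpos) sums (\<integral>t. (\<Sum>n. f n t) \<partial>Rpos)"
  proof (rule sums_integral[OF f_int])
    show "AE t in Rpos. summable (\<lambda>n. norm (f n t))"
    proof (rule AE_I2)
      fix t assume "t \<in> space Rpos"
      then have t: "t > 0" by simp
      show "summable (\<lambda>n. norm (f n t))"
      proof (rule summable_comparison_test)
        show "summable (\<lambda>n. 2 * exp (- (a n * t)))"
          using sums_summable[OF csch_half_sums[OF t]] by (simp add: a_def)
      qed (auto simp: f_def abs_mult mult_left_le)
    qed
    \<comment> \<open>The comparison series is the expansion of the hyperbolic tangent at 1. The
      factor 5 comes from \<open>a n \<ge> 1/2\<close>, which gives (a n)^2 + 1 \<le> 5 (a
      n)^2.\<close>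
    have "summable (\<lambda>n. 5 * \<bar>\<tau>\<bar> * (2 * 1 / ((real n + 1/2)\<^sup>2 + 1\<^sup>2)))"
      by (intro summable_mult sums_summable[OF tanh_partial_fractions[of 1]])
    then show "summable (\<lambda>n. \<integral>t. norm (f n t) \<partial>Rpos)"
    proof (rule summable_comparison_test[rotated], intro exI allI impI)
      fix n
      have "(\<integral>t. norm (f n t) \<partial>Rpos) \<le> (\<integral>t. 2 * \<bar>\<tau>\<bar> * (t * exp (- (a n * t))) \<partial>Rpos)"
      proof (rule integral_mono)
        show "integrable Rpos (\<lambda>t. norm (f n t))" using f_int by (rule integrable_norm)
        show "integrable Rpos (\<lambda>t. 2 * \<bar>\<tau>\<bar> * (t * exp (- (a n * t))))" using te(1)[of n] by simp
      qed (use f_bd in simp)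
      also have "\<dots> = 2 * \<bar>\<tau>\<bar> * (1 / (a n)\<^sup>2)" by (simp add: te(2))
      also have "\<dots> \<le> 2 * \<bar>\<tau>\<bar> * (5 * (1 / ((a n)\<^sup>2 + 1)))"
      proof (rule mult_left_mono)
        have "(1/2)\<^sup>2 \<le> (a n)\<^sup>2" unfolding a_def by (intro power_mono) auto
        then have "1 \<le> 4 * (a n)\<^sup>2" by (simp add: power2_eq_square)
        moreover have "0 < (a n)\<^sup>2" using a[of n] by simp
        moreover have "0 < (a n)\<^sup>2 + 1" by (simp add: add_nonneg_pos)
        ultimately show "1 / (a n)\<^sup>2 \<le> 5 * (1 / ((a n)\<^sup>2 + 1))" by (simp add: field_simps)
      qed simp
      finally show "norm (\<integral>t. norm (f n t) \<partial>Rpos) \<le> 5 * \<bar>\<tau>\<bar> * (2 * 1 / ((real n + 1/2)\<^sup>2 + 1\<^sup>2))"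
        by (simp add: a_def mult_ac)
    qed
  qed
  moreover have "(\<integral>t. (\<Sum>n. f n t) \<partial>Rpos) = (\<integral>t. sin (\<tau> * t) / sinh (t / 2) \<partial>Rpos)"
    by (intro Bochner_Integration.integral_cong refl sums_unique[symmetric] fs) simp
  ultimately have "(\<lambda>n. 2 * \<tau> / ((a n)\<^sup>2 + \<tau>\<^sup>2)) sums (\<integral>t. sin (\<tau> * t) / sinh (t / 2) \<partial>Rpos)"
    by (simp only: f_val)
  then show ?thesis
    using tanh_partial_fractions[of \<tau>] unfolding a_def by (rule sums_unique2)
qed

section \<open>Cosine integrals of powers of sech(t/2)\<close>

lemma sech_power_le_exp:
  assumes "n \<ge> 1"
  shows "sech x ^ n \<le> 2 * exp (- x)"
proof -
  have "sech x ^ n \<le> sech x ^ 1" using assms by (intro power_decreasing) (auto simp: less_imp_le)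
  then show ?thesis using sech_le_exp[of x] by simp
qed

lemma integrable_polynomial_sech_power:
  assumes "real_polynomial_function p" "n \<ge> 1" "u \<in> borel_measurable borel" "\<And>t. \<bar>u t\<bar> \<le> (1::real)"
  shows "integrable Rpos (\<lambda>t. p t * (u t * sech (t / 2) ^ n))"
proof (rule integrable_polynomial_mult_Rpos[OF assms(1), of "1/2" _ 2])
  show "(\<lambda>t. u t * sech (t / 2) ^ n) \<in> borel_measurable borel" using assms(3) by measurable
  fix t :: real
  have "\<bar>u t * sech (t / 2) ^ n\<bar> \<le> 1 * (2 * exp (- (t / 2)))"
    unfolding abs_mult using assms(2,4)
    by (intro mult_mono) (auto simp: less_imp_le sech_power_le_exp)
  then show "\<bar>u t * sech (t / 2) ^ n\<bar> \<le> 2 * exp (- (1 / 2 * t))" by simp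
qed simp

lemma integrable_cos_sech_power:
  assumes "n \<ge> 1"
  shows "integrable Rpos (\<lambda>t. cos (\<tau> * t) * sech (t / 2) ^ n)"
proof -
  have "real_polynomial_function (\<lambda>x::real. 1)" by (rule real_polynomial_function.intros)
  from integrable_polynomial_sech_power[OF this assms, of "\<lambda>t. cos (\<tau> * t)"] show ?thesis by simp
qed

lemma sech_half_power_at_top:
  assumes "n \<ge> 1"
  shows "((\<lambda>t. sech (t / 2) ^ n) \<longlongrightarrow> 0) at_top"
proof (rule Lim_null_comparison[OF always_eventually[OF allI]])
  show "norm (sech (t / 2) ^ n) \<le> 2 * exp (- (1 / 2 * t))" for t
    using sech_power_le_exp[OF assms, of "t / 2"] by (simp add: less_imp_le)
  show "((\<lambda>t. 2 * exp (- (1 / 2 * t))) \<longlongrightarrow> (0::real)) at_top"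
    using tendsto_mult_right_zero[OF exp_tendsto_0_at_top[of "1/2"]] by simp
qed

lemma DERIV_sech_half_power:
  "((\<lambda>t. sech (t / 2) ^ n) has_real_derivative - (real n / 2) * (tanh (x / 2) * sech (x / 2) ^ n)) (at x)"
proof (cases n)
  case (Suc m)
  have "((\<lambda>t. sech (t / 2) ^ n) has_real_derivative
      real n * sech (x / 2) ^ (n - 1) * (- (sech (x / 2) * tanh (x / 2)) * (1/2))) (at x)"
    by (auto intro!: derivative_eq_intros)
  then show ?thesis by (simp add: Suc mult_ac)
qed simp

lemma DERIV_tanh_sech_half_power:
  "((\<lambda>t. tanh (t / 2) * sech (t / 2) ^ n) has_real_derivative
    (real n + 1) / 2 * sech (x / 2) ^ (n + 2) - real n / 2 * sech (x / 2) ^ n) (at x)"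
proof -
  have T: "((\<lambda>t. tanh (t / 2)) has_real_derivative (sech (x / 2))\<^sup>2 / 2) (at x)"
    unfolding sech_square by (auto intro!: derivative_eq_intros)
  have "(sech (x / 2))\<^sup>2 / 2 * sech (x / 2) ^ n + - (real n / 2) * (tanh (x / 2) * sech (x / 2) ^ n) * tanh (x / 2) =
      sech (x / 2) ^ n * ((sech (x / 2))\<^sup>2 / 2 - real n / 2 * (tanh (x / 2))\<^sup>2)"
    by (simp add: algebra_simps power2_eq_square)
  also have "(tanh (x / 2))\<^sup>2 = 1 - (sech (x / 2))\<^sup>2" by (simp add: sech_square)
  also have "sech (x / 2) ^ n * ((sech (x / 2))\<^sup>2 / 2 - real n / 2 * (1 - (sech (x / 2))\<^sup>2)) =
      (real n + 1) / 2 * sech (x / 2) ^ (n + 2) - real n / 2 * sech (x / 2) ^ n"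
    by (simp add: field_simps power_add power2_eq_square)
  finally show ?thesis
    using DERIV_mult[OF T DERIV_sech_half_power[of n x]] by simp
qed

text \<open>The second derivative of sech(t/2)^n is n^2/4 times that power minus n(n+1)/4 times the
  power n + 2. Two integrations by parts against the cosine turn the second derivative into the
  factor -\<tau>^2.\<close>

lemma integral_cos_sech_power_recurrence:
  assumes n: "n \<ge> 1"
  shows "real n * (real n + 1) * (\<integral>t. cos (\<tau> * t) * sech (t / 2) ^ (n + 2) \<partial>Rpos) =
    ((real n)\<^sup>2 + 4 * \<tau>\<^sup>2) * (\<integral>t. cos (\<tau> * t) * sech (t / 2) ^ n \<partial>Rpos)"
proof -
  let ?S = "\<lambda>t. sech (t / 2)" and ?T = "\<lambda>t. tanh (t / 2)"
  \<comment> \<open>The Wronskian of the cosine and sech(t/2)^n: it collects the boundary terms of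
    both integrations by parts, and vanishes at 0 because sine and tanh do.\<close>
  let ?E = "\<lambda>t. \<tau> * sin (\<tau> * t) * ?S t ^ n - real n / 2 * cos (\<tau> * t) * (?T t * ?S t ^ n)"
  let ?f = "\<lambda>t. ((real n)\<^sup>2 / 4 + \<tau>\<^sup>2) * (cos (\<tau> * t) * ?S t ^ n) -
    real n * (real n + 1) / 4 * (cos (\<tau> * t) * ?S t ^ (n + 2))"
  have i: "integrable Rpos (\<lambda>t. cos (\<tau> * t) * ?S t ^ n)" "integrable Rpos (\<lambda>t. cos (\<tau> * t) * ?S t ^ (n + 2))"
    using n by (intro integrable_cos_sech_power; simp)+
  have deriv: "(?E has_real_derivative ?f x) (at x)" for x
  proof -
    have "(?E has_real_derivative
      (\<tau> * (\<tau> * cos (\<tau> * x)) * ?S x ^ n + \<tau> * sin (\<tau> * x) * (- (real n / 2) * (?T x * ?S x ^ n))) -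
      (real n / 2 * (- \<tau> * sin (\<tau> * x)) * (?T x * ?S x ^ n) +
       real n / 2 * cos (\<tau> * x) * ((real n + 1) / 2 * ?S x ^ (n + 2) - real n / 2 * ?S x ^ n))) (at x)"
      by (rule derivative_eq_intros DERIV_sech_half_power DERIV_tanh_sech_half_power n refl | simp)+
    then show ?thesis
      by (rule back_subst[of "\<lambda>d. (?E has_real_derivative d) (at x)"])
        (simp add: algebra_simps power2_eq_square)
  qed
  have "integral\<^sup>L Rpos ?f = 0 - ?E 0"
  proof (rule integral_Rpos_FTC[OF _ _ deriv])
    show "continuous_on UNIV ?f" by (intro continuous_intros) auto
    show "integrable Rpos ?f" using i by simp
    show "isCont ?E 0" using deriv by (rule DERIV_isCont)
    show "(?E \<longlongrightarrow> 0) at_top"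
    proof (rule Lim_null_comparison[OF always_eventually[OF allI]])
      fix t
      have "\<bar>sin (\<tau> * t)\<bar> \<le> 1" "\<bar>cos (\<tau> * t) * ?T t\<bar> \<le> 1"
        using tanh_real_lt_1[of "t / 2"] tanh_real_gt_neg1[of "t / 2"]
        by (auto simp: abs_mult intro!: mult_le_one)
      then have "\<bar>\<tau>\<bar> * \<bar>sin (\<tau> * t)\<bar> * ?S t ^ n \<le> \<bar>\<tau>\<bar> * 1 * ?S t ^ n"
        "real n / 2 * \<bar>cos (\<tau> * t) * ?T t\<bar> * ?S t ^ n \<le> real n / 2 * 1 * ?S t ^ n"
        by (intro mult_left_mono mult_right_mono; simp add: less_imp_le)+
      moreover have "norm (?E t) \<le> \<bar>\<tau>\<bar> * \<bar>sin (\<tau> * t)\<bar> * ?S t ^ n + real n / 2 * \<bar>cos (\<tau> * t) * ?T t\<bar> * ?S t ^ n"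
        unfolding real_norm_def
        by (rule order_trans[OF abs_triangle_ineq4]) (simp add: abs_mult less_imp_le mult_ac)
      ultimately show "norm (?E t) \<le> (\<bar>\<tau>\<bar> + real n / 2) * ?S t ^ n"
        by (simp add: algebra_simps)
      show "((\<lambda>t. (\<bar>\<tau>\<bar> + real n / 2) * ?S t ^ n) \<longlongrightarrow> 0) at_top"
        by (rule tendsto_mult_right_zero[OF sech_half_power_at_top[OF n]])
    qed
  qed
  moreover have "integral\<^sup>L Rpos ?f = ((real n)\<^sup>2 / 4 + \<tau>\<^sup>2) * (\<integral>t. cos (\<tau> * t) * ?S t ^ n \<partial>Rpos) -
      real n * (real n + 1) / 4 * (\<integral>t. cos (\<tau> * t) * ?S t ^ (n + 2) \<partial>Rpos)"
    using i by simp
  ultimately show ?thesis by (simp add: field_simps)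
qed

text \<open>The mean value inequality bounds every difference quotient by the majorant
  \<open>g\<close> of the derivative, so dominated convergence applies along each sequence of
  increments tending to 0.\<close>

lemma has_derivative_under_integral:
  fixes f f' :: "real \<Rightarrow> 'a \<Rightarrow> real"
  assumes deriv: "\<And>s x. x \<in> space M \<Longrightarrow> ((\<lambda>s. f s x) has_real_derivative f' s x) (at s)"
    and f: "\<And>s. integrable M (f s)" and f': "\<And>s. f' s \<in> borel_measurable M"
    and bound: "\<And>s x. x \<in> space M \<Longrightarrow> \<bar>f' s x\<bar> \<le> g x" and g: "integrable M g"
  shows "((\<lambda>s. \<integral>x. f s x \<partial>M) has_real_derivative (\<integral>x. f' s x \<partial>M)) (at s)"
  unfolding DERIV_def
proof (subst tendsto_at_iff_sequentially, intro allI impI)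
  fix X :: "nat \<Rightarrow> real" assume X: "\<forall>i. X i \<in> UNIV - {0}" "X \<longlonglongrightarrow> 0"
  have "(\<lambda>n. \<integral>x. (f (s + X n) x - f s x) / X n \<partial>M) \<longlonglongrightarrow> (\<integral>x. f' s x \<partial>M)"
  proof (rule integral_dominated_convergence[OF f' _ g])
    show "(\<lambda>x. (f (s + X n) x - f s x) / X n) \<in> borel_measurable M" for n
      using f by (intro borel_measurable_divide borel_measurable_diff borel_measurable_integrable) auto
    show "AE x in M. (\<lambda>n. (f (s + X n) x - f s x) / X n) \<longlonglongrightarrow> f' s x"
    proof (rule AE_I2)
      fix x assume "x \<in> space M"
      then have "((\<lambda>h. (f (s + h) x - f s x) / h) \<longlongrightarrow> f' s x) (at 0)"
        using deriv by (simp add: DERIV_def)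
      then have "((\<lambda>h. (f (s + h) x - f s x) / h) \<circ> X) \<longlonglongrightarrow> f' s x"
        using X by (simp add: tendsto_at_iff_sequentially)
      then show "(\<lambda>n. (f (s + X n) x - f s x) / X n) \<longlonglongrightarrow> f' s x" by (simp add: o_def)
    qed
    show "AE x in M. norm ((f (s + X n) x - f s x) / X n) \<le> g x" for n
    proof (rule AE_I2)
      fix x assume x: "x \<in> space M"
      have "norm (f (s + X n) x - f s x) \<le> g x * norm ((s + X n) - s)"
      proof (rule field_differentiable_bound[of UNIV])
        show "((\<lambda>s. f s x) has_field_derivative f' z x) (at z within UNIV)" for z using deriv[OF x] by simp
        show "norm (f' z x) \<le> g x" for z using bound[OF x] by simp
      qed auto
      then show "norm ((f (s + X n) x - f s x) / X n) \<le> g x"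
        using X(1) by (simp add: divide_le_eq)
    qed
  qed
  moreover have "(\<integral>x. (f (s + X n) x - f s x) / X n \<partial>M) = ((\<integral>x. f (s + X n) x \<partial>M) - (\<integral>x. f s x \<partial>M)) / X n" for n
    using Bochner_Integration.integral_diff[OF f[of "s + X n"] f[of s]] by simp
  ultimately have "(\<lambda>n. ((\<integral>x. f (s + X n) x \<partial>M) - (\<integral>x. f s x \<partial>M)) / X n) \<longlonglongrightarrow> (\<integral>x. f' s x \<partial>M)"
    by (simp only:)
  then show "((\<lambda>h. ((\<integral>x. f (s + h) x \<partial>M) - (\<integral>x. f s x \<partial>M)) / h) \<circ> X) \<longlonglongrightarrow> (\<integral>x. f' s x \<partial>M)"
    unfolding o_def .
qed

section \<open>Moments\<close>

text \<open>The squared modulus of the Pochhammer symbol (1/2 + i \<tau>)_k.\<close>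

definition quadprod :: "nat \<Rightarrow> real \<Rightarrow> real" where
  "quadprod k \<tau> = (\<Prod>j<k. (real j + 1/2)\<^sup>2 + \<tau>\<^sup>2)"

text \<open>This is (1/2)_k k!, or (2k)!/4^k: the constant that the recurrence accumulates along the
  odd powers of sech.\<close>

definition halfprod :: "nat \<Rightarrow> real" where
  "halfprod k = (\<Prod>j<k. (real j + 1/2) * (real j + 1))"

lemma quadprod_0 [simp]: "quadprod 0 \<tau> = 1" by (simp add: quadprod_def)
lemma quadprod_Suc: "quadprod (Suc k) \<tau> = ((real k + 1/2)\<^sup>2 + \<tau>\<^sup>2) * quadprod k \<tau>"
  by (simp add: quadprod_def)
lemma halfprod_0 [simp]: "halfprod 0 = 1" by (simp add: halfprod_def)
lemma halfprod_Suc: "halfprod (Suc k) = (real k + 1/2) * (real k + 1) * halfprod k"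
  by (simp add: halfprod_def)
lemma halfprod_pos: "halfprod k > 0" by (auto simp: halfprod_def intro!: prod_pos)

lemma real_polynomial_function_id: "real_polynomial_function (\<lambda>x::real. x)"
  by (intro real_polynomial_function.intros) auto
lemma real_polynomial_function_const: "real_polynomial_function (\<lambda>x::real. c)"
  by (rule real_polynomial_function.intros)

lemma real_polynomial_function_quadprod: "real_polynomial_function (quadprod k)"
proof (induction k)
  case (Suc k)
  have "real_polynomial_function (\<lambda>\<tau>::real. ((real k + 1/2)\<^sup>2 + \<tau>\<^sup>2) * quadprod k \<tau>)"
    unfolding power2_eq_square
    by (intro real_polynomial_function.intros(3,4) Suc real_polynomial_function_id real_polynomial_function_const)
  then show ?case by (simp add: quadprod_Suc[abs_def])
qed (simp add: real_polynomial_function_const quadprod_def)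

lemma quadprod_measurable [measurable]: "quadprod k \<in> borel_measurable borel"
  by (rule borel_measurable_polynomial[OF real_polynomial_function_quadprod])

lemma h_eq_sech: "h \<tau> = pi * sech (pi * \<tau>)" by (simp add: h_def sech_def)
lemma h_pos: "h \<tau> > 0" by (simp add: h_eq_sech)
lemma h_le_pi: "h \<tau> \<le> pi" by (simp add: h_eq_sech mult_left_le)
lemma h_le_exp: "h \<tau> \<le> 2 * pi * exp (- (pi * \<tau>))"
  using mult_left_mono[OF sech_le_exp[of "pi * \<tau>"], of pi] by (simp add: h_eq_sech mult_ac)
lemma h_measurable [measurable]: "h \<in> borel_measurable borel" unfolding h_eq_sech[abs_def] by measurable

lemma integrable_polynomial_h:
  assumes p: "real_polynomial_function p" and u: "u \<in> borel_measurable borel" "\<And>t. t > 0 \<Longrightarrow> \<bar>u t\<bar> \<le> C"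
  shows "integrable Rpos (\<lambda>t. p t * (h t * u t))"
proof (rule integrable_polynomial_mult_Rpos[OF p, of pi _ "2 * pi * C"])
  show "(\<lambda>t. h t * u t) \<in> borel_measurable borel" using u(1) by measurable
  fix t :: real assume "t > 0"
  then have "\<bar>h t * u t\<bar> \<le> (2 * pi * exp (- (pi * t))) * C"
    unfolding abs_mult using h_pos[of t] h_le_exp[of t] u(2)[of t] by (intro mult_mono) auto
  then show "\<bar>h t * u t\<bar> \<le> 2 * pi * C * exp (- (pi * t))" by (simp add: mult_ac)
qed simp

text \<open>For n = 2k + 1 the factor n^2 + 4 \<tau>^2 of the recurrence is four times the new
  factor of \<open>quadprod\<close>, and n(n+1) is four times the new factor of
  \<open>halfprod\<close>.\<close>

lemma integral_cos_sech_odd_power: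
  "halfprod k * (\<integral>t. cos (\<tau> * t) * sech (t / 2) ^ (2 * k + 1) \<partial>Rpos) = h \<tau> * quadprod k \<tau>"
proof (induction k)
  case 0
  then show ?case using integral_cos_sech_half[of \<tau>] by (simp add: h_def)
next
  case (Suc k)
  define n where "n = 2 * k + 1"
  define I where "I = (\<lambda>n. \<integral>t. cos (\<tau> * t) * sech (t / 2) ^ n \<partial>Rpos)"
  have "real n * (real n + 1) * I (n + 2) = ((real n)\<^sup>2 + 4 * \<tau>\<^sup>2) * I n"
    unfolding I_def by (rule integral_cos_sech_power_recurrence) (simp add: n_def)
  moreover have "real n * (real n + 1) = 4 * ((real k + 1/2) * (real k + 1))"
    "(real n)\<^sup>2 + 4 * \<tau>\<^sup>2 = 4 * ((real k + 1/2)\<^sup>2 + \<tau>\<^sup>2)"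
    by (simp_all add: n_def power2_eq_square algebra_simps)
  ultimately have "4 * ((real k + 1/2) * (real k + 1) * I (n + 2)) = 4 * (((real k + 1/2)\<^sup>2 + \<tau>\<^sup>2) * I n)"
    by (simp only: mult.assoc)
  then have rec: "(real k + 1/2) * (real k + 1) * I (n + 2) = ((real k + 1/2)\<^sup>2 + \<tau>\<^sup>2) * I n"
    by (subst (asm) mult_left_cancel) auto
  have "halfprod (Suc k) * I (n + 2) = halfprod k * ((real k + 1/2) * (real k + 1) * I (n + 2))"
    by (simp add: halfprod_Suc)
  also have "\<dots> = ((real k + 1/2)\<^sup>2 + \<tau>\<^sup>2) * (halfprod k * I n)" unfolding rec by simp
  also have "halfprod k * I n = h \<tau> * quadprod k \<tau>" using Suc by (simp add: I_def n_def)
  finally show ?case by (simp add: I_def n_def quadprod_Suc)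
qed

text \<open>The transform of sech(t/2) read backwards: after the scaling t = 2 pi \<tau> it is the
  same integral.\<close>

lemma integral_h_cos: "(\<integral>\<tau>. h \<tau> * cos (s * \<tau>) \<partial>Rpos) = pi / 2 * sech (s / 2)"
proof -
  have "(\<integral>\<tau>. (\<lambda>t. cos (s / (2 * pi) * t) * sech (t / 2)) (2 * pi * \<tau>) \<partial>Rpos) =
      (\<integral>t. cos (s / (2 * pi) * t) * sech (t / 2) \<partial>Rpos) / (2 * pi)"
    by (rule integral_Rpos_scale) auto
  also have "\<dots> = (pi / cosh (pi * (s / (2 * pi)))) / (2 * pi)" by (simp only: integral_cos_sech_half)
  also have "\<dots> = sech (s / 2) / 2" by (simp add: sech_def)
  finally have "pi * (\<integral>\<tau>. cos (s * \<tau>) * sech (pi * \<tau>) \<partial>Rpos) = pi / 2 * sech (s / 2)" by simp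
  then show ?thesis
    by (simp flip: Bochner_Integration.integral_mult_right_zero add: h_eq_sech mult_ac)
qed

lemma
  assumes p: "real_polynomial_function p"
  shows DERIV_integral_h_cos: "((\<lambda>s. \<integral>\<tau>. p \<tau> * (h \<tau> * cos (s * \<tau>)) \<partial>Rpos) has_real_derivative
      - (\<integral>\<tau>. p \<tau> * (\<tau> * h \<tau> * sin (s * \<tau>)) \<partial>Rpos)) (at s)"
    and DERIV_integral_h_sin: "((\<lambda>s. \<integral>\<tau>. p \<tau> * (h \<tau> * sin (s * \<tau>)) \<partial>Rpos) has_real_derivative
      (\<integral>\<tau>. p \<tau> * (\<tau> * h \<tau> * cos (s * \<tau>)) \<partial>Rpos)) (at s)"
proof -
  have p_meas [measurable]: "p \<in> borel_measurable borel" by (rule borel_measurable_polynomial[OF p])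
  have px: "real_polynomial_function (\<lambda>x. p x * x)"
    by (intro real_polynomial_function.intros(4) p real_polynomial_function_id)
  have g: "integrable Rpos (\<lambda>\<tau>. \<bar>p \<tau>\<bar> * (\<tau> * h \<tau>))"
  proof -
    have "integrable Rpos (\<lambda>\<tau>. norm (p \<tau> * \<tau> * (h \<tau> * 1)))"
      by (intro integrable_norm integrable_polynomial_h[OF px, of _ 1]) auto
    then show ?thesis
      by (rule Bochner_Integration.integrable_cong[THEN iffD1, rotated 2])
        (use h_pos in \<open>auto simp: abs_mult less_imp_le\<close>)
  qed
  have bound: "\<bar>p x * (x * h x * v)\<bar> \<le> \<bar>p x\<bar> * (x * h x)" if "x \<in> space Rpos" "\<bar>v\<bar> \<le> 1" for x v
  proof -
    have "\<bar>p x * (x * h x * v)\<bar> = \<bar>p x\<bar> * (x * h x) * \<bar>v\<bar>"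
      using that h_pos[of x] by (simp add: abs_mult)
    also have "\<dots> \<le> \<bar>p x\<bar> * (x * h x)"
      using that h_pos[of x] by (intro mult_left_le) auto
    finally show ?thesis .
  qed
  have "((\<lambda>s. \<integral>\<tau>. p \<tau> * (h \<tau> * cos (s * \<tau>)) \<partial>Rpos) has_real_derivative
      (\<integral>\<tau>. p \<tau> * (\<tau> * h \<tau> * (- sin (s * \<tau>))) \<partial>Rpos)) (at s)"
  proof (rule has_derivative_under_integral[OF _ _ _ _ g])
    show "integrable Rpos (\<lambda>\<tau>. p \<tau> * (h \<tau> * cos (s * \<tau>)))" for s
      by (intro integrable_polynomial_h[OF p, of _ 1]) auto
    show "(\<lambda>\<tau>. p \<tau> * (\<tau> * h \<tau> * (- sin (s * \<tau>)))) \<in> borel_measurable Rpos" for s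
      by (rule borel_measurable_Rpos) measurable
    show "((\<lambda>s. p x * (h x * cos (s * x))) has_real_derivative p x * (x * h x * (- sin (s * x)))) (at s)" for s x
      by (auto intro!: derivative_eq_intros)
  qed (auto intro!: bound simp del: mult_minus_right)
  then show "((\<lambda>s. \<integral>\<tau>. p \<tau> * (h \<tau> * cos (s * \<tau>)) \<partial>Rpos) has_real_derivative
      - (\<integral>\<tau>. p \<tau> * (\<tau> * h \<tau> * sin (s * \<tau>)) \<partial>Rpos)) (at s)" by simp
  show "((\<lambda>s. \<integral>\<tau>. p \<tau> * (h \<tau> * sin (s * \<tau>)) \<partial>Rpos) has_real_derivative
      (\<integral>\<tau>. p \<tau> * (\<tau> * h \<tau> * cos (s * \<tau>)) \<partial>Rpos)) (at s)"
  proof (rule has_derivative_under_integral[OF _ _ _ _ g])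
    show "integrable Rpos (\<lambda>\<tau>. p \<tau> * (h \<tau> * sin (s * \<tau>)))" for s
      by (intro integrable_polynomial_h[OF p, of _ 1]) auto
    show "(\<lambda>\<tau>. p \<tau> * (\<tau> * h \<tau> * cos (s * \<tau>))) \<in> borel_measurable Rpos" for s
      by (rule borel_measurable_Rpos) measurable
    show "((\<lambda>s. p x * (h x * sin (s * x))) has_real_derivative p x * (x * h x * cos (s * x))) (at s)" for s x
      by (auto intro!: derivative_eq_intros)
  qed (auto intro!: bound)
qed

text \<open>Two derivatives in \<open>s\<close> insert -\<tau>^2, so the next factor (k + 1/2)^2 +
  \<tau>^2 acts as (k + 1/2)^2 minus the second derivative. On sech(s/2)^(2k+1) this cancels the
  power 2k + 1 and leaves only 2k + 3. The sine integral records the intermediate first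
  derivative.\<close>

lemma
  shows integral_quadprod_h_cos:
    "(\<integral>\<tau>. quadprod k \<tau> * (h \<tau> * cos (s * \<tau>)) \<partial>Rpos) = pi / 2 * halfprod k * sech (s / 2) ^ (2 * k + 1)"
      (is "?cos k s")
    and integral_quadprod_h_sin:
    "(\<integral>\<tau>. quadprod k \<tau> * (\<tau> * h \<tau> * sin (s * \<tau>)) \<partial>Rpos) =
      pi / 2 * halfprod k * (real k + 1/2) * (tanh (s / 2) * sech (s / 2) ^ (2 * k + 1))" (is "?sin k s")
proof -
  have sin: "?sin k s" if cos: "\<And>s. ?cos k s" for k s
  proof -
    define A where "A = pi / 2 * halfprod k"
    have "((\<lambda>s. \<integral>\<tau>. quadprod k \<tau> * (h \<tau> * cos (s * \<tau>)) \<partial>Rpos) has_real_derivative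
        A * (- (real (2 * k + 1) / 2) * (tanh (s / 2) * sech (s / 2) ^ (2 * k + 1)))) (at s)"
      unfolding cos A_def[symmetric] by (intro DERIV_cmult DERIV_sech_half_power)
    from DERIV_unique[OF DERIV_integral_h_cos[OF real_polynomial_function_quadprod] this]
    have "(\<integral>\<tau>. quadprod k \<tau> * (\<tau> * h \<tau> * sin (s * \<tau>)) \<partial>Rpos) =
        A * (real (2 * k + 1) / 2 * (tanh (s / 2) * sech (s / 2) ^ (2 * k + 1)))"
      by simp
    moreover have "real (2 * k + 1) / 2 = real k + 1/2" by (simp add: field_simps)
    ultimately show ?thesis unfolding A_def by (simp only: mult.assoc)
  qed
  have cos: "\<And>s. ?cos k s" for k
  proof (induction k)
    case 0
    show ?case using integral_h_cos by simp
  next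
    case (Suc k)
    define n where "n = 2 * k + 1"
    define A where "A = pi / 2 * halfprod k"
    have px: "real_polynomial_function (\<lambda>\<tau>. quadprod k \<tau> * \<tau>)"
      by (intro real_polynomial_function.intros(4) real_polynomial_function_quadprod real_polynomial_function_id)
    have "((\<lambda>s. \<integral>\<tau>. quadprod k \<tau> * \<tau> * (h \<tau> * sin (s * \<tau>)) \<partial>Rpos) has_real_derivative
        A * (real k + 1/2) * ((real n + 1) / 2 * sech (s / 2) ^ (n + 2) - real n / 2 * sech (s / 2) ^ n)) (at s)"
    proof -
      have "(\<integral>\<tau>. quadprod k \<tau> * \<tau> * (h \<tau> * sin (s * \<tau>)) \<partial>Rpos) =
          A * (real k + 1/2) * (tanh (s / 2) * sech (s / 2) ^ n)" for s
        using sin[OF Suc.IH, of s] by (simp add: A_def n_def mult.assoc)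
      then show ?thesis by (simp only:) (intro DERIV_cmult DERIV_tanh_sech_half_power)
    qed
    from DERIV_unique[OF DERIV_integral_h_sin[OF px] this]
    have X: "(\<integral>\<tau>. quadprod k \<tau> * \<tau> * (\<tau> * h \<tau> * cos (s * \<tau>)) \<partial>Rpos) =
        A * (real k + 1/2) * ((real n + 1) / 2 * sech (s / 2) ^ (n + 2) - real n / 2 * sech (s / 2) ^ n)" .
    have i: "integrable Rpos (\<lambda>\<tau>. quadprod k \<tau> * (h \<tau> * cos (s * \<tau>)))"
      by (intro integrable_polynomial_h[of _ _ 1] real_polynomial_function_quadprod) auto
    have "real_polynomial_function (\<lambda>\<tau>. quadprod k \<tau> * \<tau> * \<tau>)"
      by (intro real_polynomial_function.intros(4) real_polynomial_function_quadprod real_polynomial_function_id)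
    then have "integrable Rpos (\<lambda>\<tau>. quadprod k \<tau> * \<tau> * \<tau> * (h \<tau> * cos (s * \<tau>)))"
      by (intro integrable_polynomial_h[of _ _ 1]) auto
    then have i2: "integrable Rpos (\<lambda>\<tau>. quadprod k \<tau> * \<tau> * (\<tau> * h \<tau> * cos (s * \<tau>)))" by (simp only: mult.assoc)
    have "(\<integral>\<tau>. quadprod (Suc k) \<tau> * (h \<tau> * cos (s * \<tau>)) \<partial>Rpos) =
        (\<integral>\<tau>. (real k + 1/2)\<^sup>2 * (quadprod k \<tau> * (h \<tau> * cos (s * \<tau>))) + quadprod k \<tau> * \<tau> * (\<tau> * h \<tau> * cos (s * \<tau>)) \<partial>Rpos)"
      by (intro Bochner_Integration.integral_cong refl) (simp add: quadprod_Suc algebra_simps power2_eq_square)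
    also have "\<dots> = (real k + 1/2)\<^sup>2 * (A * sech (s / 2) ^ n) +
        A * (real k + 1/2) * ((real n + 1) / 2 * sech (s / 2) ^ (n + 2) - real n / 2 * sech (s / 2) ^ n)"
    proof -
      have Y: "(\<integral>\<tau>. quadprod k \<tau> * (h \<tau> * cos (s * \<tau>)) \<partial>Rpos) = A * sech (s / 2) ^ n"
        unfolding A_def n_def by (rule Suc.IH)
      show ?thesis
        by (simp only: Bochner_Integration.integral_add[OF integrable_mult_right[OF i] i2]
            integral_mult_right_zero X Y)
    qed
    also have "\<dots> = A * ((real k + 1/2) * (real k + 1)) * sech (s / 2) ^ (n + 2)"
      by (simp add: n_def power2_eq_square field_simps)
    finally show ?case by (simp add: A_def n_def halfprod_Suc mult_ac)
  qed
  show "?cos k s" by (rule cos)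
  show "?sin k s" by (rule sin[OF cos])
qed

section \<open>Fubini on the quadrant and the moments of the weight\<close>

lemma borel_measurable_Rpos_pair:
  "f \<in> borel_measurable (borel \<Otimes>\<^sub>M borel) \<Longrightarrow> f \<in> borel_measurable (Rpos \<Otimes>\<^sub>M Rpos)"
proof -
  assume f: "f \<in> borel_measurable (borel \<Otimes>\<^sub>M borel)"
  have id: "(\<lambda>x. x) \<in> measurable Rpos borel" by (rule borel_measurable_Rpos) simp
  have "(\<lambda>p. (fst p, snd p)) \<in> measurable (Rpos \<Otimes>\<^sub>M Rpos) (borel \<Otimes>\<^sub>M borel)"
    by (intro measurable_Pair measurable_compose[OF measurable_fst id] measurable_compose[OF measurable_snd id])
  from measurable_compose[OF this f] show ?thesis by simp
qed

lemma Fubini_Rpos_dominated: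
  fixes f :: "real \<Rightarrow> real \<Rightarrow> 'b::{banach, second_countable_topology}"
  assumes f: "(\<lambda>p. f (fst p) (snd p)) \<in> borel_measurable (Rpos \<Otimes>\<^sub>M Rpos)"
    and u: "integrable Rpos u" and v: "integrable Rpos v"
    and bound: "\<And>x y. x > 0 \<Longrightarrow> y > 0 \<Longrightarrow> norm (f x y) \<le> u x * v y"
  shows "(\<integral>y. (\<integral>x. f x y \<partial>Rpos) \<partial>Rpos) = (\<integral>x. (\<integral>y. f x y \<partial>Rpos) \<partial>Rpos)"
    and "integrable Rpos (\<lambda>x. \<integral>y. f x y \<partial>Rpos)"
proof -
  have "integrable (Rpos \<Otimes>\<^sub>M Rpos) (\<lambda>p. u (fst p) * v (snd p))"
  proof (rule Rpos_pair.Fubini_integrable)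
    show "(\<lambda>p. u (fst p) * v (snd p)) \<in> borel_measurable (Rpos \<Otimes>\<^sub>M Rpos)"
      using u v by measurable
    have "integrable Rpos (\<lambda>x. \<bar>u x\<bar> * (\<integral>y. \<bar>v y\<bar> \<partial>Rpos))"
      using integrable_norm[OF u] by simp
    then show "integrable Rpos (\<lambda>x. \<integral>y. norm (u (fst (x, y)) * v (snd (x, y))) \<partial>Rpos)"
      by (simp add: abs_mult)
    show "AE x in Rpos. integrable Rpos (\<lambda>y. u (fst (x, y)) * v (snd (x, y)))" using v by simp
  qed
  then have "integrable (Rpos \<Otimes>\<^sub>M Rpos) (\<lambda>p. f (fst p) (snd p))"
  proof (rule Bochner_Integration.integrable_bound[OF _ f])
    show "AE p in Rpos \<Otimes>\<^sub>M Rpos. norm (f (fst p) (snd p)) \<le> norm (u (fst p) * v (snd p))"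
      using bound by (intro AE_I2) (force simp: space_pair_measure intro: order_trans[OF _ abs_ge_self])
  qed
  then have "integrable (Rpos \<Otimes>\<^sub>M Rpos) (case_prod f)" by (simp add: case_prod_beta')
  then show "(\<integral>y. (\<integral>x. f x y \<partial>Rpos) \<partial>Rpos) = (\<integral>x. (\<integral>y. f x y \<partial>Rpos) \<partial>Rpos)"
    and "integrable Rpos (\<lambda>x. \<integral>y. f x y \<partial>Rpos)"
    by (rule Rpos_pair.Fubini_integral, rule Rpos_pair.integrable_fst)
qed

text \<open>When a factor of the weight is itself a sine transform, Fubini moves it to the
  \<open>s\<close> side, where the \<tau>-integral is known. The majorant uses |sin(\<tau> s)| \<le>
  \<tau> s, whence the condition on \<open>s * K s\<close>; it admits the kernel 1/sinh(s/2) with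
  its pole at 0.\<close>

lemma integral_quadprod_h_sine_transform:
  assumes K: "K \<in> borel_measurable borel" "\<And>s. s > 0 \<Longrightarrow> K s \<ge> 0" "integrable Rpos (\<lambda>s. s * K s)"
  shows "(\<integral>\<tau>. quadprod k \<tau> * (\<tau> * h \<tau> * (\<integral>s. sin (\<tau> * s) * K s \<partial>Rpos)) \<partial>Rpos) =
    pi / 2 * halfprod k * (real k + 1/2) * (\<integral>s. K s * (tanh (s / 2) * sech (s / 2) ^ (2 * k + 1)) \<partial>Rpos)"
proof -
  note [measurable] = K(1)
  define f where "f = (\<lambda>\<tau> s. quadprod k \<tau> * (\<tau> * h \<tau> * sin (\<tau> * s)) * K s)"
  have px: "real_polynomial_function (\<lambda>\<tau>. quadprod k \<tau> * \<tau> * \<tau>)"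
    by (intro real_polynomial_function.intros(4) real_polynomial_function_quadprod real_polynomial_function_id)
  have "integrable Rpos (\<lambda>\<tau>. norm (quadprod k \<tau> * \<tau> * \<tau> * (h \<tau> * 1)))"
    by (intro integrable_norm integrable_polynomial_h[OF px, of _ 1]) auto
  then have u: "integrable Rpos (\<lambda>\<tau>. \<bar>quadprod k \<tau>\<bar> * \<tau> * \<tau> * h \<tau>)"
    by (rule Bochner_Integration.integrable_cong[THEN iffD1, rotated 2])
      (use h_pos in \<open>auto simp: abs_mult less_imp_le\<close>)
  have "(\<integral>s. (\<integral>\<tau>. f \<tau> s \<partial>Rpos) \<partial>Rpos) = (\<integral>\<tau>. (\<integral>s. f \<tau> s \<partial>Rpos) \<partial>Rpos)"
  proof (rule Fubini_Rpos_dominated(1)[OF _ u K(3)])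
    show "(\<lambda>p. f (fst p) (snd p)) \<in> borel_measurable (Rpos \<Otimes>\<^sub>M Rpos)"
      unfolding f_def by (rule borel_measurable_Rpos_pair) measurable
    fix x y :: real assume xy: "x > 0" "y > 0"
    have "norm (f x y) = (\<bar>quadprod k x\<bar> * x * h x * K y) * \<bar>sin (x * y)\<bar>"
      using xy h_pos[of x] K(2)[of y] by (simp add: f_def abs_mult mult_ac)
    also have "\<dots> \<le> (\<bar>quadprod k x\<bar> * x * h x * K y) * (x * y)"
    proof (rule mult_left_mono)
      show "\<bar>sin (x * y)\<bar> \<le> x * y" using abs_sin_x_le_abs_x[of "x * y"] xy by simp
      show "0 \<le> \<bar>quadprod k x\<bar> * x * h x * K y"
        using xy h_pos[of x] K(2)[of y] by (simp add: less_imp_le)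
    qed
    finally show "norm (f x y) \<le> \<bar>quadprod k x\<bar> * x * x * h x * (y * K y)" by (simp add: mult_ac)
  qed
  moreover have "(\<integral>s. f \<tau> s \<partial>Rpos) = quadprod k \<tau> * (\<tau> * h \<tau> * (\<integral>s. sin (\<tau> * s) * K s \<partial>Rpos))" for \<tau>
    unfolding f_def by (simp flip: Bochner_Integration.integral_mult_right_zero add: mult.assoc)
  moreover have "(\<integral>\<tau>. f \<tau> s \<partial>Rpos) = pi / 2 * halfprod k * (real k + 1/2) *
      (K s * (tanh (s / 2) * sech (s / 2) ^ (2 * k + 1)))" for s
  proof -
    have "(\<integral>\<tau>. f \<tau> s \<partial>Rpos) = (\<integral>\<tau>. quadprod k \<tau> * (\<tau> * h \<tau> * sin (s * \<tau>)) \<partial>Rpos) * K s"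
      unfolding f_def by (simp add: mult.commute[of s])
    then show ?thesis unfolding integral_quadprod_h_sin by simp
  qed
  ultimately show ?thesis by simp
qed

text \<open>The recurrence at \<tau> = 0 along the even powers, started from sech(t/2)^2, whose
  antiderivative is 2 tanh(t/2).\<close>

lemma integral_sech_half_even_power:
  "halfprod k * (real k + 1/2) * (\<integral>t. sech (t / 2) ^ (2 * k + 2) \<partial>Rpos) = (fact k)\<^sup>2"
proof (induction k)
  case 0
  have "(\<integral>t. (sech (t / 2))\<^sup>2 \<partial>Rpos) = 2 - 2 * tanh (0 / 2)"
  proof (rule integral_Rpos_FTC)
    show "continuous_on UNIV (\<lambda>t. (sech (t / 2))\<^sup>2)" by (intro continuous_intros) auto
    show "integrable Rpos (\<lambda>t. (sech (t / 2))\<^sup>2)" using integrable_cos_sech_power[of 2 0] by simp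
    have d: "((\<lambda>t. 2 * tanh (t / 2)) has_real_derivative (sech (x / 2))\<^sup>2) (at x)" for x :: real
      unfolding sech_square by (auto intro!: derivative_eq_intros)
    show "((\<lambda>t. 2 * tanh (t / 2)) has_real_derivative (sech (x / 2))\<^sup>2) (at x)" for x :: real by (rule d)
    show "isCont (\<lambda>t. 2 * tanh (t / 2)) (0::real)" using d by (rule DERIV_isCont)
    have "filterlim (\<lambda>t::real. 1 / 2 * t) at_top at_top"
      by (rule filterlim_tendsto_pos_mult_at_top[OF tendsto_const _ filterlim_ident]) simp
    from filterlim_compose[OF tanh_real_at_top this]
    have "((\<lambda>t. 2 * tanh (t / 2)) \<longlongrightarrow> 2 * (1::real)) at_top" by (intro tendsto_mult tendsto_const) simp
    then show "((\<lambda>t. 2 * tanh (t / 2)) \<longlongrightarrow> (2::real)) at_top" by simp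
  qed
  then show ?case by (simp add: power2_eq_square)
next
  case (Suc k)
  define I where "I = (\<lambda>n. \<integral>t. sech (t / 2) ^ n \<partial>Rpos)"
  have "real (2 * k + 2) * (real (2 * k + 2) + 1) * I (2 * k + 2 + 2) = (real (2 * k + 2))\<^sup>2 * I (2 * k + 2)"
    using integral_cos_sech_power_recurrence[of "2 * k + 2" 0] by (simp add: I_def)
  then have "real (2 * k + 2) * ((real (2 * k + 2) + 1) * I (2 * k + 4)) = real (2 * k + 2) * (real (2 * k + 2) * I (2 * k + 2))"
    by (simp add: power2_eq_square mult.assoc numeral_eq_Suc)
  then have rec: "(real (2 * k + 2) + 1) * I (2 * k + 4) = real (2 * k + 2) * I (2 * k + 2)"
    by (subst (asm) mult_left_cancel) auto
  have "halfprod (Suc k) * (real (Suc k) + 1/2) * I (2 * k + 4) =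
      halfprod k * (real k + 1/2) * (real k + 1) * (1/2) * ((real (2 * k + 2) + 1) * I (2 * k + 4))"
    by (simp add: halfprod_Suc field_simps)
  also have "\<dots> = (real k + 1)\<^sup>2 * (halfprod k * (real k + 1/2) * I (2 * k + 2))"
    unfolding rec by (simp add: power2_eq_square field_simps)
  also have "\<dots> = (real k + 1)\<^sup>2 * (fact k)\<^sup>2"
    using Suc by (simp only: I_def)
  also have "\<dots> = (fact (Suc k))\<^sup>2"
    by (simp add: power_mult_distrib add.commute)
  moreover have "2 * Suc k + 2 = 2 * k + 4" by simp
  ultimately show ?case by (simp only: I_def)
qed

text \<open>Integration by parts on t sech(t/2)^(2k+2). The quotient by k + 1 is the source of the
  denominators of the Hilbert matrix.\<close>

lemma integral_t_tanh_sech_half_power: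
  "(\<integral>t. t * (tanh (t / 2) * sech (t / 2) ^ (2 * k + 2)) \<partial>Rpos) = (\<integral>t. sech (t / 2) ^ (2 * k + 2) \<partial>Rpos) / (real k + 1)"
proof -
  define n where "n = 2 * k + 2"
  let ?F = "\<lambda>t. - (t * sech (t / 2) ^ n)"
  let ?f = "\<lambda>t. real n / 2 * (t * (tanh (t / 2) * sech (t / 2) ^ n)) - sech (t / 2) ^ n"
  have n1: "n \<ge> 1" by (simp add: n_def)
  have i1: "integrable Rpos (\<lambda>t. sech (t / 2) ^ n)" using integrable_cos_sech_power[OF n1, of 0] by simp
  have i2: "integrable Rpos (\<lambda>t. t * (tanh (t / 2) * sech (t / 2) ^ n))"
    by (rule integrable_polynomial_sech_power[OF real_polynomial_function_id n1])
      (use tanh_real_lt_1 tanh_real_gt_neg1 in \<open>auto simp: abs_le_iff less_imp_le minus_le_iff\<close>)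
  have d: "(?F has_real_derivative ?f x) (at x)" for x
  proof -
    have "(?F has_real_derivative - (1 * sech (x / 2) ^ n + - (real n / 2) * (tanh (x / 2) * sech (x / 2) ^ n) * x)) (at x)"
      by (intro DERIV_minus DERIV_mult DERIV_ident DERIV_sech_half_power)
    then show ?thesis by (simp add: algebra_simps)
  qed
  have "integral\<^sup>L Rpos ?f = 0 - ?F 0"
  proof (rule integral_Rpos_FTC[OF _ _ d])
    show "continuous_on UNIV ?f" by (intro continuous_intros) auto
    show "integrable Rpos ?f" using i1 i2 by simp
    show "isCont ?F 0" using d by (rule DERIV_isCont)
    show "(?F \<longlongrightarrow> 0) at_top"
    proof (rule Lim_null_comparison[where g = "\<lambda>t. 2 * (t * exp (- (t / 2)))"])
      show "((\<lambda>t::real. 2 * (t * exp (- (t / 2)))) \<longlongrightarrow> 0) at_top" by real_asymp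
      show "\<forall>\<^sub>F t in at_top. norm (?F t) \<le> 2 * (t * exp (- (t / 2)))"
        using eventually_ge_at_top[of 0]
      proof eventually_elim
        case (elim t)
        have "t * sech (t / 2) ^ n \<le> t * (2 * exp (- (t / 2)))"
          using elim by (intro mult_left_mono sech_power_le_exp n1)
        then show ?case using elim by (simp add: abs_mult less_imp_le)
      qed
    qed
  qed
  then have "real n / 2 * (\<integral>t. t * (tanh (t / 2) * sech (t / 2) ^ n) \<partial>Rpos) = (\<integral>t. sech (t / 2) ^ n \<partial>Rpos)"
    using i1 i2 by simp
  then have "(\<integral>t. t * (tanh (t / 2) * sech (t / 2) ^ n) \<partial>Rpos) = (\<integral>t. sech (t / 2) ^ n \<partial>Rpos) / (real k + 1)"
    by (simp add: n_def field_simps)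
  then show ?thesis by (simp add: n_def)
qed

lemma DERIV_h: "(h has_real_derivative - (pi * tanh (pi * \<tau>) * h \<tau>)) (at \<tau>)"
  unfolding h_eq_sech[abs_def] by (auto intro!: derivative_eq_intros)

text \<open>The derivative of the cosine transform of sech(t/2) in the frequency. It exhibits tanh
  times \<open>h\<close> as a sine transform, as \<open>integral_sin_csch_half\<close> does for tanh
  alone.\<close>

lemma integral_t_sin_sech_half: "(\<integral>t. sin (\<tau> * t) * (t * sech (t / 2)) \<partial>Rpos) = pi * tanh (pi * \<tau>) * h \<tau>"
proof -
  have "((\<lambda>s. \<integral>t. cos (s * t) * sech (t / 2) \<partial>Rpos) has_real_derivative
      (\<integral>t. - sin (\<tau> * t) * (t * sech (t / 2)) \<partial>Rpos)) (at \<tau>)"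
  proof (rule has_derivative_under_integral)
    show "integrable Rpos (\<lambda>t. cos (s * t) * sech (t / 2))" for s using integrable_cos_sech_power[of 1 s] by simp
    show "(\<lambda>t. - sin (s * t) * (t * sech (t / 2))) \<in> borel_measurable Rpos" for s
      by (rule borel_measurable_Rpos) measurable
    show "integrable Rpos (\<lambda>t. t * sech (t / 2))"
      using integrable_polynomial_sech_power[OF real_polynomial_function_id, of 1 "\<lambda>_. 1"] by simp
    show "\<bar>- sin (s * x) * (x * sech (x / 2))\<bar> \<le> x * sech (x / 2)" if "x \<in> space Rpos" for s x
      using that by (simp add: abs_mult mult_left_le_one_le less_imp_le)
    show "((\<lambda>s. cos (s * x) * sech (x / 2)) has_real_derivative - sin (s * x) * (x * sech (x / 2))) (at s)" for s x
      by (auto intro!: derivative_eq_intros)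
  qed
  moreover have "(\<lambda>s. \<integral>t. cos (s * t) * sech (t / 2) \<partial>Rpos) = h"
    by (simp add: fun_eq_iff integral_cos_sech_half h_def)
  ultimately have "(\<integral>t. - sin (\<tau> * t) * (t * sech (t / 2)) \<partial>Rpos) = - (pi * tanh (pi * \<tau>) * h \<tau>)"
    using DERIV_unique[OF _ DERIV_h] by simp
  then show ?thesis by simp
qed

text \<open>The square of \<open>w 0\<close>. Multiplied by 2 pi, it is the continuous dual Hahn
  weight |Gamma(1/2 + i \<tau>)^3 / Gamma(2 i \<tau>)|^2. The factor tanh is kept visible because it
  is a sine transform.\<close>

definition weight :: "real \<Rightarrow> real" where
  "weight \<tau> = 2 * \<tau> * tanh (pi * \<tau>) * h \<tau>"

lemma weight_measurable [measurable]: "weight \<in> borel_measurable borel" unfolding weight_def by measurable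

lemma integral_weight_quadprod: "(\<integral>\<tau>. weight \<tau> * quadprod k \<tau> \<partial>Rpos) = (fact k)\<^sup>2"
proof -
  let ?K = "\<lambda>s::real. 1 / sinh (s / 2)"
  \<comment> \<open>From sinh(s/2) = 2 sinh(s/4) cosh(s/4) and sinh(s/4) \<ge> s/4: the first factor
    absorbs \<open>s\<close>, the second supplies the exponential decay.\<close>
  have bound: "\<bar>s * ?K s\<bar> \<le> 4 * exp (- (1/4 * s))" if "s > 0" for s
  proof -
    have "s / 4 \<le> sinh (s / 4)" 
      using that real_le_x_sinh[of "s / 4"] by (simp add: sinh_def exp_minus)
    then have "s / 4 * (2 * cosh (s / 4)) \<le> sinh (s / 4) * (2 * cosh (s / 4))" by (intro mult_right_mono) auto
    also have "\<dots> = sinh (s / 2)" using sinh_double[of "s / 4"] by simp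
    finally have "s * cosh (s / 4) \<le> 2 * sinh (s / 2)" by simp
    then have "s / sinh (s / 2) \<le> 2 * (1 / cosh (s / 4))" using that by (simp add: field_simps)
    also have "\<dots> \<le> 2 * (2 * exp (- (s / 4)))" by (intro mult_left_mono inverse_cosh_le) auto
    finally show ?thesis using that by simp
  qed
  have int: "integrable Rpos (\<lambda>s. s * ?K s)"
    by (rule integrable_exp_bound_Rpos[of "1/4" _ 4]) (use bound in auto)
  have "(\<integral>\<tau>. weight \<tau> * quadprod k \<tau> \<partial>Rpos) = 2 / pi * (\<integral>\<tau>. quadprod k \<tau> * (\<tau> * h \<tau> * (\<integral>s. sin (\<tau> * s) * ?K s \<partial>Rpos)) \<partial>Rpos)"
    using integral_sin_csch_half
    by (simp flip: Bochner_Integration.integral_mult_right_zero add: weight_def mult_ac)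
  also have "\<dots> = 2 / pi * (pi / 2 * halfprod k * (real k + 1/2) * (\<integral>s. ?K s * (tanh (s / 2) * sech (s / 2) ^ (2 * k + 1)) \<partial>Rpos))"
    by (subst integral_quadprod_h_sine_transform[OF _ _ int]) auto
  \<comment> \<open>The pole of 1/sinh cancels against tanh, leaving a pure even power of
    sech.\<close>
  also have "(\<integral>s. ?K s * (tanh (s / 2) * sech (s / 2) ^ (2 * k + 1)) \<partial>Rpos) = (\<integral>s. sech (s / 2) ^ (2 * k + 2) \<partial>Rpos)"
    by (intro Bochner_Integration.integral_cong refl) (simp add: tanh_def sech_def)
  finally show ?thesis using integral_sech_half_even_power[of k] by simp
qed

text \<open>The extra \<open>h\<close> changes only the kernel, from 1/sinh(s/2) to s sech(s/2), so
  the two moment formulas differ by the single denominator k + 1.\<close>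

lemma integral_weight_h_quadprod: "(\<integral>\<tau>. weight \<tau> * h \<tau> * quadprod k \<tau> \<partial>Rpos) = (fact k)\<^sup>2 / (real k + 1)"
proof -
  have cancel: "2 / pi * (pi / 2 * a * b * (v / c)) = a * b * v / c" for a b v c :: real by simp
  let ?K = "\<lambda>s::real. s * sech (s / 2)"
  have "real_polynomial_function (\<lambda>x::real. x * x)"
    by (intro real_polynomial_function.intros(4) real_polynomial_function_id)
  from integrable_polynomial_sech_power[OF this, of 1 "\<lambda>_. 1"]
  have int: "integrable Rpos (\<lambda>s. s * ?K s)" by (simp add: mult.assoc)
  have "(\<integral>\<tau>. weight \<tau> * h \<tau> * quadprod k \<tau> \<partial>Rpos) = 2 / pi * (\<integral>\<tau>. quadprod k \<tau> * (\<tau> * h \<tau> * (\<integral>s. sin (\<tau> * s) * ?K s \<partial>Rpos)) \<partial>Rpos)"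
    unfolding integral_t_sin_sech_half
    by (simp flip: Bochner_Integration.integral_mult_right_zero add: weight_def mult_ac)
  also have "\<dots> = 2 / pi * (pi / 2 * halfprod k * (real k + 1/2) * (\<integral>s. ?K s * (tanh (s / 2) * sech (s / 2) ^ (2 * k + 1)) \<partial>Rpos))"
    by (subst integral_quadprod_h_sine_transform[OF _ _ int]) (auto simp: less_imp_le)
  also have "(\<integral>s. ?K s * (tanh (s / 2) * sech (s / 2) ^ (2 * k + 1)) \<partial>Rpos) = (\<integral>s. sech (s / 2) ^ (2 * k + 2) \<partial>Rpos) / (real k + 1)"
    unfolding integral_t_tanh_sech_half_power[symmetric]
    by (intro Bochner_Integration.integral_cong refl) (simp add: mult_ac)
  finally show ?thesis
    unfolding integral_sech_half_even_power[of k, symmetric] by (simp only: cancel)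
qed

text \<open>The factors that raise \<open>j\<close> and \<open>k\<close> differ by (j + 1/2)^2 - (k
  + 1/2)^2 = (j - k)(j + k + 1), in which \<tau> has cancelled. The density is arbitrary, so both
  families of moments are reduced to j = 0 in the same way.\<close>

lemma moment_recurrence:
  fixes \<omega> :: "real \<Rightarrow> real"
  assumes i: "\<And>j k. integrable Rpos (\<lambda>\<tau>. \<omega> \<tau> * (quadprod j \<tau> * quadprod k \<tau>))"
  defines "X \<equiv> \<lambda>j k. \<integral>\<tau>. \<omega> \<tau> * (quadprod j \<tau> * quadprod k \<tau>) \<partial>Rpos"
  shows "X (Suc j) k = X j (Suc k) + (real j - real k) * (real j + real k + 1) * X j k"
proof -
  have "X (Suc j) k = (\<integral>\<tau>. \<omega> \<tau> * (quadprod j \<tau> * quadprod (Suc k) \<tau>) +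
      (real j - real k) * (real j + real k + 1) * (\<omega> \<tau> * (quadprod j \<tau> * quadprod k \<tau>)) \<partial>Rpos)"
    unfolding X_def
    by (intro Bochner_Integration.integral_cong refl) (simp add: quadprod_Suc power2_eq_square field_simps)
  then show ?thesis using i unfolding X_def by simp
qed

lemma abs_tanh_le_1: "\<bar>tanh x\<bar> \<le> (1::real)"
  using tanh_real_lt_1[of x] tanh_real_gt_neg1[of x] by (simp add: abs_le_iff less_imp_le)

lemma
  assumes p: "real_polynomial_function p"
  shows integrable_weight_polynomial: "integrable Rpos (\<lambda>\<tau>. weight \<tau> * p \<tau>)"
    and integrable_weight_h_polynomial: "integrable Rpos (\<lambda>\<tau>. weight \<tau> * h \<tau> * p \<tau>)"
proof -
  have px: "real_polynomial_function (\<lambda>x. 2 * x * p x)"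
    by (intro real_polynomial_function.intros(4) p real_polynomial_function_id real_polynomial_function_const)
  show "integrable Rpos (\<lambda>\<tau>. weight \<tau> * p \<tau>)"
    using integrable_polynomial_h[OF px, of "\<lambda>t. tanh (pi * t)" 1, OF _ abs_tanh_le_1]
    by (simp add: weight_def mult_ac)
  have "\<bar>tanh (pi * t) * h t\<bar> \<le> 1 * pi" if "t > 0" for t
    unfolding abs_mult using abs_tanh_le_1[of "pi * t"] h_pos[of t] h_le_pi[of t] by (intro mult_mono) auto
  then show "integrable Rpos (\<lambda>\<tau>. weight \<tau> * h \<tau> * p \<tau>)"
    using integrable_polynomial_h[OF px, of "\<lambda>t. tanh (pi * t) * h t" pi]
    by (simp add: weight_def mult_ac)
qed

lemma integral_weight_quadprod_quadprod:
  "(\<integral>\<tau>. weight \<tau> * (quadprod j \<tau> * quadprod k \<tau>) \<partial>Rpos) = fact j * fact k * fact (j + k)"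
proof (induction j arbitrary: k)
  case 0
  show ?case using integral_weight_quadprod[of k] by (simp add: power2_eq_square)
next
  case (Suc j)
  have "(\<integral>\<tau>. weight \<tau> * (quadprod (Suc j) \<tau> * quadprod k \<tau>) \<partial>Rpos) =
    fact j * fact (Suc k) * fact (j + Suc k) + (real j - real k) * (real j + real k + 1) * (fact j * fact k * fact (j + k))"
    unfolding Suc.IH[symmetric]
    by (rule moment_recurrence)
      (intro integrable_weight_polynomial real_polynomial_function.intros(4) real_polynomial_function_quadprod)
  also have "\<dots> = fact (Suc j) * fact k * fact (Suc j + k)"
    by (simp add: algebra_simps)
  finally show ?case .
qed

lemma integral_weight_h_quadprod_quadprod:
  "(\<integral>\<tau>. weight \<tau> * h \<tau> * (quadprod j \<tau> * quadprod k \<tau>) \<partial>Rpos) = (fact j * fact k)\<^sup>2 / (real j + real k + 1)"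
proof (induction j arbitrary: k)
  case 0
  show ?case using integral_weight_h_quadprod[of k] by simp
next
  case (Suc j)
  have "(\<integral>\<tau>. weight \<tau> * h \<tau> * (quadprod (Suc j) \<tau> * quadprod k \<tau>) \<partial>Rpos) =
    (fact j * fact (Suc k))\<^sup>2 / (real j + real (Suc k) + 1) +
    (real j - real k) * (real j + real k + 1) * ((fact j * fact k)\<^sup>2 / (real j + real k + 1))"
    unfolding Suc.IH[symmetric]
    by (rule moment_recurrence)
      (intro integrable_weight_h_polynomial real_polynomial_function.intros(4) real_polynomial_function_quadprod)
  also have "(real j - real k) * (real j + real k + 1) * ((fact j * fact k)\<^sup>2 / (real j + real k + 1)) =
      (real j - real k) * (fact j * fact k)\<^sup>2"
  proof -
    have "real j + real k + 1 \<noteq> 0" using of_nat_0_le_iff[of j] of_nat_0_le_iff[of k] by linarith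
    then show ?thesis by simp
  qed
  also have "(fact j * fact (Suc k))\<^sup>2 / (real j + real (Suc k) + 1) + (real j - real k) * (fact j * fact k)\<^sup>2 =
      (fact j * fact k)\<^sup>2 * ((real k + 1)\<^sup>2 / (real j + real k + 2) + (real j - real k))"
    by (simp add: power_mult_distrib distrib_left) (simp add: algebra_simps)
  also have "(real k + 1)\<^sup>2 / (real j + real k + 2) + (real j - real k) = (real j + 1)\<^sup>2 / (real j + real k + 2)"
    by (simp add: field_simps power2_eq_square)
  finally show ?case by (simp add: power_mult_distrib add_ac)
qed

section \<open>The basis functions in closed form\<close>

definition altsum :: "nat \<Rightarrow> (nat \<Rightarrow> real) \<Rightarrow> real" where
  "altsum n f = (\<Sum>k\<le>n. real (n choose k) * (-1) ^ k * f k)"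

lemma altsum_0 [simp]: "altsum 0 f = f 0" by (simp add: altsum_def)

text \<open>\<open>altsum n f\<close> is (-1)^n times the n-th forward difference of
  \<open>f\<close> at 0, so the order drops by one when \<open>f\<close> is differenced; on
  coefficients this is Pascal's rule.\<close>

lemma altsum_Suc: "altsum (Suc n) f = altsum n (\<lambda>k. f k - f (Suc k))"
proof -
  have "altsum (Suc n) f = f 0 + (\<Sum>k\<le>n. real (Suc n choose Suc k) * (-1) ^ Suc k * f (Suc k))"
    unfolding altsum_def by (subst sum.atMost_Suc_shift) simp
  also have "(\<Sum>k\<le>n. real (Suc n choose Suc k) * (-1) ^ Suc k * f (Suc k)) =
      (\<Sum>k\<le>n. real (n choose Suc k) * (-1) ^ Suc k * f (Suc k)) - (\<Sum>k\<le>n. real (n choose k) * (-1) ^ k * f (Suc k))"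
    unfolding sum_subtractf[symmetric] by (intro sum.cong refl) (simp add: algebra_simps)
  also have "(\<Sum>k\<le>n. real (n choose Suc k) * (-1) ^ Suc k * f (Suc k)) = altsum n f - f 0"
  proof -
    have "altsum n f = (\<Sum>k\<le>Suc n. real (n choose k) * (-1) ^ k * f k)" by (simp add: altsum_def)
    also have "\<dots> = f 0 + (\<Sum>k\<le>n. real (n choose Suc k) * (-1) ^ Suc k * f (Suc k))"
      by (subst sum.atMost_Suc_shift) simp
    finally show ?thesis by simp
  qed
  finally show ?thesis by (simp add: altsum_def right_diff_distrib sum_subtractf)
qed

lemma altsum_cmult: "altsum n (\<lambda>k. c * f k) = c * altsum n f"
  by (simp add: altsum_def sum_distrib_left mult_ac)

text \<open>By Pascal's rule each difference lowers the lower index by one, so a single binomial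
  coefficient survives.\<close>

lemma altsum_binomial:
  "altsum n (\<lambda>k. real ((i + k) choose j)) = (-1) ^ n * (if n \<le> j then real (i choose (j - n)) else 0)"
proof (induction n arbitrary: j)
  case (Suc n)
  show ?case
  proof (cases j)
    case 0
    then have "altsum (Suc n) (\<lambda>k. real ((i + k) choose j)) = altsum n (\<lambda>k. 0 * 1)"
      by (simp add: altsum_Suc)
    then show ?thesis unfolding altsum_cmult using 0 by simp
  next
    case (Suc j')
    then have "altsum (Suc n) (\<lambda>k. real ((i + k) choose j)) = altsum n (\<lambda>k. (-1) * real ((i + k) choose j'))"
      by (simp add: altsum_Suc)
    then show ?thesis unfolding altsum_cmult Suc.IH using Suc by simp
  qed
qed simp

text \<open>The inner difference yields (-1)^n times \<open>j choose n\<close>. The outer one, taken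
  at 0, leaves \<open>0 choose (n - m)\<close> up to sign if m \<le> n, and 0 otherwise.\<close>

lemma altsum_altsum_binomial:
  "altsum m (\<lambda>j. altsum n (\<lambda>k. real ((j + k) choose j))) = (if m = n then 1 else 0)"
proof -
  have inner: "altsum n (\<lambda>k. real ((j + k) choose j)) = (-1) ^ n * real ((0 + j) choose n)" for j
  proof -
    have "altsum n (\<lambda>k. real ((j + k) choose j)) = (-1) ^ n * (if n \<le> j then real (j choose (j - n)) else 0)"
      by (rule altsum_binomial)
    also have "(if n \<le> j then real (j choose (j - n)) else 0) = real ((0 + j) choose n)"
      by (simp add: binomial_symmetric[of n j] binomial_eq_0)
    finally show ?thesis .
  qed
  have "altsum m (\<lambda>j. altsum n (\<lambda>k. real ((j + k) choose j))) =
      (-1) ^ n * ((-1) ^ m * (if m \<le> n then real (0 choose (n - m)) else 0))"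
    unfolding inner unfolding altsum_cmult altsum_binomial ..
  also have "\<dots> = (if m = n then 1 else 0)"
    by (cases "n - m") (auto simp flip: power_mult_distrib)
  finally show ?thesis .
qed

text \<open>Both sides are the Beta integral of x^a (1 - x)^n over [0, 1], the left one with the
  power of 1 - x expanded. The proof uses the recursion in \<open>n\<close> instead.\<close>

lemma altsum_inverse: "altsum n (\<lambda>k. 1 / (real (a + k) + 1)) = fact n * fact a / fact (n + a + 1)"
proof (induction n arbitrary: a)
  case (Suc n)
  have lin: "altsum n (\<lambda>k. f k - g k) = altsum n f - altsum n g" for f g
    by (simp add: altsum_def right_diff_distrib sum_subtractf)
  have "altsum (Suc n) (\<lambda>k. 1 / (real (a + k) + 1)) =
      altsum n (\<lambda>k. 1 / (real (a + k) + 1)) - altsum n (\<lambda>k. 1 / (real (Suc a + k) + 1))"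
    unfolding altsum_Suc lin by simp
  also have "\<dots> = fact n * fact a / fact (n + a + 1) - fact n * fact (Suc a) / fact (Suc (n + a + 1))"
    unfolding Suc.IH by simp
  also have "\<dots> = fact (Suc n) * fact a / fact (Suc (n + a + 1))"
  proof -
    define F :: real where "F = fact (n + a + 1)"
    define N :: real where "N = real n + real a + 2"
    have F: "F \<noteq> 0" "N \<noteq> 0" by (simp_all add: F_def N_def add_nonneg_eq_0_iff)
    have S: "fact (Suc (n + a + 1)) = N * F" by (simp add: F_def N_def algebra_simps)
    have "fact n * fact a / F - fact n * fact (Suc a) / (N * F) = fact n * fact a * (N - (real a + 1)) / (N * F)"
      using F by (simp add: field_simps)
    also have "N - (real a + 1) = real n + 1" by (simp add: N_def)
    finally show ?thesis unfolding S F_def[symmetric] by (simp add: mult_ac add.commute)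
  qed
  finally show ?case by simp
qed simp

text \<open>The Hilbert matrix is invariant under the binomial transform in both indices, which
  mirrors the substitution of 1 - x for x in the integral of x^(j+k) over [0, 1]. Since the entries
  depend on j + k only, both sums merge into one difference of order m + n.\<close>

lemma altsum_altsum_inverse:
  "altsum m (\<lambda>j. altsum n (\<lambda>k. 1 / (real j + real k + 1))) = 1 / (real m + real n + 1)"
proof -
  define E where "E = (\<lambda>n a. altsum n (\<lambda>k. 1 / (real (a + k) + 1)))"
  have E_Suc: "E n a - E n (Suc a) = E (Suc n) a" for n a
    unfolding E_def altsum_Suc by (simp add: altsum_def right_diff_distrib sum_subtractf)
  have "altsum m (E n) = E (m + n) 0"
    by (induction m arbitrary: n) (simp_all add: altsum_Suc E_Suc)
  also have "\<dots> = 1 / (real m + real n + 1)"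
    unfolding E_def altsum_inverse by (simp add: add_ac)
  finally have "altsum m (E n) = 1 / (real m + real n + 1)" .
  then show ?thesis by (simp add: E_def)
qed

text \<open>The Laguerre polynomial with x^k / k! replaced by its transform
  \<open>quadprod k \<tau> / (fact k)\<^sup>2\<close>, the common factor
  \<open>sqrt (weight \<tau>)\<close> being split off.\<close>

definition laguerre_image :: "nat \<Rightarrow> real \<Rightarrow> real" where
  "laguerre_image n \<tau> = altsum n (\<lambda>k. quadprod k \<tau> / (fact k)\<^sup>2)"

lemma real_polynomial_function_laguerre_image: "real_polynomial_function (laguerre_image n)"
proof -
  have "real_polynomial_function (\<lambda>\<tau>. \<Sum>k\<le>n. real (n choose k) * (-1) ^ k / (fact k)\<^sup>2 * quadprod k \<tau>)"
    by (intro real_polynomial_function_sum real_polynomial_function.intros(4)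
        real_polynomial_function_quadprod real_polynomial_function_const) auto
  moreover have "laguerre_image n = (\<lambda>\<tau>. \<Sum>k\<le>n. real (n choose k) * (-1) ^ k / (fact k)\<^sup>2 * quadprod k \<tau>)"
    by (simp add: laguerre_image_def altsum_def fun_eq_iff)
  ultimately show ?thesis by simp
qed

lemma integral_laguerre_image:
  fixes \<omega> :: "real \<Rightarrow> real"
  assumes i: "\<And>j k. integrable Rpos (\<lambda>\<tau>. \<omega> \<tau> * (quadprod j \<tau> * quadprod k \<tau>))"
  shows "(\<integral>\<tau>. \<omega> \<tau> * (laguerre_image m \<tau> * laguerre_image n \<tau>) \<partial>Rpos) =
    altsum m (\<lambda>j. altsum n (\<lambda>k. (\<integral>\<tau>. \<omega> \<tau> * (quadprod j \<tau> * quadprod k \<tau>) \<partial>Rpos) / (fact j * fact k)\<^sup>2))"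
proof -
  define c :: "nat \<Rightarrow> nat \<Rightarrow> real" where "c = (\<lambda>n k. real (n choose k) * (-1) ^ k / (fact k)\<^sup>2)"
  have p: "laguerre_image n \<tau> = (\<Sum>k\<le>n. c n k * quadprod k \<tau>)" for n \<tau>
    by (simp add: laguerre_image_def altsum_def c_def)
  have "(\<integral>\<tau>. \<omega> \<tau> * (laguerre_image m \<tau> * laguerre_image n \<tau>) \<partial>Rpos) =
      (\<integral>\<tau>. (\<Sum>j\<le>m. \<Sum>k\<le>n. c m j * c n k * (\<omega> \<tau> * (quadprod j \<tau> * quadprod k \<tau>))) \<partial>Rpos)"
    unfolding p sum_product by (simp add: sum_distrib_left mult_ac)
  also have "\<dots> = (\<Sum>j\<le>m. \<Sum>k\<le>n. c m j * c n k * (\<integral>\<tau>. \<omega> \<tau> * (quadprod j \<tau> * quadprod k \<tau>) \<partial>Rpos))"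
    using i by simp
  also have "\<dots> = altsum m (\<lambda>j. altsum n (\<lambda>k. (\<integral>\<tau>. \<omega> \<tau> * (quadprod j \<tau> * quadprod k \<tau>) \<partial>Rpos) / (fact j * fact k)\<^sup>2))"
    unfolding altsum_def c_def sum_distrib_left
    by (intro sum.cong refl) (simp add: power_mult_distrib)
  finally show ?thesis .
qed

lemma integral_weight_laguerre_image:
  "(\<integral>\<tau>. weight \<tau> * (laguerre_image m \<tau> * laguerre_image n \<tau>) \<partial>Rpos) = (if m = n then 1 else 0)"
proof -
  have "(\<integral>\<tau>. weight \<tau> * (laguerre_image m \<tau> * laguerre_image n \<tau>) \<partial>Rpos) =
      altsum m (\<lambda>j. altsum n (\<lambda>k. fact j * fact k * fact (j + k) / (fact j * fact k)\<^sup>2))"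
    unfolding integral_weight_quadprod_quadprod[symmetric]
    by (intro integral_laguerre_image integrable_weight_polynomial real_polynomial_function.intros(4)
        real_polynomial_function_quadprod)
  also have "\<dots> = altsum m (\<lambda>j. altsum n (\<lambda>k. real ((j + k) choose j)))"
    by (simp add: binomial_fact power2_eq_square)
  finally show ?thesis by (simp only: altsum_altsum_binomial)
qed

lemma integral_weight_h_laguerre_image:
  "(\<integral>\<tau>. weight \<tau> * h \<tau> * (laguerre_image m \<tau> * laguerre_image n \<tau>) \<partial>Rpos) = 1 / (real m + real n + 1)"
proof -
  have "(\<integral>\<tau>. weight \<tau> * h \<tau> * (laguerre_image m \<tau> * laguerre_image n \<tau>) \<partial>Rpos) =
      altsum m (\<lambda>j. altsum n (\<lambda>k. (fact j * fact k)\<^sup>2 / (real j + real k + 1) / (fact j * fact k)\<^sup>2))"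
    unfolding integral_weight_h_quadprod_quadprod[symmetric]
    by (intro integral_laguerre_image integrable_weight_h_polynomial real_polynomial_function.intros(4)
        real_polynomial_function_quadprod)
  also have "\<dots> = altsum m (\<lambda>j. altsum n (\<lambda>k. 1 / (real j + real k + 1)))" by simp
  finally show ?thesis by (simp only: altsum_altsum_inverse)
qed

section \<open>The Lebedev transform of the Laguerre functions in closed form\<close>

lemma exp_minus_le_powr:
  assumes "y > (0::real)"
  shows "exp (- y) \<le> y powr (- 1/4)"
proof -
  have "y powr (1/4) \<le> exp y"
  proof (cases "y \<le> 1")
    case True
    then have "y powr (1/4) \<le> 1" using assms powr_mono2[of "1/4" y 1] by simp
    also have "1 \<le> exp y" using assms by simp
    finally show ?thesis .
  next
    case False
    then have "y powr (1/4) \<le> y powr 1" by (intro powr_mono) auto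
    also have "y powr 1 = y" using assms by simp
    also have "y \<le> exp y" using exp_ge_add_one_self[of y] by linarith
    finally show ?thesis .
  qed
  then have "1 / exp y \<le> 1 / y powr (1/4)" using assms by (intro divide_left_mono) auto
  then show ?thesis by (simp add: exp_minus powr_minus inverse_eq_divide)
qed

definition bessel_real :: "real \<Rightarrow> real \<Rightarrow> real" where
  "bessel_real \<tau> x = (\<integral>t. exp (- (x / 2 * cosh t)) * cos (\<tau> * t) \<partial>Rpos)"

lemma cosh_complex_of_real: "cosh (complex_of_real t) = complex_of_real (cosh t)"
  by (simp add: cosh_field_def flip: exp_of_real)

lemma bessel_K_eq: "bessel_K (\<i> * complex_of_real \<tau>) (complex_of_real (x / 2)) = complex_of_real (bessel_real \<tau> x)"
proof -
  have "cosh (\<i> * complex_of_real \<tau> * complex_of_real t) = complex_of_real (cos (\<tau> * t))" for t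
  proof -
    have "\<i> * (\<i> * complex_of_real \<tau> * complex_of_real t) = - complex_of_real (\<tau> * t)"
      by (simp add: complex_eq_iff)
    then show ?thesis unfolding cosh_conv_cos by (simp only: cos_minus cos_of_real)
  qed
  moreover have "exp (- complex_of_real (x / 2) * cosh (complex_of_real t)) = complex_of_real (exp (- (x / 2 * cosh t)))" for t
    unfolding cosh_complex_of_real exp_of_real[symmetric] of_real_mult of_real_minus mult_minus_left ..
  ultimately show ?thesis
    unfolding bessel_K_def bessel_real_def by (simp only: of_real_mult[symmetric] integral_complex_of_real)
qed

lemma
  shows integral_powr_bessel: "(\<integral>x. x powr (real k - 1/2) * exp (- (x / 2)) * bessel_real \<tau> x \<partial>Rpos) =
      sqrt pi * h \<tau> * quadprod k \<tau> / fact k"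
    and integrable_powr_bessel: "integrable Rpos (\<lambda>x. x powr (real k - 1/2) * exp (- (x / 2)) * bessel_real \<tau> x)"
proof -
  define f where "f = (\<lambda>x t. x powr (real k - 1/2) * exp (- (x / 2)) * (exp (- (x / 2 * cosh t)) * cos (\<tau> * t)))"
  define v where "v = (\<lambda>t::real. 4 powr (1/4) * exp (- (1/4 * t)))"
  define u where "u = (\<lambda>x. x powr (real k - 3/4) * exp (- (x / 2)))"
  have u: "integrable Rpos u"
    using integrable_Gamma_Rpos_scaled[of "real k + 1/4" "1/2"] by (simp add: u_def add_nonneg_pos)
  have v: "integrable Rpos v" using integrable_power_exp_Rpos[of "1/4" 0] by (simp add: v_def)
  have meas: "(\<lambda>p. f (fst p) (snd p)) \<in> borel_measurable (Rpos \<Otimes>\<^sub>M Rpos)"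
    unfolding f_def by (rule borel_measurable_Rpos_pair) measurable
  \<comment> \<open>\<open>exp (- y) \<le> y powr (- 1/4)\<close> separates \<open>x\<close> from \<open>t\<close> and keeps \<open>u\<close> integrable at 0 even for \<open>k = 0\<close>.\<close>
  have bound: "norm (f x t) \<le> u x * v t" if xt: "x > 0" "t > 0" for x t
  proof -
    have "exp t \<le> 2 * cosh t" by (simp add: cosh_def)
    then have "x * exp t \<le> x * (2 * cosh t)" using xt by (intro mult_left_mono) auto
    then have "exp (- (x / 2 * cosh t)) \<le> exp (- (x * exp t / 4))" by simp
    also have "\<dots> \<le> (x * exp t / 4) powr (- 1/4)" using xt by (intro exp_minus_le_powr) simp
    also have "\<dots> = x powr (- 1/4) * v t"
      using xt by (simp add: v_def powr_mult powr_divide powr_minus powr_def[of "exp t"] exp_minus field_simps)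
    finally have e: "exp (- (x / 2 * cosh t)) \<le> x powr (- 1/4) * v t" .
    have "norm (f x t) = x powr (real k - 1/2) * exp (- (x / 2)) * (exp (- (x / 2 * cosh t)) * \<bar>cos (\<tau> * t)\<bar>)"
      by (simp add: f_def abs_mult)
    also have "\<dots> \<le> x powr (real k - 1/2) * exp (- (x / 2)) * (exp (- (x / 2 * cosh t)) * 1)"
      by (intro mult_left_mono) auto
    also have "\<dots> \<le> x powr (real k - 1/2) * exp (- (x / 2)) * (x powr (- 1/4) * v t)"
      using e by (intro mult_left_mono) auto
    also have "\<dots> = u x * v t"
    proof -
      have "x powr (real k - 1/2) * x powr (- 1/4) = x powr (real k - 3/4)"
        using xt by (simp flip: powr_add)
      then have "x powr (real k - 1/2) * x powr (- 1/4) * (exp (- (x / 2)) * v t) = x powr (real k - 3/4) * (exp (- (x / 2)) * v t)"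
        by simp
      then show ?thesis by (simp add: u_def mult_ac)
    qed
    finally show ?thesis .
  qed
  have inner: "(\<integral>t. f x t \<partial>Rpos) = x powr (real k - 1/2) * exp (- (x / 2)) * bessel_real \<tau> x" for x
    unfolding f_def bessel_real_def by simp
  show "integrable Rpos (\<lambda>x. x powr (real k - 1/2) * exp (- (x / 2)) * bessel_real \<tau> x)"
    unfolding inner[symmetric] by (rule Fubini_Rpos_dominated(2)[OF meas u v bound])
  have inner2: "(\<integral>x. f x t \<partial>Rpos) = Gamma (real k + 1/2) * (cos (\<tau> * t) * sech (t / 2) ^ (2 * k + 1))" for t
  proof -
    define c where "c = cosh (t / 2)"
    have c: "c > 0" by (simp add: c_def)
    \<comment> \<open>The half-angle identity merges \<open>exp (- (x / 2))\<close> with the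
      exponential of the Bessel integrand. The x-integral becomes a Gamma integral, and
      \<open>t\<close> is left with an odd power of sech(t/2).\<close>
    have "1 + cosh t = 2 * c\<^sup>2" using cosh_double_cosh[of "t / 2"] by (simp add: c_def)
    then have c2: "x / 2 + x / 2 * cosh t = c\<^sup>2 * x" for x
    proof -
      have "x / 2 + x / 2 * cosh t = x / 2 * (1 + cosh t)" by (simp add: algebra_simps)
      then show ?thesis using \<open>1 + cosh t = 2 * c\<^sup>2\<close> by simp
    qed
    have "f x t = x powr (real k + 1/2 - 1) * exp (- (c\<^sup>2 * x)) * cos (\<tau> * t)" for x
      unfolding c2[symmetric] by (simp add: f_def exp_add[symmetric] mult_ac flip: exp_add)
    then have "(\<integral>x. f x t \<partial>Rpos) = (\<integral>x. x powr (real k + 1/2 - 1) * exp (- (c\<^sup>2 * x)) \<partial>Rpos) * cos (\<tau> * t)"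
      by (simp del: diff_add_eq)
    also have "\<dots> = Gamma (real k + 1/2) / (c\<^sup>2) powr (real k + 1/2) * cos (\<tau> * t)"
      using c by (subst integral_Gamma_Rpos_scaled) (auto simp: add_nonneg_pos)
    also have "(c\<^sup>2) powr (real k + 1/2) = c ^ (2 * k + 1)"
    proof -
      have "(c\<^sup>2) powr (real k + 1/2) = (c powr 2) powr (real k + 1/2)" using c by (simp add: powr_numeral)
      also have "\<dots> = c powr (real (2 * k + 1))" unfolding powr_powr by (simp add: algebra_simps)
      also have "\<dots> = c ^ (2 * k + 1)" using c by (rule powr_realpow)
      finally show ?thesis .
    qed
    finally show ?thesis by (simp add: sech_def c_def power_divide)
  qed
  \<comment> \<open>Since \<open>halfprod k\<close> is (1/2)_k k!, the Gamma factor divided by it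
    reduces to sqrt pi / k!.\<close>
  have G: "Gamma (real k + 1/2) * fact k = sqrt pi * halfprod k"
  proof (induction k)
    case (Suc k)
    have "Gamma (real (Suc k) + 1/2) = (real k + 1/2) * Gamma (real k + 1/2)"
    proof -
      have "real k + 1/2 > 0" by (simp add: add_nonneg_pos)
      then have "real k + 1/2 \<notin> \<int>\<^sub>\<le>\<^sub>0" using nonpos_Ints_nonpos by fastforce
      from Gamma_plus1[OF this] show ?thesis by (simp add: add_ac)
    qed
    then have "Gamma (real (Suc k) + 1/2) * fact (Suc k) = (real k + 1/2) * (real k + 1) * (Gamma (real k + 1/2) * fact k)"
      by (simp add: algebra_simps)
    then show ?case unfolding Suc.IH by (simp add: halfprod_Suc)
  qed (simp add: Gamma_one_half_real)
  have "(\<integral>x. x powr (real k - 1/2) * exp (- (x / 2)) * bessel_real \<tau> x \<partial>Rpos) = (\<integral>x. (\<integral>t. f x t \<partial>Rpos) \<partial>Rpos)"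
    unfolding inner ..
  also have "\<dots> = (\<integral>t. (\<integral>x. f x t \<partial>Rpos) \<partial>Rpos)"
    by (rule Fubini_Rpos_dominated(1)[OF meas u v bound, symmetric])
  also have "\<dots> = Gamma (real k + 1/2) * (\<integral>t. cos (\<tau> * t) * sech (t / 2) ^ (2 * k + 1) \<partial>Rpos)"
    unfolding inner2 by (rule Bochner_Integration.integral_mult_right_zero)
  also have "\<dots> = Gamma (real k + 1/2) * (h \<tau> * quadprod k \<tau> / halfprod k)"
    using integral_cos_sech_odd_power[of k \<tau>] halfprod_pos[of k] by (simp add: field_simps)
  also have "\<dots> = sqrt pi * h \<tau> * quadprod k \<tau> / fact k"
    using G halfprod_pos[of k] by (simp add: field_simps)
  finally show "(\<integral>x. x powr (real k - 1/2) * exp (- (x / 2)) * bessel_real \<tau> x \<partial>Rpos) =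
      sqrt pi * h \<tau> * quadprod k \<tau> / fact k" .
qed

lemma weight_eq: "weight \<tau> = 2 * \<tau> * sinh (pi * \<tau>) / pi * (h \<tau>)\<^sup>2"
  by (simp add: weight_def h_def tanh_def power2_eq_square)

text \<open>sinh is odd, so the product is even in \<tau>. This lets \<open>w_eq\<close> be stated
  for every real \<tau>.\<close>

lemma x_sinh_nonneg: "0 \<le> 2 * \<tau> * sinh (pi * \<tau>)"
  by (cases "\<tau> \<ge> 0") (auto intro: mult_nonpos_nonpos simp: mult_nonneg_nonpos)

lemma weight_nonneg: "weight \<tau> \<ge> 0"
  unfolding weight_eq using x_sinh_nonneg[of \<tau>] by simp

lemma weight_pos: "\<tau> > 0 \<Longrightarrow> weight \<tau> > 0"
  using h_pos[of \<tau>] by (simp add: weight_def)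

lemma w_eq: "w n \<tau> = complex_of_real (sqrt (weight \<tau>) * laguerre_image n \<tau>)"
proof -
  define A where "A = sqrt (2 * \<tau> * sinh (pi * \<tau>)) / pi"
  define c :: "nat \<Rightarrow> real" where "c = (\<lambda>k. real (n choose k) * (-1) ^ k / fact k)"
  define g where "g = (\<lambda>k x. x powr (real k - 1/2) * exp (- (x / 2)) * bessel_real \<tau> x)"
  have g: "integrable Rpos (g k)" "integral\<^sup>L Rpos (g k) = sqrt pi * h \<tau> * quadprod k \<tau> / fact k" for k
    unfolding g_def by (rule integrable_powr_bessel integral_powr_bessel)+
  have integrand: "complex_of_real (sqrt (2 * \<tau> * sinh (pi * \<tau>)) / (pi * sqrt x)) *
      bessel_K (\<i> * complex_of_real \<tau>) (complex_of_real (x / 2)) *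
      Q_op (\<lambda>x. complex_of_real (laguerre n x)) x = complex_of_real (A * (\<Sum>k\<le>n. c k * g k x))"
    if "x \<in> space Rpos" for x
  proof -
    have x: "x > 0" using that by simp
    have "x ^ k / sqrt x = x powr (real k - 1/2)" for k
      using x by (simp add: powr_diff powr_realpow powr_half_sqrt)
    then have "laguerre n x / sqrt x = (\<Sum>k\<le>n. c k * x powr (real k - 1/2))"
      by (simp add: laguerre_def c_def sum_divide_distrib flip: times_divide_eq_right)
    then have "A * (exp (- (x / 2)) * bessel_real \<tau> x) * (laguerre n x / sqrt x) = A * (\<Sum>k\<le>n. c k * g k x)"
      by (simp add: g_def sum_distrib_left mult_ac)
    then show ?thesis
      unfolding bessel_K_eq Q_op_def of_real_mult[symmetric] by (simp add: A_def mult_ac)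
  qed
  have "w n \<tau> = (\<integral>x. complex_of_real (A * (\<Sum>k\<le>n. c k * g k x)) \<partial>Rpos)"
    unfolding w_def U_op_def by (rule Bochner_Integration.integral_cong[OF refl integrand])
  also have "\<dots> = complex_of_real (\<integral>x. A * (\<Sum>k\<le>n. c k * g k x) \<partial>Rpos)"
    by (rule integral_complex_of_real)
  also have "(\<integral>x. A * (\<Sum>k\<le>n. c k * g k x) \<partial>Rpos) = A * (\<Sum>k\<le>n. c k * (sqrt pi * h \<tau> * quadprod k \<tau> / fact k))"
    using g by simp
  also have "\<dots> = A * sqrt pi * h \<tau> * laguerre_image n \<tau>"
    unfolding laguerre_image_def altsum_def c_def sum_distrib_left
    by (intro sum.cong refl) (simp add: power2_eq_square)
  also have "A * sqrt pi * h \<tau> = sqrt (weight \<tau>)"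
  proof -
    have "A * sqrt pi = sqrt (2 * \<tau> * sinh (pi * \<tau>)) / sqrt pi"
      unfolding A_def times_divide_eq_left by (subst frac_eq_eq) (auto simp: mult.assoc)
    then have "A * sqrt pi * h \<tau> = sqrt (2 * \<tau> * sinh (pi * \<tau>) / pi) * sqrt ((h \<tau>)\<^sup>2)"
      using h_pos[of \<tau>] by (simp add: real_sqrt_divide)
    also have "\<dots> = sqrt (weight \<tau>)" unfolding weight_eq by (rule real_sqrt_mult[symmetric])
    finally show ?thesis .
  qed
  finally show ?thesis .
qed

section \<open>Completeness\<close>

text \<open>The square of \<open>u\<close> costs at most exp(\<tau>) against a decay exp(-pi \<tau>)
  of the weight; since pi \<ge> 2, a factor exp(-\<tau>) remains. The room left for \<open>u\<close>
  later accommodates the Taylor partial sums of the cosine.\<close>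

lemma L2_sqrt_weight:
  assumes p: "real_polynomial_function p"
    and u: "u \<in> borel_measurable borel" "\<And>\<tau>. \<tau> > 0 \<Longrightarrow> \<bar>u \<tau>\<bar> \<le> exp (\<tau> / 2)"
  shows "L2 Rpos (\<lambda>\<tau>. complex_of_real (sqrt (weight \<tau>) * p \<tau> * u \<tau>))"
  unfolding L2_def
proof (intro conjI)
  have p_meas [measurable]: "p \<in> borel_measurable borel" by (rule borel_measurable_polynomial[OF p])
  note [measurable] = u(1)
  show "(\<lambda>\<tau>. complex_of_real (sqrt (weight \<tau>) * p \<tau> * u \<tau>)) \<in> borel_measurable Rpos"
    by (rule borel_measurable_Rpos) measurable
  have q: "real_polynomial_function (\<lambda>\<tau>. 2 * \<tau> * (p \<tau> * p \<tau>))"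
    by (intro real_polynomial_function.intros(4) p real_polynomial_function_id real_polynomial_function_const)
  have "integrable Rpos (\<lambda>\<tau>. 2 * \<tau> * (p \<tau> * p \<tau>) * (tanh (pi * \<tau>) * h \<tau> * (u \<tau>)\<^sup>2))"
  proof (rule integrable_polynomial_mult_Rpos[OF q, of 1 _ "2 * pi"])
    show "(\<lambda>\<tau>. tanh (pi * \<tau>) * h \<tau> * (u \<tau>)\<^sup>2) \<in> borel_measurable borel" by measurable
    fix \<tau> :: real assume \<tau>: "\<tau> > 0"
    have "(\<bar>u \<tau>\<bar>)\<^sup>2 \<le> (exp (\<tau> / 2))\<^sup>2" using u(2)[OF \<tau>] by (intro power_mono) auto
    also have "(exp (\<tau> / 2))\<^sup>2 = exp \<tau>" by (simp flip: exp_double)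
    finally have u2: "(u \<tau>)\<^sup>2 \<le> exp \<tau>" by simp
    have "\<bar>tanh (pi * \<tau>) * h \<tau> * (u \<tau>)\<^sup>2\<bar> = \<bar>tanh (pi * \<tau>)\<bar> * (h \<tau> * (u \<tau>)\<^sup>2)"
      using h_pos[of \<tau>] by (simp add: abs_mult)
    also have "\<dots> \<le> 1 * (2 * pi * exp (- (pi * \<tau>)) * exp \<tau>)"
      using abs_tanh_le_1[of "pi * \<tau>"] h_pos[of \<tau>] h_le_exp[of \<tau>] u2
      by (intro mult_mono) (auto simp: less_imp_le)
    also have "\<dots> = 2 * pi * exp (\<tau> - pi * \<tau>)" by (simp add: exp_diff exp_minus field_simps)
    also have "\<dots> \<le> 2 * pi * exp (- (1 * \<tau>))"
    proof -
      have "2 * \<tau> \<le> pi * \<tau>" using pi_ge_two \<tau> by (intro mult_right_mono) auto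
      then show ?thesis by (intro mult_left_mono) auto
    qed
    finally show "\<bar>tanh (pi * \<tau>) * h \<tau> * (u \<tau>)\<^sup>2\<bar> \<le> 2 * pi * exp (- (1 * \<tau>))" .
  qed simp
  moreover have "(cmod (complex_of_real (sqrt (weight \<tau>) * p \<tau> * u \<tau>)))\<^sup>2 =
      2 * \<tau> * (p \<tau> * p \<tau>) * (tanh (pi * \<tau>) * h \<tau> * (u \<tau>)\<^sup>2)" for \<tau>
  proof -
    have "(cmod (complex_of_real (sqrt (weight \<tau>) * p \<tau> * u \<tau>)))\<^sup>2 = (sqrt (weight \<tau>) * p \<tau> * u \<tau>)\<^sup>2"
      by (simp only: norm_of_real power2_abs)
    also have "\<dots> = weight \<tau> * (p \<tau>)\<^sup>2 * (u \<tau>)\<^sup>2"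
      by (simp add: power_mult_distrib weight_nonneg)
    finally show ?thesis by (simp add: weight_def power2_eq_square mult_ac)
  qed
  ultimately show "integrable Rpos (\<lambda>\<tau>. (cmod (complex_of_real (sqrt (weight \<tau>) * p \<tau> * u \<tau>)))\<^sup>2)"
    by (simp only:)
qed

lemma L2_sqrt_weight_polynomial:
  assumes "real_polynomial_function p"
  shows "L2 Rpos (\<lambda>\<tau>. complex_of_real (sqrt (weight \<tau>) * p \<tau>))"
  using L2_sqrt_weight[OF assms, of "\<lambda>_. 1"] by simp

lemma real_polynomial_function_power: "real_polynomial_function (\<lambda>x::real. x ^ n)"
  by (induction n) (auto intro: real_polynomial_function.intros(4) real_polynomial_function_id real_polynomial_function_const)

section \<open>Orthonormality, and the matrix of multiplication by \<open>h\<close>\<close>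

lemma w_L2: "L2 Rpos (w n)"
  unfolding w_eq[abs_def] by (rule L2_sqrt_weight_polynomial[OF real_polynomial_function_laguerre_image])

lemma w_orthonormal: "(\<integral>\<tau>. w m \<tau> * w n \<tau> \<partial>Rpos) = (if m = n then 1 else 0)"
proof -
  have "w m \<tau> * w n \<tau> = complex_of_real (weight \<tau> * (laguerre_image m \<tau> * laguerre_image n \<tau>))" for \<tau>
  proof -
    have "sqrt (weight \<tau>) * laguerre_image m \<tau> * (sqrt (weight \<tau>) * laguerre_image n \<tau>) =
        (sqrt (weight \<tau>) * sqrt (weight \<tau>)) * (laguerre_image m \<tau> * laguerre_image n \<tau>)" by (simp only: mult_ac)
    also have "sqrt (weight \<tau>) * sqrt (weight \<tau>) = weight \<tau>" by (simp add: weight_nonneg)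
    finally show ?thesis unfolding w_eq of_real_mult[symmetric] by (simp only:)
  qed
  then show ?thesis by (simp only: integral_complex_of_real integral_weight_laguerre_image) simp
qed

lemma integral_h_w_w: "(\<integral>\<tau>. complex_of_real (h \<tau>) * w m \<tau> * w n \<tau> \<partial>Rpos) = hilbert_matrix m n"
proof -
  have "complex_of_real (h \<tau>) * w m \<tau> * w n \<tau> = complex_of_real (weight \<tau> * h \<tau> * (laguerre_image m \<tau> * laguerre_image n \<tau>))" for \<tau>
  proof -
    have "h \<tau> * (sqrt (weight \<tau>) * laguerre_image m \<tau>) * (sqrt (weight \<tau>) * laguerre_image n \<tau>) =
        (sqrt (weight \<tau>) * sqrt (weight \<tau>)) * h \<tau> * (laguerre_image m \<tau> * laguerre_image n \<tau>)" by (simp only: mult_ac)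
    also have "sqrt (weight \<tau>) * sqrt (weight \<tau>) = weight \<tau>" by (simp add: weight_nonneg)
    finally show ?thesis unfolding w_eq of_real_mult[symmetric] by (simp only:)
  qed
  then show ?thesis
    by (simp only: integral_complex_of_real integral_weight_h_laguerre_image) (simp add: hilbert_matrix_def)
qed

text \<open>Only even powers occur because the \<open>laguerre_image n\<close> are polynomials in
  \<tau>^2; accordingly the class is multiplied by cosines, never by sines.\<close>

definition even_moments_vanish :: "(real \<Rightarrow> complex) \<Rightarrow> bool" where
  "even_moments_vanish f \<longleftrightarrow> L2 Rpos f \<and>
    (\<forall>k. (\<integral>\<tau>. f \<tau> * complex_of_real (sqrt (weight \<tau>) * \<tau> ^ (2 * k)) \<partial>Rpos) = 0)"

lemma integrable_L2_sqrt_weight: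
  assumes "L2 Rpos f" "real_polynomial_function p"
  shows "integrable Rpos (\<lambda>\<tau>. f \<tau> * complex_of_real (sqrt (weight \<tau>) * p \<tau>))"
  by (rule L2_mult_integrable[OF assms(1) L2_sqrt_weight_polynomial[OF assms(2)]])

text \<open>Two changes of basis: \<open>laguerre_image n\<close> contains \<open>quadprod n\<close>
  with nonzero coefficient, besides lower ones, and \<tau>^2 \<open>quadprod k\<close> is a
  combination of \<open>quadprod (Suc k)\<close> and \<open>quadprod k\<close>.\<close>

lemma even_moments_vanishI:
  assumes f: "L2 Rpos f" and ortho: "\<And>n. (\<integral>\<tau>. f \<tau> * w n \<tau> \<partial>Rpos) = 0"
  shows "even_moments_vanish f"
proof -
  define m where "m = (\<lambda>p. \<integral>\<tau>. f \<tau> * complex_of_real (sqrt (weight \<tau>) * p \<tau>) \<partial>Rpos)"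
  have m_add: "m (\<lambda>\<tau>. p \<tau> + q \<tau>) = m p + m q" if "real_polynomial_function p" "real_polynomial_function q" for p q
    unfolding m_def using integrable_L2_sqrt_weight[OF f that(1)] integrable_L2_sqrt_weight[OF f that(2)]
    by (simp add: distrib_left)
  have m_cmult: "m (\<lambda>\<tau>. c * p \<tau>) = complex_of_real c * m p" for c p
  proof -
    have "m (\<lambda>\<tau>. c * p \<tau>) = (\<integral>\<tau>. complex_of_real c * (f \<tau> * complex_of_real (sqrt (weight \<tau>) * p \<tau>)) \<partial>Rpos)"
      unfolding m_def by (simp add: mult_ac)
    then show ?thesis unfolding m_def by (simp only: integral_mult_right_zero)
  qed
  have m_sum: "m (\<lambda>\<tau>. \<Sum>k<n. c k * p k \<tau>) = (\<Sum>k<n. complex_of_real (c k) * m (p k))"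
    if "\<And>k. real_polynomial_function (p k)" for n :: nat and c p
  proof (induction n)
    case 0
    show ?case by (simp add: m_def)
  next
    case (Suc n)
    have "real_polynomial_function (\<lambda>\<tau>. \<Sum>k<n. c k * p k \<tau>)" "real_polynomial_function (\<lambda>\<tau>. c n * p n \<tau>)"
      by (intro real_polynomial_function_sum real_polynomial_function.intros(4) that real_polynomial_function_const; simp)+
    from m_add[OF this] show ?case using Suc by (simp add: m_cmult)
  qed
  have m_laguerre: "m (laguerre_image n) = 0" for n
    using ortho[of n] by (simp add: m_def w_eq)
  have m_quadprod: "m (quadprod n) = 0" for n
  proof (induction n rule: less_induct)
    case (less n)
    define c :: "nat \<Rightarrow> real" where "c = (\<lambda>k. real (n choose k) * (-1) ^ k / (fact k)\<^sup>2)"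
    have "laguerre_image n = (\<lambda>\<tau>. \<Sum>k<Suc n. c k * quadprod k \<tau>)"
      by (simp add: laguerre_image_def altsum_def c_def fun_eq_iff lessThan_Suc_atMost del: sum.lessThan_Suc)
    then have "m (laguerre_image n) = (\<Sum>k<Suc n. complex_of_real (c k) * m (quadprod k))"
      by (simp only: m_sum[OF real_polynomial_function_quadprod])
    also have "\<dots> = complex_of_real (c n) * m (quadprod n)" using less by simp
    finally have "complex_of_real (c n) * m (quadprod n) = 0" by (simp only: m_laguerre)
    moreover have "c n \<noteq> 0" by (simp add: c_def)
    ultimately show ?case by simp
  qed
  have "m (\<lambda>\<tau>. \<tau> ^ (2 * j) * quadprod k \<tau>) = 0" for j k
  proof (induction j arbitrary: k)
    case 0
    show ?case using m_quadprod by simp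
  next
    case (Suc j)
    have P: "real_polynomial_function (\<lambda>\<tau>. \<tau> ^ (2 * j) * quadprod k \<tau>)" for k
      by (intro real_polynomial_function.intros(4) real_polynomial_function_power real_polynomial_function_quadprod)
    have "(\<lambda>\<tau>. \<tau> ^ (2 * Suc j) * quadprod k \<tau>) =
        (\<lambda>\<tau>. \<tau> ^ (2 * j) * quadprod (Suc k) \<tau> + (- ((real k + 1/2)\<^sup>2)) * (\<tau> ^ (2 * j) * quadprod k \<tau>))"
      by (simp add: fun_eq_iff quadprod_Suc algebra_simps power2_eq_square)
    then have "m (\<lambda>\<tau>. \<tau> ^ (2 * Suc j) * quadprod k \<tau>) =
        m (\<lambda>\<tau>. \<tau> ^ (2 * j) * quadprod (Suc k) \<tau>) + m (\<lambda>\<tau>. (- ((real k + 1/2)\<^sup>2)) * (\<tau> ^ (2 * j) * quadprod k \<tau>))"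
      using m_add[OF P[of "Suc k"] real_polynomial_function.intros(4)[OF real_polynomial_function_const P[of k]]]
      by (simp only:)
    then show ?case by (simp only: m_cmult Suc.IH) simp
  qed
  from this[of _ 0] f show ?thesis by (simp add: even_moments_vanish_def m_def)
qed

text \<open>For |s| \<le> 1/2 all partial sums of the cosine series are bounded by exp(\<tau>/2),
  and \<open>f\<close> times \<open>sqrt weight\<close> remains integrable against a power times
  this bound. Integration may therefore be done term by term, and each term is a moment of
  \<open>f\<close>.\<close>

lemma even_moments_vanish_cos_small:
  assumes f: "even_moments_vanish f" and s: "\<bar>s\<bar> \<le> 1/2"
  shows "even_moments_vanish (\<lambda>\<tau>. f \<tau> * complex_of_real (cos (s * \<tau>)))"
  unfolding even_moments_vanish_def
proof (intro conjI allI)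
  have f2: "L2 Rpos f" and fm: "\<And>k. (\<integral>\<tau>. f \<tau> * complex_of_real (sqrt (weight \<tau>) * \<tau> ^ (2 * k)) \<partial>Rpos) = 0"
    using f by (auto simp: even_moments_vanish_def)
  have [measurable]: "f \<in> borel_measurable Rpos" using f2 by (rule L2_measurable)
  have cos_meas: "(\<lambda>\<tau>. complex_of_real (cos (s * \<tau>))) \<in> borel_measurable Rpos"
    by (rule borel_measurable_Rpos) measurable
  show "L2 Rpos (\<lambda>\<tau>. f \<tau> * complex_of_real (cos (s * \<tau>)))"
    by (rule L2_bound[OF f2, of _ 1]) (auto intro: borel_measurable_times cos_meas simp: norm_mult mult_left_le)
  fix k
  define F where "F = (\<lambda>\<tau>. f \<tau> * complex_of_real (sqrt (weight \<tau>) * \<tau> ^ (2 * k)))"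
  define S where "S = (\<lambda>N \<tau>. \<Sum>n<N. cos_coeff n * (s * \<tau>) ^ n)"
  have F_int: "integrable Rpos F"
    unfolding F_def by (intro integrable_L2_sqrt_weight f2 real_polynomial_function_power)
  have S_bound: "\<bar>S N \<tau>\<bar> \<le> exp (\<tau> / 2)" if "\<tau> > 0" for N \<tau>
  proof -
    have "\<bar>S N \<tau>\<bar> \<le> (\<Sum>n<N. \<bar>cos_coeff n * (s * \<tau>) ^ n\<bar>)" unfolding S_def by (rule sum_abs)
    also have "\<dots> \<le> (\<Sum>n<N. (\<tau> / 2) ^ n /\<^sub>R fact n)"
    proof (rule sum_mono)
      fix n
      have "\<bar>s * \<tau>\<bar> \<le> 1/2 * \<tau>" unfolding abs_mult using s that by (intro mult_mono) auto
      then have "\<bar>s * \<tau>\<bar> ^ n \<le> (\<tau> / 2) ^ n" by (intro power_mono) auto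
      moreover have "\<bar>cos_coeff n\<bar> \<le> inverse (fact n)" by (simp add: cos_coeff_def abs_mult power_abs inverse_eq_divide)
      ultimately have "\<bar>cos_coeff n\<bar> * \<bar>s * \<tau>\<bar> ^ n \<le> inverse (fact n) * (\<tau> / 2) ^ n"
        by (intro mult_mono) auto
      then show "\<bar>cos_coeff n * (s * \<tau>) ^ n\<bar> \<le> (\<tau> / 2) ^ n /\<^sub>R fact n"
        by (simp only: abs_mult power_abs real_scaleR_def)
    qed
    also have "\<dots> \<le> exp (\<tau> / 2)"
      unfolding exp_def using that by (intro sum_le_suminf summable_exp_generic) auto
    finally show ?thesis .
  qed
  have dom: "integrable Rpos (\<lambda>\<tau>. norm (f \<tau> * complex_of_real (sqrt (weight \<tau>) * \<tau> ^ (2 * k) * exp (\<tau> / 2))))"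
    by (intro integrable_norm L2_mult_integrable f2 L2_sqrt_weight real_polynomial_function_power) auto
  have "(\<lambda>N. \<integral>\<tau>. F \<tau> * complex_of_real (S N \<tau>) \<partial>Rpos) \<longlonglongrightarrow> (\<integral>\<tau>. F \<tau> * complex_of_real (cos (s * \<tau>)) \<partial>Rpos)"
  proof (rule integral_dominated_convergence[OF _ _ dom])
    show "(\<lambda>\<tau>. F \<tau> * complex_of_real (cos (s * \<tau>))) \<in> borel_measurable Rpos"
      by (rule borel_measurable_times[OF borel_measurable_integrable[OF F_int] cos_meas])
    have "(\<lambda>\<tau>. complex_of_real (S N \<tau>)) \<in> borel_measurable Rpos" for N
      unfolding S_def by (rule borel_measurable_Rpos) measurable
    then show "(\<lambda>\<tau>. F \<tau> * complex_of_real (S N \<tau>)) \<in> borel_measurable Rpos" for N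
      by (rule borel_measurable_times[OF borel_measurable_integrable[OF F_int]])
    have "(\<lambda>N. S N \<tau>) \<longlonglongrightarrow> cos (s * \<tau>)" for \<tau>
      unfolding S_def using cos_converges[of "s * \<tau>"] by (simp add: sums_def)
    then show "AE \<tau> in Rpos. (\<lambda>N. F \<tau> * complex_of_real (S N \<tau>)) \<longlonglongrightarrow> F \<tau> * complex_of_real (cos (s * \<tau>))"
      by (intro AE_I2 tendsto_mult tendsto_const tendsto_of_real)
    show "AE \<tau> in Rpos. norm (F \<tau> * complex_of_real (S N \<tau>)) \<le>
        norm (f \<tau> * complex_of_real (sqrt (weight \<tau>) * \<tau> ^ (2 * k) * exp (\<tau> / 2)))" for N
    proof (rule AE_I2)
      fix \<tau> assume "\<tau> \<in> space Rpos"
      then have "norm (F \<tau>) * \<bar>S N \<tau>\<bar> \<le> norm (F \<tau>) * exp (\<tau> / 2)"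
        by (intro mult_left_mono S_bound) auto
      then show "norm (F \<tau> * complex_of_real (S N \<tau>)) \<le>
          norm (f \<tau> * complex_of_real (sqrt (weight \<tau>) * \<tau> ^ (2 * k) * exp (\<tau> / 2)))"
        by (simp add: F_def norm_mult abs_mult mult_ac)
    qed
  qed
  moreover have "(\<integral>\<tau>. F \<tau> * complex_of_real (S N \<tau>) \<partial>Rpos) = 0" for N
  proof -
    define G where "G = (\<lambda>n \<tau>. f \<tau> * complex_of_real (sqrt (weight \<tau>) * \<tau> ^ (2 * k + n)))"
    have G_int: "integrable Rpos (G n)" for n
      unfolding G_def by (intro integrable_L2_sqrt_weight f2 real_polynomial_function_power)
    have "F \<tau> * complex_of_real (S N \<tau>) = (\<Sum>n<N. complex_of_real (cos_coeff n * s ^ n) * G n \<tau>)" for \<tau>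
      unfolding F_def S_def G_def of_real_sum sum_distrib_left
      by (intro sum.cong refl) (simp add: power_mult_distrib power_add mult_ac)
    then have "(\<integral>\<tau>. F \<tau> * complex_of_real (S N \<tau>) \<partial>Rpos) = (\<Sum>n<N. complex_of_real (cos_coeff n * s ^ n) * integral\<^sup>L Rpos (G n))"
      using G_int by simp
    also have "\<dots> = 0"
    proof (rule sum.neutral, intro ballI)
      fix n
      show "complex_of_real (cos_coeff n * s ^ n) * integral\<^sup>L Rpos (G n) = 0"
      \<comment> \<open>The odd Taylor coefficients of the cosine vanish, so only even moments of
        \<open>f\<close> are met.\<close>
      proof (cases "even n")
        case True
        then obtain i where "n = 2 * i" by auto
        then have "2 * k + n = 2 * (k + i)" by simp
        then show ?thesis unfolding G_def by (simp only: fm mult_zero_right)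
      qed (simp add: cos_coeff_def)
    qed
    finally show ?thesis .
  qed
  ultimately have "(\<lambda>N::nat. 0) \<longlonglongrightarrow> (\<integral>\<tau>. F \<tau> * complex_of_real (cos (s * \<tau>)) \<partial>Rpos)" by (simp only:)
  then have "(\<integral>\<tau>. F \<tau> * complex_of_real (cos (s * \<tau>)) \<partial>Rpos) = 0" by (rule LIMSEQ_unique[OF _ tendsto_const])
  then show "(\<integral>\<tau>. f \<tau> * complex_of_real (cos (s * \<tau>)) * complex_of_real (sqrt (weight \<tau>) * \<tau> ^ (2 * k)) \<partial>Rpos) = 0"
    by (simp add: F_def mult_ac)
qed

text \<open>The combination is the one in cos(a + b) = 2 cos a cos b - cos(a - b).\<close>

lemma even_moments_vanish_linear:
  assumes f: "even_moments_vanish f" and g: "even_moments_vanish g"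
  shows "even_moments_vanish (\<lambda>\<tau>. c * f \<tau> - g \<tau>)"
  unfolding even_moments_vanish_def
proof (intro conjI allI)
  have f2: "L2 Rpos f" and g2: "L2 Rpos g" using f g by (auto simp: even_moments_vanish_def)
  show "L2 Rpos (\<lambda>\<tau>. c * f \<tau> - g \<tau>)" by (intro L2_diff L2_cmult f2 g2)
  fix k
  let ?p = "\<lambda>\<tau>. complex_of_real (sqrt (weight \<tau>) * \<tau> ^ (2 * k))"
  have "(\<integral>\<tau>. (c * f \<tau> - g \<tau>) * ?p \<tau> \<partial>Rpos) = (\<integral>\<tau>. c * (f \<tau> * ?p \<tau>) - g \<tau> * ?p \<tau> \<partial>Rpos)"
    by (simp add: left_diff_distrib mult.assoc)
  also have "\<dots> = c * (\<integral>\<tau>. f \<tau> * ?p \<tau> \<partial>Rpos) - (\<integral>\<tau>. g \<tau> * ?p \<tau> \<partial>Rpos)"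
    unfolding integral_mult_right_zero[symmetric]
    by (rule Bochner_Integration.integral_diff)
      (rule integrable_mult_right integrable_L2_sqrt_weight f2 g2 real_polynomial_function_power)+
  also have "\<dots> = 0" using f g by (simp add: even_moments_vanish_def del: of_real_mult)
  finally show "(\<integral>\<tau>. (c * f \<tau> - g \<tau>) * ?p \<tau> \<partial>Rpos) = 0" .
qed

text \<open>The Taylor series of the cosine only reaches frequencies below the decay rate of the weight;
  the Chebyshev recurrence carries the vanishing to all multiples.\<close>

lemma even_moments_vanish_cos:
  assumes f: "even_moments_vanish f"
  shows "even_moments_vanish (\<lambda>\<tau>. f \<tau> * complex_of_real (cos (s * \<tau>)))"
proof -
  obtain N :: nat where N: "2 * \<bar>s\<bar> < real N" using reals_Archimedean2 by blast
  define r where "r = s / real N"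
  have N0: "real N > 0" using N by linarith
  have r: "\<bar>r\<bar> \<le> 1/2" using N N0 by (simp add: r_def abs_divide divide_le_eq)
  define g where "g = (\<lambda>n \<tau>. f \<tau> * complex_of_real (cos (real n * r * \<tau>)))"
  have "even_moments_vanish (g n) \<and> even_moments_vanish (g (Suc n))" for n
  proof (induction n)
    case 0
    show ?case using f even_moments_vanish_cos_small[OF f r] by (simp add: g_def)
  next
    case (Suc n)
    have cheb: "g (Suc (Suc n)) = (\<lambda>\<tau>. 2 * (g (Suc n) \<tau> * complex_of_real (cos (r * \<tau>))) - g n \<tau>)"
    proof
      fix \<tau>
      define a where "a = real (Suc n) * r * \<tau>"
      have e: "real (Suc (Suc n)) * r * \<tau> = a + r * \<tau>" "real n * r * \<tau> = a - r * \<tau>"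
        by (simp_all add: a_def algebra_simps)
      have "cos (a + r * \<tau>) = 2 * (cos a * cos (r * \<tau>)) - cos (a - r * \<tau>)" by (simp add: cos_add cos_diff)
      then have "complex_of_real (cos (a + r * \<tau>)) =
          2 * (complex_of_real (cos a) * complex_of_real (cos (r * \<tau>))) - complex_of_real (cos (a - r * \<tau>))"
        by (simp only: of_real_diff of_real_mult of_real_numeral)
      then show "g (Suc (Suc n)) \<tau> = 2 * (g (Suc n) \<tau> * complex_of_real (cos (r * \<tau>))) - g n \<tau>"
        unfolding g_def e a_def[symmetric] by (simp only: right_diff_distrib mult_ac)
    qed
    show ?case
      using Suc even_moments_vanish_linear[OF even_moments_vanish_cos_small[OF _ r], of "g (Suc n)" "g n" 2]
      by (simp add: cheb)
  qed
  then have "even_moments_vanish (g N)" by blast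
  then show ?thesis using N0 by (simp add: g_def r_def)
qed

text \<open>As \<open>h\<close> is the cosine transform of sech(t/2), Fubini makes the inner
  \<tau>-integral a moment of \<open>f\<close> times a cosine, which vanishes for every
  \<open>t\<close>.\<close>

lemma even_moments_vanish_h:
  assumes f: "even_moments_vanish f"
  shows "even_moments_vanish (\<lambda>\<tau>. complex_of_real (h \<tau>) * f \<tau>)"
  unfolding even_moments_vanish_def
proof (intro conjI allI)
  have f2: "L2 Rpos f" using f by (simp add: even_moments_vanish_def)
  have [measurable]: "f \<in> borel_measurable Rpos" using f2 by (rule L2_measurable)
  have h_meas: "(\<lambda>\<tau>. complex_of_real (h \<tau>)) \<in> borel_measurable Rpos" by (rule borel_measurable_Rpos) measurable
  show "L2 Rpos (\<lambda>\<tau>. complex_of_real (h \<tau>) * f \<tau>)"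
    by (rule L2_bound[OF f2, of _ pi])
      (use h_pos h_le_pi in \<open>auto intro!: borel_measurable_times h_meas mult_right_mono simp: norm_mult less_imp_le\<close>)
  fix k
  define F where "F = (\<lambda>\<tau>. f \<tau> * complex_of_real (sqrt (weight \<tau>) * \<tau> ^ (2 * k)))"
  define K where "K = (\<lambda>\<tau> t. F \<tau> * complex_of_real (cos (t * \<tau>) * sech (t / 2)))"
  have F_int: "integrable Rpos F"
    unfolding F_def by (intro integrable_L2_sqrt_weight f2 real_polynomial_function_power)
  have F_meas [measurable]: "F \<in> borel_measurable Rpos" using F_int by auto
  have sech_int: "integrable Rpos (\<lambda>t. sech (t / 2))" using integrable_cos_sech_power[of 1 0] by simp
  have "(\<lambda>p. complex_of_real (cos (snd p * fst p) * sech (snd p / 2))) \<in> borel_measurable (Rpos \<Otimes>\<^sub>M Rpos)"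
    by (rule borel_measurable_Rpos_pair) measurable
  then have meas: "(\<lambda>p. K (fst p) (snd p)) \<in> borel_measurable (Rpos \<Otimes>\<^sub>M Rpos)"
    unfolding K_def by (intro borel_measurable_times measurable_compose[OF measurable_fst F_meas])
  have "(\<integral>t. (\<integral>\<tau>. K \<tau> t \<partial>Rpos) \<partial>Rpos) = (\<integral>\<tau>. (\<integral>t. K \<tau> t \<partial>Rpos) \<partial>Rpos)"
  proof (rule Fubini_Rpos_dominated(1)[OF meas integrable_norm[OF F_int] sech_int])
    show "norm (K x y) \<le> norm (F x) * sech (y / 2)" for x y
      unfolding K_def norm_mult norm_of_real abs_mult
      by (intro mult_left_mono) (auto simp: mult_left_le_one_le less_imp_le)
  qed
  moreover have "(\<integral>t. K \<tau> t \<partial>Rpos) = F \<tau> * complex_of_real (h \<tau>)" for \<tau>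
  proof -
    have "(\<integral>t. K \<tau> t \<partial>Rpos) = F \<tau> * complex_of_real (\<integral>t. cos (t * \<tau>) * sech (t / 2) \<partial>Rpos)"
      unfolding K_def by (simp only: integral_mult_right_zero integral_complex_of_real)
    then show ?thesis using integral_cos_sech_half[of \<tau>] by (simp add: h_def mult.commute[of \<tau>])
  qed
  moreover have "(\<integral>\<tau>. K \<tau> t \<partial>Rpos) = 0" for t
  proof -
    have "(\<integral>\<tau>. K \<tau> t \<partial>Rpos) =
        (\<integral>\<tau>. complex_of_real (sech (t / 2)) * (f \<tau> * complex_of_real (cos (t * \<tau>)) * complex_of_real (sqrt (weight \<tau>) * \<tau> ^ (2 * k))) \<partial>Rpos)"
      unfolding K_def F_def by (simp add: mult_ac)
    also have "\<dots> = 0"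
      using even_moments_vanish_cos[OF f, of t]
      by (simp add: even_moments_vanish_def del: of_real_mult)
    finally show ?thesis .
  qed
  ultimately have "(\<integral>\<tau>. F \<tau> * complex_of_real (h \<tau>) \<partial>Rpos) = 0" by simp
  then show "(\<integral>\<tau>. complex_of_real (h \<tau>) * f \<tau> * complex_of_real (sqrt (weight \<tau>) * \<tau> ^ (2 * k)) \<partial>Rpos) = 0"
    by (simp add: F_def mult_ac)
qed

lemma h_strict_antimono: "0 \<le> x \<Longrightarrow> x < y \<Longrightarrow> h y < h x"
  unfolding h_def by (intro divide_strict_left_mono) (auto simp: cosh_real_nonneg_less_iff)

text \<open>Integrability, not square-integrability, is the right hypothesis: the lemma is applied
  to \<open>f\<close> times \<open>sqrt weight\<close> and to differences of products of two L2
  functions.\<close>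

lemma AE_zero_of_h_moments:
  assumes "integrable Rpos F" "\<And>n. (\<integral>x. complex_of_real (h x ^ n) * F x \<partial>Rpos) = 0"
  shows "AE x in Rpos. F x = 0"
  by (rule AE_zero_of_integral_mult_powers_zero[OF assms(1) h_measurable _ h_strict_antimono assms(2), of pi])
    (use h_pos h_le_pi in \<open>auto simp: less_imp_le\<close>)

lemma w_complete:
  assumes f: "L2 Rpos f" and ortho: "\<And>n. (\<integral>\<tau>. f \<tau> * w n \<tau> \<partial>Rpos) = 0"
  shows "AE \<tau> in Rpos. f \<tau> = 0"
proof -
  define F where "F = (\<lambda>\<tau>. f \<tau> * complex_of_real (sqrt (weight \<tau>)))"
  have F: "integrable Rpos F"
    using integrable_L2_sqrt_weight[OF f real_polynomial_function_const[of 1]] by (simp add: F_def)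
  have hn: "even_moments_vanish (\<lambda>\<tau>. complex_of_real (h \<tau> ^ n) * f \<tau>)" for n
  proof (induction n)
    case 0
    show ?case using even_moments_vanishI[OF f ortho] by simp
  next
    case (Suc n)
    from even_moments_vanish_h[OF this] show ?case by (simp add: mult.assoc)
  qed
  have "(\<integral>\<tau>. complex_of_real (h \<tau> ^ n) * F \<tau> \<partial>Rpos) = 0" for n
  proof -
    have "(\<integral>\<tau>. complex_of_real (h \<tau> ^ n) * f \<tau> * complex_of_real (sqrt (weight \<tau>) * \<tau> ^ (2 * 0)) \<partial>Rpos) = 0"
      using hn[of n] unfolding even_moments_vanish_def by blast
    then show ?thesis by (simp add: F_def mult.assoc)
  qed
  then have "AE \<tau> in Rpos. F \<tau> = 0" by (rule AE_zero_of_h_moments[OF F])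
  then show ?thesis
  proof (rule AE_mp, intro AE_I2 impI)
    fix \<tau> assume "\<tau> \<in> space Rpos" "F \<tau> = 0"
    then show "f \<tau> = 0" using weight_pos[of \<tau>] by (simp add: F_def)
  qed
qed

interpretation W: real_orthonormal_basis Rpos w
proof
  show "cnj (w n x) = w n x" for n x by (simp add: w_eq)
  show "L2 Rpos (w n)" for n by (rule w_L2)
  show "(\<integral>x. w m x * w n x \<partial>Rpos) = (if m = n then 1 else 0)" for m n by (rule w_orthonormal)
  show "AE x in Rpos. f x = 0" if "L2 Rpos f" "\<And>n. (\<integral>x. f x * w n x \<partial>Rpos) = 0" for f
    using that by (rule w_complete)
qed

lemma L2_h: "L2 Rpos F \<Longrightarrow> L2 Rpos (\<lambda>x. complex_of_real (h x) * F x)"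
proof -
  assume F: "L2 Rpos F"
  have h_meas: "(\<lambda>\<tau>. complex_of_real (h \<tau>)) \<in> borel_measurable Rpos" by (rule borel_measurable_Rpos) measurable
  show ?thesis
    by (rule L2_bound[OF F, of _ pi])
      (use h_pos h_le_pi in \<open>auto intro!: borel_measurable_times h_meas L2_measurable[OF F] mult_right_mono simp: norm_mult less_imp_le\<close>)
qed

section \<open>Square roots of the Hilbert matrix\<close>

definition coefficients :: "(real \<Rightarrow> complex) \<Rightarrow> nat \<Rightarrow> complex" where
  "coefficients F n = (\<integral>t. F t * w n t \<partial>Rpos)"

lemma coefficients_in_ell2: "L2 Rpos F \<Longrightarrow> coefficients F \<in> ell2"
  using W.bessel[of F] by (simp add: ell2_def coefficients_def)

lemma coefficients_sums:
  "L2 Rpos F \<Longrightarrow> L2 Rpos G \<Longrightarrow> (\<lambda>n. coefficients F n * coefficients G n) sums (\<integral>t. F t * G t \<partial>Rpos)"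
  unfolding coefficients_def by (rule W.parseval)

lemma coefficients_surj:
  assumes "summable (\<lambda>n. (cmod (x n))\<^sup>2)"
  obtains F where "L2 Rpos F" "coefficients F = x"
  using W.riesz_fischer[OF assms] by (auto simp: coefficients_def fun_eq_iff)

lemma coefficients_w: "coefficients (w n) = ell2_basis n"
  by (auto simp: coefficients_def ell2_basis_def w_orthonormal fun_eq_iff)

lemma coefficients_h_w: "coefficients (\<lambda>t. complex_of_real (h t) * w m t) n = hilbert_matrix m n"
  unfolding coefficients_def by (rule integral_h_w_w)

text \<open>The rows of the Hilbert matrix are the coefficients of \<open>h * w m\<close>, so
  Parseval sums each row against \<open>coefficients F\<close>. In the basis \<open>w\<close> the
  Hilbert operator is thus multiplication by the bounded function \<open>h\<close>.\<close>

lemma hilbert_op_coefficients: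
  assumes F: "L2 Rpos F"
  shows "hilbert_op (coefficients F) = coefficients (\<lambda>t. complex_of_real (h t) * F t)"
proof
  fix m
  have "(\<lambda>n. hilbert_matrix m n * coefficients F n) sums (\<integral>t. complex_of_real (h t) * w m t * F t \<partial>Rpos)"
    using coefficients_sums[OF L2_h[OF w_L2[of m]] F] by (simp only: coefficients_h_w)
  then show "hilbert_op (coefficients F) m = coefficients (\<lambda>t. complex_of_real (h t) * F t) m"
    by (simp add: hilbert_op_def op_of_matrix_def sums_iff coefficients_def mult_ac)
qed

lemma hilbert_op_power_coefficients:
  assumes F: "L2 Rpos F"
  shows "L2 Rpos (\<lambda>t. complex_of_real (h t ^ j) * F t) \<and>
    (hilbert_op ^^ j) (coefficients F) = coefficients (\<lambda>t. complex_of_real (h t ^ j) * F t)"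
proof (induction j)
  case 0
  show ?case using F by simp
next
  case (Suc j)
  then show ?case
    using L2_h[of "\<lambda>t. complex_of_real (h t ^ j) * F t"] hilbert_op_coefficients[of "\<lambda>t. complex_of_real (h t ^ j) * F t"]
    by (simp add: mult.assoc)
qed

lemma op_square_eq_hilbert_op:
  assumes T: "bounded_op_ell2 T"
    and g: "g \<in> borel_measurable Rpos" "\<And>\<tau>. \<tau> > 0 \<Longrightarrow> (g \<tau>)\<^sup>2 = complex_of_real (h \<tau>)"
    and mat: "\<And>m n. matrix_of_op T m n = (\<integral>x. g x * w m x * cnj (w n x) \<partial>Rpos)"
    and x: "x \<in> ell2"
  shows "T (T x) = hilbert_op x"
proof -
  have g_bound: "cmod (g \<tau>) \<le> sqrt pi" if "\<tau> > 0" for \<tau>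
  proof -
    have "(cmod (g \<tau>))\<^sup>2 = h \<tau>" using g(2)[OF that] h_pos[of \<tau>]
      by (metis abs_of_pos norm_of_real norm_power)
    then show ?thesis using h_le_pi[of \<tau>] real_le_rsqrt by simp
  qed
  have gw: "L2 Rpos (\<lambda>x. g x * w m x)" for m
    by (rule L2_bound[OF w_L2[of m], of _ "sqrt pi"])
      (auto intro!: borel_measurable_times g(1) L2_measurable[OF w_L2] mult_right_mono g_bound simp: norm_mult)
  have row: "matrix_of_op T m n = coefficients (\<lambda>x. g x * w m x) n" for m n
    unfolding mat coefficients_def by (simp only: W.e_real)
  \<comment> \<open>Since the \<open>w n\<close> are real, the matrix is symmetric: rows and columns
    are coefficient sequences of the same functions \<open>g * w m\<close>, and an entry of the
    square is a Parseval series without conjugates.\<close>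
  have sym: "matrix_of_op T m n = coefficients (\<lambda>x. g x * w n x) m" for m n
    unfolding row by (simp add: coefficients_def mult_ac)
  have "matrix_of_op (\<lambda>x. T (T x)) m n = hilbert_matrix m n" for m n
  proof -
    have Te: "T (ell2_basis n) k = coefficients (\<lambda>x. g x * w n x) k" for k
      using sym[of k n] by (simp only: matrix_of_op_def)
    have "T (ell2_basis n) \<in> ell2" by (rule bounded_op_ell2_mem[OF T ell2_basis_in_ell2])
    from bounded_op_ell2_sums[OF T this, of m]
    have "(\<lambda>k. coefficients (\<lambda>x. g x * w m x) k * coefficients (\<lambda>x. g x * w n x) k) sums T (T (ell2_basis n)) m"
      by (simp only: row Te)
    moreover have "(\<lambda>k. coefficients (\<lambda>x. g x * w m x) k * coefficients (\<lambda>x. g x * w n x) k) sums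
        (\<integral>x. (g x * w m x) * (g x * w n x) \<partial>Rpos)"
      by (rule coefficients_sums[OF gw gw])
    moreover have "(\<integral>x. (g x * w m x) * (g x * w n x) \<partial>Rpos) = (\<integral>x. complex_of_real (h x) * w m x * w n x \<partial>Rpos)"
    proof (rule Bochner_Integration.integral_cong[OF refl])
      fix x assume "x \<in> space Rpos"
      then have "g x * g x = complex_of_real (h x)" using g(2)[of x] by (simp add: power2_eq_square)
      then show "(g x * w m x) * (g x * w n x) = complex_of_real (h x) * w m x * w n x"
        by (metis mult.assoc mult.left_commute)
    qed
    ultimately show ?thesis
      unfolding matrix_of_op_def integral_h_w_w by (metis sums_unique2)
  qed
  then show ?thesis
    unfolding hilbert_op_def using bounded_op_ell2_eqI[OF bounded_op_ell2_compose[OF T T] _ x] by blast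
qed

lemma sqrt_of_hilbert_op_matrix:
  assumes T: "bounded_op_ell2 T" and sq: "\<And>x. x \<in> ell2 \<Longrightarrow> T (T x) = hilbert_op x"
  obtains g where "g \<in> borel_measurable Rpos" "\<And>\<tau>. \<tau> > 0 \<Longrightarrow> (g \<tau>)\<^sup>2 = complex_of_real (h \<tau>)"
    "\<And>m n. matrix_of_op T m n = (\<integral>x. g x * w m x * cnj (w n x) \<partial>Rpos)"
proof -
  have mem: "x \<in> ell2 \<Longrightarrow> T x \<in> ell2" for x by (rule bounded_op_ell2_mem[OF T])
  have H_mem: "x \<in> ell2 \<Longrightarrow> hilbert_op x \<in> ell2" for x using mem sq by metis
  \<comment> \<open>Both sides are the cube of \<open>T\<close> applied to \<open>x\<close>.\<close>
  have comm: "x \<in> ell2 \<Longrightarrow> T (hilbert_op x) = hilbert_op (T x)" for x using mem sq by metis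
  have Hj: "(hilbert_op ^^ j) x \<in> ell2 \<and> T ((hilbert_op ^^ j) x) = (hilbert_op ^^ j) (T x)" if "x \<in> ell2" for j x
    by (induction j) (simp_all add: that H_mem comm)
  let ?hp = "\<lambda>j F t. complex_of_real (h t ^ j) * F t"
  have b0: "ell2_basis 0 \<in> ell2" by (rule ell2_basis_in_ell2)
  obtain F where F: "L2 Rpos F" "coefficients F = T (ell2_basis 0)"
    using coefficients_surj[of "T (ell2_basis 0)"] mem[OF b0] unfolding ell2_def by blast
  have "\<exists>v. L2 Rpos v \<and> coefficients v = matrix_of_op T m" for m
    using coefficients_surj[of "matrix_of_op T m"] bounded_op_ell2_row_summable[OF T, of m] by blast
  then obtain v where v: "\<And>m. L2 Rpos (v m)" "\<And>m. coefficients (v m) = matrix_of_op T m" by metis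
  \<comment> \<open>Parseval turns the row expansion of \<open>T\<close> into a pairing with
    \<open>v m\<close>; from here on \<open>T\<close> is handled through integrals.\<close>
  have T_eq: "T (coefficients G) m = (\<integral>t. v m t * G t \<partial>Rpos)" if "L2 Rpos G" for G m
    using bounded_op_ell2_sums[OF T coefficients_in_ell2[OF that], of m] coefficients_sums[OF v(1)[of m] that]
    unfolding v(2) by (rule sums_unique2)
  have hw: "L2 Rpos (?hp j (w 0))" "(hilbert_op ^^ j) (ell2_basis 0) = coefficients (?hp j (w 0))" for j
    using hilbert_op_power_coefficients[OF w_L2[of 0], of j] by (simp_all add: coefficients_w)
  have hF: "L2 Rpos (?hp j F)" "(hilbert_op ^^ j) (T (ell2_basis 0)) = coefficients (?hp j F)" for j
    using hilbert_op_power_coefficients[OF F(1), of j] by (simp_all add: F(2))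
  have int: "integrable Rpos (\<lambda>t. v m t * w 0 t)" "integrable Rpos (\<lambda>t. F t * w m t)" "integrable Rpos (\<lambda>t. v m t * F t)"
    "integrable Rpos (\<lambda>t. complex_of_real (h t) * w 0 t * w 0 t)" for m
    by (rule L2_mult_integrable[OF v(1) w_L2] L2_mult_integrable[OF F(1) w_L2] L2_mult_integrable[OF v(1) F(1)]
        L2_mult_integrable[OF L2_h[OF w_L2] w_L2])+
  have int_h: "integrable Rpos (\<lambda>t. complex_of_real (h t ^ j) * (G t * K t))" if "L2 Rpos G" "L2 Rpos K" for j G K
    using L2_mult_integrable[OF conjunct1[OF hilbert_op_power_coefficients[OF that(1), of j]] that(2)]
    by (simp add: mult.assoc)
  \<comment> \<open>Coordinate m of T H^j e_0 is the integral of h^j v_m w_0. Moving T past H^j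
    makes it coordinate m of H^j T e_0, which is the integral of h^j F w_m.\<close>
  have "AE t in Rpos. v m t * w 0 t - F t * w m t = 0" for m
  proof (rule AE_zero_of_h_moments)
    show "integrable Rpos (\<lambda>t. v m t * w 0 t - F t * w m t)" using int by simp
    fix j
    have "(\<integral>t. v m t * ?hp j (w 0) t \<partial>Rpos) = T ((hilbert_op ^^ j) (ell2_basis 0)) m"
      unfolding hw(2) by (rule T_eq[OF hw(1), symmetric])
    also have "\<dots> = coefficients (?hp j F) m" using Hj[OF b0, of j] hF(2)[of j] by simp
    finally have "(\<integral>t. complex_of_real (h t ^ j) * (v m t * w 0 t) \<partial>Rpos) =
        (\<integral>t. complex_of_real (h t ^ j) * (F t * w m t) \<partial>Rpos)"
      by (simp add: coefficients_def mult_ac)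
    then show "(\<integral>t. complex_of_real (h t ^ j) * (v m t * w 0 t - F t * w m t) \<partial>Rpos) = 0"
      using int_h[OF v(1)[of m] w_L2[of 0], of j] int_h[OF F(1) w_L2[of m], of j]
      by (simp add: right_diff_distrib del: of_real_power)
  qed
  then have ae1: "AE t in Rpos. v m t * w 0 t = F t * w m t" for m by simp
  \<comment> \<open>Coordinate 0 of T H^j T e_0 is the integral of h^j v_0 F, and by commutation
    also coordinate 0 of H^(j+1) e_0. One coordinate is enough, because the first identity will give
    v_0 = F.\<close>
  have "AE t in Rpos. v 0 t * F t - complex_of_real (h t) * w 0 t * w 0 t = 0"
  proof (rule AE_zero_of_h_moments)
    show "integrable Rpos (\<lambda>t. v 0 t * F t - complex_of_real (h t) * w 0 t * w 0 t)" using int by simp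
    fix j
    have "(\<integral>t. v 0 t * ?hp j F t \<partial>Rpos) = T ((hilbert_op ^^ j) (T (ell2_basis 0))) 0"
      unfolding hF(2) by (rule T_eq[OF hF(1), symmetric])
    also have "\<dots> = T (T ((hilbert_op ^^ j) (ell2_basis 0))) 0"
      by (simp only: conjunct2[OF Hj[OF b0]])
    also have "\<dots> = (hilbert_op ^^ Suc j) (ell2_basis 0) 0"
      using sq[OF conjunct1[OF Hj[OF b0, of j]]] by simp
    also have "\<dots> = coefficients (?hp (Suc j) (w 0)) 0" by (simp only: hw(2))
    finally have "(\<integral>t. complex_of_real (h t ^ j) * (v 0 t * F t) \<partial>Rpos) =
        (\<integral>t. complex_of_real (h t ^ j) * (complex_of_real (h t) * w 0 t * w 0 t) \<partial>Rpos)"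
      by (simp add: coefficients_def mult_ac)
    then show "(\<integral>t. complex_of_real (h t ^ j) * (v 0 t * F t - complex_of_real (h t) * w 0 t * w 0 t) \<partial>Rpos) = 0"
      using int_h[OF v(1)[of 0] F(1), of j] int_h[OF L2_h[OF w_L2[of 0]] w_L2[of 0], of j]
      by (simp add: right_diff_distrib del: of_real_power)
  qed
  then have ae2: "AE t in Rpos. v 0 t * F t = complex_of_real (h t) * w 0 t * w 0 t" by simp
  define g0 where "g0 = (\<lambda>t. F t / w 0 t)"
  \<comment> \<open>Almost everywhere this is the quotient \<open>g0\<close>. The positive root is
    substituted where \<open>g0\<close> fails, since the square must equal \<open>h\<close> at every
    point and not just off a null set.\<close>
  define g where "g = (\<lambda>t. if (g0 t)\<^sup>2 = complex_of_real (h t) then g0 t else complex_of_real (sqrt (h t)))"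
  \<comment> \<open>\<open>laguerre_image 0\<close> is the constant 1, so \<open>w 0\<close> is
    \<open>sqrt weight\<close> and division by it is safe for t > 0.\<close>
  have w0: "w 0 t \<noteq> 0" if "t > 0" for t
    using weight_pos[OF that] by (simp add: w_eq laguerre_image_def)
  have ae_g: "AE t in Rpos. g t = g0 t"
  proof (rule AE_mp[OF ae1[of 0] AE_mp[OF ae2]], intro AE_I2 impI)
    fix t assume t: "t \<in> space Rpos" "v 0 t * w 0 t = F t * w 0 t"
      and *: "v 0 t * F t = complex_of_real (h t) * w 0 t * w 0 t"
    \<comment> \<open>Cancelling w_0 in row 0 of the first identity gives v_0 = F, and the second
      one then reads F^2 = h w_0^2.\<close>
    then have "w 0 t \<noteq> 0" "v 0 t = F t" using w0[of t] by auto
    then have "(g0 t)\<^sup>2 = complex_of_real (h t)" using * by (simp add: g0_def power2_eq_square)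
    then show "g t = g0 t" by (simp add: g_def)
  qed
  have [measurable]: "F \<in> borel_measurable Rpos" "\<And>m. w m \<in> borel_measurable Rpos" "\<And>m. v m \<in> borel_measurable Rpos"
    using F(1) w_L2 v(1) by (auto intro: L2_measurable)
  have g0_meas [measurable]: "g0 \<in> borel_measurable Rpos" unfolding g0_def by measurable
  have [measurable]: "(\<lambda>t. complex_of_real (h t)) \<in> borel_measurable Rpos" "(\<lambda>t. complex_of_real (sqrt (h t))) \<in> borel_measurable Rpos"
    by (rule borel_measurable_Rpos, measurable)+
  have g_meas [measurable]: "g \<in> borel_measurable Rpos" unfolding g_def by measurable
  show ?thesis
  proof (rule that[OF g_meas])
    show "(g \<tau>)\<^sup>2 = complex_of_real (h \<tau>)" for \<tau>
      using h_pos[of \<tau>] by (simp add: g_def less_imp_le flip: of_real_power)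
    fix m n
    have "matrix_of_op T m n = (\<integral>t. v m t * w n t \<partial>Rpos)"
      using v(2)[of m] by (simp add: coefficients_def fun_eq_iff)
    also have "\<dots> = (\<integral>t. g t * w m t * w n t \<partial>Rpos)"
    proof (rule integral_cong_AE)
      show "AE t in Rpos. v m t * w n t = g t * w m t * w n t"
      proof (rule AE_mp[OF ae1[of m] AE_mp[OF ae_g]], intro AE_I2 impI)
        fix t assume t: "t \<in> space Rpos" "v m t * w 0 t = F t * w m t" "g t = g0 t"
        then have "w 0 t \<noteq> 0" using w0[of t] by simp
        then have "v m t = g0 t * w m t" using t(2) by (simp add: g0_def field_simps)
        then show "v m t * w n t = g t * w m t * w n t" using t(3) by simp
      qed
    qed measurable
    finally show "matrix_of_op T m n = (\<integral>x. g x * w m x * cnj (w n x) \<partial>Rpos)"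
      by (simp only: W.e_real)
  qed
qed

theorem theorem6p2:
  fixes T :: "(nat \<Rightarrow> complex) \<Rightarrow> (nat \<Rightarrow> complex)"
  assumes "bounded_op_ell2 T"
  shows "(\<forall>x\<in>ell2. T (T x) = hilbert_op x) \<longleftrightarrow>
    (\<exists>g :: real \<Rightarrow> complex.
       g \<in> borel_measurable (lebesgue_on {0<..}) \<and>
       (\<forall>\<tau>>0. (g \<tau>)\<^sup>2 = complex_of_real (h \<tau>)) \<and>
       (\<forall>m n. matrix_of_op T m n =
          (LINT x|lebesgue_on {0<..}. g x * w m x * cnj (w n x))))"
proof (rule iffI, goal_cases)
  case 1
  then obtain g where "g \<in> borel_measurable Rpos" "\<And>\<tau>. \<tau> > 0 \<Longrightarrow> (g \<tau>)\<^sup>2 = complex_of_real (h \<tau>)"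
    "\<And>m n. matrix_of_op T m n = (\<integral>x. g x * w m x * cnj (w n x) \<partial>Rpos)"
    using sqrt_of_hilbert_op_matrix[OF assms] by metis
  then show ?case by (intro exI[of _ g] conjI allI impI)
next
  case 2
  then obtain g where g: "g \<in> borel_measurable Rpos" "\<forall>\<tau>>0. (g \<tau>)\<^sup>2 = complex_of_real (h \<tau>)"
    "\<forall>m n. matrix_of_op T m n = (\<integral>x. g x * w m x * cnj (w n x) \<partial>Rpos)"
    by (elim exE conjE)
  show ?case
    by (rule ballI) (rule op_square_eq_hilbert_op[OF assms g(1) g(2)[rule_format] g(3)[rule_format]])
qed

end
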